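(* Let $d\ge 1$ be an integer, $\sigma\in(0,1)$, $\mathcal L=-\Delta+(-\Delta)^\sigma$ on $\mathbb R^d$, and $p>1$. Consider the problem $$u_t+\mathcal L u=u^p\ \text{ in }\mathbb R^d\times(0,\infty),\qquad u(\cdot,0)=u_0 .$$ This problem has no global (mild) solution for any positive initial datum $u_0\in C_0(\mathbb R^d)\cap L^1(\mathbb R^d)$ (that is, for every such $u_0$ there is no global solution) if and only if $$1<p\le 1+\frac{2\sigma}{d}.$$
   Context: $C_0(\mathbb R^d)$ is the space of continuous functions on $\mathbb R^d$ vanishing at infinity. For $\sigma\in(0,1)$, $(-\Delta)^\sigma v(x)=C_{d,\sigma}\,\mathrm{P.V.}\int_{\mathbb R^d}\frac{v(x)-v(y)}{|x-y|^{d+2\sigma}}\,dy$ with $C_{d,\sigma}=\frac{2^{2\sigma-1}\,2\sigma\,\Gamma(\frac{d+2\sigma}{2})}{\pi^{d/2}\Gamma(1-\sigma)}$ is the fractional Laplacian (Fourier multiplier $|\xi|^{2\sigma}$). The heat semigroup generated by $-\mathcal L$ is $e^{-t\mathcal L}\phi(x)=\int_{\mathbb R^d}p_t(x-y)\phi(y)\,dy$, where $p_t(x)=(4\pi t)^{-d/2}\int_{\mathbb R^d}e^{-|x-\xi|^2/(4t)}H^\sigma_t(\xi)\,d\xi$ for $t>0$, and $H_t^\sigma$ is the heat kernel of $(-\Delta)^\sigma$. Mild solution of $u_t+\mathcal L u=h(t)f(u)$, $u(\cdot,0)=u_0$ (here $h\equiv1$, $f(u)=u^p$): for nonnegative nontrivial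 $u_0\in L^\infty(\mathbb R^d)$ there is a nonnegative local-in-time mild solution $u\in C([0,T_{\max});L^\infty(\mathbb R^d))$ with maximal existence time $T_{\max}\le\infty$, i.e. $u(x,t)=e^{-t\mathcal L}u_0(x)+\int_0^t e^{-(t-s)\mathcal L}h(s)f(u(x,s))\,ds$ for all $t\in[0,T_{\max})$. It is global if $T_{\max}=\infty$; it blows up in finite time if $T_{\max}<\infty$, in which case $\lim_{t\to T_{\max}}\|u(\cdot,t)\|_{L^\infty(\mathbb R^d)}=\infty$. *)

theory Defs
  imports "HOL-Probability.Probability" "HOL-Probability.Essential_Supremum"
begin

text \<open>
  The Euclidean space \<open>\<real>\<^sup>d\<close> is a type \<open>'a\<close> of class \<open>euclidean_space\<close>, with \<open>d = DIM('a)\<close>.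
  The heat kernel of the fractional Laplacian, that is, of the Fourier multiplier
  \<open>|\<xi>|\<^sup>2\<^sup>\<sigma>\<close>, is the inverse Fourier transform of \<open>exp (- t |\<xi>|\<^sup>2\<^sup>\<sigma>)\<close>. The transform
  is real-valued because the symbol is even, so taking the real part loses nothing.
\<close>

definition frac_heat_kernel :: "real \<Rightarrow> real \<Rightarrow> 'a::euclidean_space \<Rightarrow> real" where
  "frac_heat_kernel \<sigma> t x =
     Re ((LINT \<xi>|lborel. exp (\<i> * complex_of_real (x \<bullet> \<xi>))
                         * complex_of_real (exp (- t * norm \<xi> powr (2 * \<sigma>))))
         / complex_of_real ((2 * pi) ^ DIM('a)))"

definition mixed_heat_kernel :: "real \<Rightarrow> real \<Rightarrow> 'a::euclidean_space \<Rightarrow> real" where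
  "mixed_heat_kernel \<sigma> t x =
     (4 * pi * t) powr (- real DIM('a) / 2)
     * (LINT \<xi>|lborel. exp (- (norm (x - \<xi>))\<^sup>2 / (4 * t)) * frac_heat_kernel \<sigma> t \<xi>)"

text \<open>
  The semigroup \<open>exp (- t L)\<close> for \<open>L = - \<Delta> + (- \<Delta>)\<^sup>\<sigma>\<close>. The kernel exists only for \<open>t > 0\<close>; at
  \<open>t = 0\<close> the semigroup is the identity. Negative times are never used.
\<close>

definition mixed_semigroup ::
    "real \<Rightarrow> real \<Rightarrow> ('a::euclidean_space \<Rightarrow> real) \<Rightarrow> 'a \<Rightarrow> real" where
  "mixed_semigroup \<sigma> t \<phi> x =
     (if t > 0 then LINT y|lborel. mixed_heat_kernel \<sigma> t (x - y) * \<phi> y else \<phi> x)"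

definition C0 :: "('a::euclidean_space \<Rightarrow> real) set" where
  "C0 = {f. continuous_on UNIV f \<and> (f \<longlongrightarrow> 0) at_infinity}"

definition Linf_norm :: "('a::euclidean_space \<Rightarrow> real) \<Rightarrow> ereal" where
  "Linf_norm f = esssup lborel (\<lambda>x. ereal \<bar>f x\<bar>)"

definition Linf :: "('a::euclidean_space \<Rightarrow> real) set" where
  "Linf = {f \<in> borel_measurable lborel. Linf_norm f < \<infinity>}"

text \<open>
  \<open>u t x\<close> is the value at time \<open>t\<close> and point \<open>x\<close>. Elements of \<open>L\<^sup>\<infinity>\<close> are represented by Borel
  functions, so relations between them hold almost everywhere. Continuity of
  \<open>u\<close> in \<open>L\<^sup>\<infinity>\<close> makes the integrand in \<open>s\<close> bounded and, for every \<open>x\<close>, continuous on \<open>[0, t)\<close>,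
  so the time integral always converges absolutely.
\<close>

definition mild_solution ::
    "real \<Rightarrow> real \<Rightarrow> ('a::euclidean_space \<Rightarrow> real) \<Rightarrow> ereal \<Rightarrow> (real \<Rightarrow> 'a \<Rightarrow> real) \<Rightarrow> bool" where
  "mild_solution \<sigma> p u0 T u \<longleftrightarrow>
     (let I = {t. 0 \<le> t \<and> ereal t < T} in
       (\<forall>t\<in>I. u t \<in> Linf \<and> (AE x in lborel. 0 \<le> u t x)) \<and>
       (\<forall>t\<in>I. ((\<lambda>s. Linf_norm (\<lambda>x. u s x - u t x)) \<longlongrightarrow> 0) (at t within I)) \<and>
       (\<forall>t\<in>I. AE x in lborel.
          u t x = mixed_semigroup \<sigma> t u0 x
            + (LINT s:{0..t}|lborel. mixed_semigroup \<sigma> (t - s) (\<lambda>y. u s y powr p) x)))"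

definition has_global_solution ::
    "real \<Rightarrow> real \<Rightarrow> ('a::euclidean_space \<Rightarrow> real) \<Rightarrow> bool" where
  "has_global_solution \<sigma> p u0 \<longleftrightarrow> (\<exists>u. mild_solution \<sigma> p u0 \<infinity> u)"

end

theory Submission
  imports Defs "HOL-Real_Asymp.Real_Asymp"
begin

text \<open>
  The semigroup has the kernel with Fourier transform \<open>exp (- t |\<xi>|\<^sup>2 - t |\<xi>|\<^sup>2\<^sup>\<sigma>)\<close>, a probability
  density that decays like \<open>t\<close> to the power \<open>- q\<close>, with \<open>q = d / (2\<sigma>)\<close>, and that is at least a
  multiple of this on the ball of radius of order \<open>t\<close> to the power \<open>1 / (2\<sigma>)\<close>. Positivity comes from the
  binomial series: \<open>- (1 - y)\<^sup>\<sigma>\<close> has nonnegative coefficients apart from the constant term, so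
  \<open>exp (- c (1 - exp (- s |\<xi>|\<^sup>2))\<^sup>\<sigma>)\<close> is a limit of positive combinations of Gaussians, and
  \<open>n (1 - exp (- |\<xi>|\<^sup>2 / n))\<close> tends to \<open>|\<xi>|\<^sup>2\<close>.

  If \<open>q (p - 1) \<le> 1\<close> and \<open>u\<close> is a global solution, let \<open>J(t)\<close> be the value at the origin of the semigroup
  at time \<open>T - t\<close> applied to \<open>u(t)\<close>. By Duhamel's formula and Jensen's inequality \<open>J' \<ge> J\<^sup>p\<close> on \<open>(0, T)\<close>, so
  \<open>J(t)\<close> is at most of order \<open>t\<close> to the power \<open>- 1 / (p - 1) \<le> - q\<close> when \<open>T = 2t\<close>. The lower bounds on the
  kernel and on \<open>u\<close>, inserted into Duhamel's formula, make \<open>J(t)\<close> larger than this by a factor \<open>ln t\<close>.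

  If \<open>q (p - 1) > 1\<close>, take \<open>u\<^sub>0\<close> a small multiple \<open>\<epsilon>\<close> of a Gaussian and let \<open>\<epsilon> V(t)\<close> be its free evolution.
  Since the supremum of \<open>V(t)\<close> to the power \<open>p - 1\<close> is integrable in time, \<open>2 \<epsilon> V\<close> is a
  supersolution, and the monotone iteration below it converges to a global solution.
\<close>

section \<open>Gaussian integrals\<close>

text \<open>No spatial decay of the mixed kernel is ever proved: only its mass, its supremum and its
  size on a central ball are known, and every argument is shaped so that these suffice. Continuity
  of the semigroup in time comes from Scheffe's lemma for probability densities, and the lower bound
  from comparing the cosine with 1. The two diffusions scale differently, so the kernel is not
  self-similar. Rescaling always normalises the fractional part, since \<sigma> < 1 makes it
  dominate at large times: for the upper bound the Laplacian part is dropped, and for the lower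
  bound its rescaled time is at most 1. This is why only \<sigma> and the dimension enter the
  threshold. The differential inequality with the free lower bound for J contradicts existence only
  strictly below the threshold. At the threshold both sides carry the same power of t and only
  constants differ. The horizon 2t keeps 2t - s of order t for all s \<le> t, so that the source at
  time s contributes at least a multiple of t to the power -q divided by s; integrating over s gains
  the logarithm that settles both cases at once.\<close>

lemma
  fixes f :: "'a::euclidean_space \<Rightarrow> real \<Rightarrow> 'b::{real_normed_field,banach,second_countable_topology}"
  assumes f: "\<And>b. b \<in> Basis \<Longrightarrow> integrable lborel (f b)"
  shows integrable_lborel_prod: "integrable lborel (\<lambda>x::'a. \<Prod>b\<in>Basis. f b (x \<bullet> b))"
    and integral_lborel_prod:
      "(\<integral>x. (\<Prod>b\<in>Basis. f b (x \<bullet> b)) \<partial>(lborel :: 'a measure)) = (\<Prod>b\<in>Basis. integral\<^sup>L lborel (f b))"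
proof -
  interpret product_sigma_finite "\<lambda>_::'a. lborel :: real measure" by standard
  have m: "f b \<in> borel_measurable borel" if "b \<in> Basis" for b
    using f[OF that] by (simp add: integrable_iff_bounded)
  have meas: "(\<lambda>x::'a. \<Prod>b\<in>Basis. f b (x \<bullet> b)) \<in> borel_measurable borel"
    by (intro borel_measurable_prod measurable_compose[OF _ m]) auto
  have *: "(\<Prod>b\<in>Basis. f b ((\<Sum>i\<in>Basis. g i *\<^sub>R i) \<bullet> b)) = (\<Prod>b\<in>Basis. f b (g b))" for g :: "'a \<Rightarrow> real"
    by (intro prod.cong refl) simp
  have T: "(\<lambda>f. \<Sum>b\<in>Basis. f b *\<^sub>R b) \<in> (\<Pi>\<^sub>M b\<in>(Basis::'a set). (lborel :: real measure)) \<rightarrow>\<^sub>M borel"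
    by simp
  show "integrable lborel (\<lambda>x::'a. \<Prod>b\<in>Basis. f b (x \<bullet> b))"
    by (subst lborel_eq, subst integrable_distr_eq[OF T meas], subst *)
       (intro product_integrable_prod f finite_Basis)
  show "(\<integral>x. (\<Prod>b\<in>Basis. f b (x \<bullet> b)) \<partial>(lborel :: 'a measure)) = (\<Prod>b\<in>Basis. integral\<^sup>L lborel (f b))"
    by (subst lborel_eq, subst integral_distr[OF T meas], subst *)
       (intro product_integral_prod f finite_Basis)
qed

lemma
  fixes f :: "'a::euclidean_space \<Rightarrow> real" and c :: real
  assumes c: "c \<noteq> 0"
  shows integrable_lborel_affine: "integrable lborel f \<Longrightarrow> integrable lborel (\<lambda>x. f (t + c *\<^sub>R x))"
    and integral_lborel_affine:
      "f \<in> borel_measurable borel \<Longrightarrow>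
        (\<integral>x. f x \<partial>lborel) = \<bar>c\<bar> ^ DIM('a) * (\<integral>x. f (t + c *\<^sub>R x) \<partial>lborel)"
proof -
  show "integrable lborel (\<lambda>x. f (t + c *\<^sub>R x))" if f: "integrable lborel f"
  proof -
    have [measurable]: "f \<in> borel_measurable borel"
      using f by (simp add: integrable_iff_bounded)
    show ?thesis
      using f c by (subst (asm) lborel_affine[OF c, of t])
        (simp add: integrable_density integrable_distr_eq)
  qed
  show "(\<integral>x. f x \<partial>lborel) = \<bar>c\<bar> ^ DIM('a) * (\<integral>x. f (t + c *\<^sub>R x) \<partial>lborel)"
    if [measurable]: "f \<in> borel_measurable borel"
    by (subst lborel_affine[OF c, of t]) (simp add: integral_density integral_distr)
qed

lemma gaussian_fourier_real:
  fixes a x :: real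
  assumes "0 < a"
  shows "integrable lborel (\<lambda>z. iexp (x * z) * complex_of_real (exp (- a * z\<^sup>2)))" (is ?I)
    and "(LBINT z. iexp (x * z) * complex_of_real (exp (- a * z\<^sup>2)))
       = complex_of_real (sqrt (pi / a) * exp (- x\<^sup>2 / (4 * a)))" (is ?E)
proof -
  \<comment> \<open>This rescaling turns the Gaussian into the standard normal density, whose
    characteristic function is known.\<close>
  define c where "c = sqrt (2 * a)"
  have c: "c > 0" "c\<^sup>2 = 2 * a" using assms by (auto simp: c_def)
  define g where "g = (\<lambda>z. std_normal_density z *\<^sub>R iexp (x / c * z))"
  have g: "integrable lborel g"
    unfolding g_def by (rule Bochner_Integration.integrable_bound[OF integrable_normal_density[where \<mu>=0 and \<sigma>=1]])
       auto
  have gi: "integral\<^sup>L lborel g = complex_of_real (exp (- (x / c)\<^sup>2 / 2))"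
    using fun_cong[OF char_std_normal_distribution, of "x / c"]
    by (simp add: char_def g_def integral_density)
  have eq: "iexp (x * z) * complex_of_real (exp (- a * z\<^sup>2)) = sqrt (2 * pi) *\<^sub>R g (0 + c * z)" for z
    using c by (simp add: g_def std_normal_density_def power_mult_distrib scaleR_conv_of_real mult_ac)
  show ?I unfolding eq using lborel_integrable_real_affine[OF g, of c 0] c by simp
  have "(LBINT z. iexp (x * z) * complex_of_real (exp (- a * z\<^sup>2))) 
      = sqrt (2 * pi) *\<^sub>R (LBINT z. g (0 + c * z))"
    unfolding eq by simp
  also have "(LBINT z. g (0 + c * z)) = (1 / c) *\<^sub>R integral\<^sup>L lborel g"
    using lborel_integral_real_affine[of c g 0] c by simp
  also have "sqrt (2 * pi) *\<^sub>R (1 / c) *\<^sub>R integral\<^sup>L lborel g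
      = complex_of_real (sqrt (2 * pi) / c * exp (- (x / c)\<^sup>2 / 2))"
    by (simp add: gi scaleR_conv_of_real)
  also have "sqrt (2 * pi) / c = sqrt (pi / a)"
    using assms by (simp add: c_def real_sqrt_divide[symmetric])
  also have "- (x / c)\<^sup>2 / 2 = - x\<^sup>2 / (4 * a)" using c by (simp add: power_divide)
  finally show ?E by simp
qed

lemma norm_sq_sum_Basis: "(norm (x::'a::euclidean_space))\<^sup>2 = (\<Sum>b\<in>Basis. (x \<bullet> b)\<^sup>2)"
  by (subst power2_norm_eq_inner, subst euclidean_inner) (simp add: power2_eq_square)

lemma
  fixes x :: "'a::euclidean_space"
  assumes a: "0 < a"
  shows integrable_gaussian: "integrable lborel (\<lambda>\<xi>::'a. exp (- a * (norm \<xi>)\<^sup>2))"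
    and integral_gaussian_cos: "(\<integral>\<xi>. cos (x \<bullet> \<xi>) * exp (- a * (norm \<xi>)\<^sup>2) \<partial>lborel)
       = (pi / a) powr (DIM('a) / 2) * exp (- (norm x)\<^sup>2 / (4 * a))"
proof -
  \<comment> \<open>The complex exponential, unlike the cosine, is a product over the coordinates;
    the real part is taken only at the end.\<close>
  have eq: "(\<Prod>b\<in>Basis. iexp ((x \<bullet> b) * (\<xi> \<bullet> b)) * complex_of_real (exp (- a * (\<xi> \<bullet> b)\<^sup>2)))
      = iexp (x \<bullet> \<xi>) * complex_of_real (exp (- a * (norm \<xi>)\<^sup>2))" for x \<xi> :: 'a
    unfolding prod.distrib of_real_prod[symmetric] norm_sq_sum_Basis exp_sum[OF finite_Basis, symmetric]
      sum_distrib_left[symmetric] euclidean_inner[of x \<xi>] of_real_sum[symmetric] by (simp add: sum_distrib_left)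
  have I: "integrable lborel (\<lambda>\<xi>. iexp (x \<bullet> \<xi>) * complex_of_real (exp (- a * (norm \<xi>)\<^sup>2)))" for x :: 'a
    using integrable_lborel_prod[of "\<lambda>b z. iexp ((x \<bullet> b) * z) * complex_of_real (exp (- a * z\<^sup>2))"]
      gaussian_fourier_real(1)[OF a] unfolding eq by blast
  show "integrable lborel (\<lambda>\<xi>::'a. exp (- a * (norm \<xi>)\<^sup>2))"
    using integrable_Re[OF I[of 0]] by simp
  have "(\<integral>\<xi>. iexp (x \<bullet> \<xi>) * complex_of_real (exp (- a * (norm \<xi>)\<^sup>2)) \<partial>lborel)
     = (\<Prod>b\<in>Basis. LBINT z. iexp ((x \<bullet> b) * z) * complex_of_real (exp (- a * z\<^sup>2)))"
    using integral_lborel_prod[of "\<lambda>b z. iexp ((x \<bullet> b) * z) * complex_of_real (exp (- a * z\<^sup>2))"]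
      gaussian_fourier_real(1)[OF a] unfolding eq by blast
  also have "\<dots> = (\<Prod>b\<in>(Basis::'a set). complex_of_real (sqrt (pi / a) * exp (- (x \<bullet> b)\<^sup>2 / (4 * a))))"
    by (simp only: gaussian_fourier_real(2)[OF a])
  also have "\<dots> = complex_of_real (sqrt (pi / a) ^ DIM('a) * exp (- (norm x)\<^sup>2 / (4 * a)))"
    unfolding of_real_prod[symmetric] prod.distrib norm_sq_sum_Basis exp_sum[OF finite_Basis, symmetric]
    by (simp add: sum_divide_distrib sum_negf)
  also have "sqrt (pi / a) ^ DIM('a) = (pi / a) powr (DIM('a) / 2)"
    using a by (simp add: powr_half_sqrt[symmetric] powr_realpow[symmetric] powr_powr)
  finally have "Re (\<integral>\<xi>. iexp (x \<bullet> \<xi>) * complex_of_real (exp (- a * (norm \<xi>)\<^sup>2)) \<partial>lborel)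
      = (pi / a) powr (DIM('a) / 2) * exp (- (norm x)\<^sup>2 / (4 * a))" by simp
  moreover have "Re (iexp (x \<bullet> \<xi>) * complex_of_real (exp (- a * (norm \<xi>)\<^sup>2)))
      = cos (x \<bullet> \<xi>) * exp (- a * (norm \<xi>)\<^sup>2)" for \<xi>
    by (simp add: Re_exp)
  ultimately show "(\<integral>\<xi>. cos (x \<bullet> \<xi>) * exp (- a * (norm \<xi>)\<^sup>2) \<partial>lborel)
       = (pi / a) powr (DIM('a) / 2) * exp (- (norm x)\<^sup>2 / (4 * a))"
    using integral_Re[OF I[of x]] by simp
qed

text \<open>Each of the d factors \<open>1 + (x \<bullet> b)\<^sup>2\<close> is at most
  \<open>1 + (norm x)\<^sup>2\<close>, so a product of one-dimensional integrable functions
  dominates. It serves as the common majorant for everything with fast decay.\<close>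

lemma integrable_inverse_one_plus_norm_sq:
  "integrable lborel (\<lambda>x::'a::euclidean_space. inverse ((1 + (norm x)\<^sup>2) ^ DIM('a)))"
proof -
  have 1: "integrable lborel (\<lambda>x::real. inverse (1 + x\<^sup>2))"
    using integrable_inverse_1_plus_square by (simp add: set_integrable_def)
  show ?thesis
  proof (rule Bochner_Integration.integrable_bound[OF integrable_lborel_prod])
    show "integrable lborel ((\<lambda>_ (x::real). inverse (1 + x\<^sup>2)) (b::'a))" for b :: 'a
      using 1 by simp
    have "inverse ((1 + (norm x)\<^sup>2) ^ DIM('a)) \<le> (\<Prod>b\<in>Basis. inverse (1 + (x \<bullet> b)\<^sup>2))" for x :: 'a
    proof -
      have "(\<Prod>b\<in>Basis. 1 + (x \<bullet> b)\<^sup>2) \<le> (\<Prod>b\<in>(Basis::'a set). 1 + (norm x)\<^sup>2)"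
      proof (intro prod_mono conjI)
        fix b :: 'a assume b: "b \<in> Basis"
        show "1 + (x \<bullet> b)\<^sup>2 \<le> 1 + (norm x)\<^sup>2"
          using Basis_le_norm[OF b, of x] by (simp add: abs_le_square_iff[symmetric])
      qed simp
      moreover have "(\<Prod>b\<in>Basis. 1 + (x \<bullet> b)\<^sup>2) > 0" by (intro prod_pos) (simp add: add_pos_nonneg)
      ultimately show ?thesis
        using prod_inversef[of "\<lambda>b. 1 + (x \<bullet> b)\<^sup>2" "Basis::'a set"]
        by (simp add: le_imp_inverse_le comp_def)
    qed
    then show "AE x in lborel. norm (inverse ((1 + (norm x)\<^sup>2) ^ DIM('a)))
        \<le> norm (\<Prod>b\<in>Basis. inverse (1 + ((x::'a) \<bullet> b)\<^sup>2))"
      by (auto intro!: AE_I2 simp: abs_of_nonneg prod_nonneg simp del: power_inverse)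
  qed measurable
qed

text \<open>The factor \<open>1 + r\<close> is carried along so that the same bound yields a finite
  first moment of the symbol, which \<open>ker_lower_bound\<close> needs.\<close>

lemma exp_neg_powr_decay:
  fixes t q :: real
  assumes "0 < t" "0 < q"
  shows "\<exists>C. \<forall>r\<ge>0. (1 + r) * exp (- t * r powr q) \<le> C * inverse ((1 + r\<^sup>2) ^ d)"
proof -
  \<comment> \<open>The power \<open>s ^ k\<close> has degree \<open>q * k\<close> in
    \<open>r\<close> and must beat degree \<open>2 * d + 1\<close>: \<open>2 * d\<close> from the
    weight, 1 from the factor \<open>1 + r\<close>. The exponential then absorbs
    \<open>s ^ k / fact k\<close>.\<close>
  obtain k :: nat where k: "(2 * d + 1) / q \<le> real k" using real_arch_simple by blast
  hence k': "real (2 * d + 1) \<le> q * real k" using assms by (simp add: field_simps)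
  define C where "C = 2 * 2 ^ d + 2 * 2 ^ d * (fact k / t ^ k)"
  have "(1 + r\<^sup>2) ^ d * (1 + r) * exp (- t * r powr q) \<le> C" if r: "r \<ge> 0" for r
  proof (cases "r \<le> 1")
    case True
    have "(1 + r\<^sup>2) ^ d * (1 + r) * exp (- t * r powr q) \<le> 2 ^ d * 2 * 1"
      using r True assms by (intro mult_mono power_mono) (auto simp: power_le_one)
    also have "\<dots> \<le> C" using assms by (simp add: C_def)
    finally show ?thesis .
  next
    case False
    hence r1: "r > 1" by simp
    define s where "s = t * r powr q"
    have s: "s \<ge> 0" using assms by (simp add: s_def)
    have "(1 + r\<^sup>2) ^ d * (1 + r) \<le> (2 * r\<^sup>2) ^ d * (2 * r)"
      using r1 one_le_power[of r 2] by (intro mult_mono power_mono) auto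
    also have "\<dots> = 2 * 2 ^ d * r powr (real (2 * d + 1))"
      using r1 by (simp add: powr_realpow[of r "2 * d", simplified] powr_add power_mult power_mult_distrib)
    also have "\<dots> \<le> 2 * 2 ^ d * r powr (q * real k)"
      using r1 k' by (intro mult_left_mono powr_mono) auto
    also have "r powr (q * real k) = s ^ k / t ^ k"
      using r1 assms by (simp add: s_def power_mult_distrib powr_powr[symmetric] powr_realpow)
    also have "s ^ k / t ^ k \<le> fact k * exp s / t ^ k"
    proof -
      have "s ^ k / fact k \<le> exp s"
        using sum_le_suminf[OF summable_exp_generic[of s], of "{k}"] s by (simp add: exp_def divide_inverse mult.commute)
      thus ?thesis using assms by (simp add: field_simps divide_right_mono)
    qed
    finally have "(1 + r\<^sup>2) ^ d * (1 + r) \<le> 2 * 2 ^ d * (fact k / t ^ k) * exp s" by simp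
    hence "(1 + r\<^sup>2) ^ d * (1 + r) * exp (- s) \<le> 2 * 2 ^ d * (fact k / t ^ k)"
      by (simp add: exp_minus field_simps)
    thus ?thesis by (simp add: s_def C_def add_increasing)
  qed
  thus ?thesis
    by (intro exI[of _ C] allI impI)
       (simp add: field_simps add_pos_nonneg)
qed

section \<open>Functions with nonnegative Fourier transform\<close>

text \<open>
  For even functions this is positive definiteness. The Gaussian factor makes the integral converge
  without a decay assumption on \<open>\<phi>\<close>, and it makes the class closed under multiplication by Gaussians.
\<close>

definition pos_cos :: "('a::euclidean_space \<Rightarrow> real) \<Rightarrow> bool" where
  "pos_cos \<phi> \<longleftrightarrow> \<phi> \<in> borel_measurable borel \<and> (\<exists>B. \<forall>\<xi>. \<bar>\<phi> \<xi>\<bar> \<le> B) \<and>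
     (\<forall>a>0. \<forall>x. 0 \<le> (\<integral>\<xi>. cos (x \<bullet> \<xi>) * (exp (- a * (norm \<xi>)\<^sup>2) * \<phi> \<xi>) \<partial>lborel))"

lemma integrable_cos_gaussian_bounded:
  fixes x :: "'a::euclidean_space"
  assumes [measurable]: "\<phi> \<in> borel_measurable borel" and B: "\<And>\<xi>. \<bar>\<phi> \<xi>\<bar> \<le> B" and a: "0 < a"
  shows "integrable lborel (\<lambda>\<xi>. cos (x \<bullet> \<xi>) * (exp (- a * (norm \<xi>)\<^sup>2) * \<phi> \<xi>))"
proof (rule Bochner_Integration.integrable_bound[OF integrable_mult_right[OF integrable_gaussian[OF a], of B]])
  show "AE \<xi> in lborel. norm (cos (x \<bullet> \<xi>) * (exp (- a * (norm \<xi>)\<^sup>2) * \<phi> \<xi>))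
          \<le> norm (B * exp (- a * (norm \<xi>)\<^sup>2))"
  proof (rule AE_I2)
    fix \<xi> :: 'a
    have "\<bar>cos (x \<bullet> \<xi>)\<bar> * (exp (- a * (norm \<xi>)\<^sup>2) * \<bar>\<phi> \<xi>\<bar>) \<le> 1 * (exp (- a * (norm \<xi>)\<^sup>2) * B)"
      using B by (intro mult_mono) auto
    moreover have "0 \<le> B" using B[of 0] by (meson abs_ge_zero order_trans)
    ultimately show "norm (cos (x \<bullet> \<xi>) * (exp (- a * (norm \<xi>)\<^sup>2) * \<phi> \<xi>)) \<le> norm (B * exp (- a * (norm \<xi>)\<^sup>2))"
      by (simp add: abs_mult mult.commute)
  qed
qed measurable

lemma pos_cosD:
  assumes "pos_cos \<phi>" "0 < a"
  shows "0 \<le> (\<integral>\<xi>. cos (x \<bullet> \<xi>) * (exp (- a * (norm \<xi>)\<^sup>2) * \<phi> \<xi>) \<partial>lborel)"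
  using assms by (auto simp: pos_cos_def)

lemma pos_cos_1: "pos_cos (\<lambda>_::'a::euclidean_space. 1)"
proof -
  have "0 \<le> (\<integral>\<xi>. cos (x \<bullet> \<xi>) * exp (- a * (norm \<xi>)\<^sup>2) \<partial>lborel)" if "0 < a" for a :: real and x :: 'a
    by (subst integral_gaussian_cos[OF that]) simp
  thus ?thesis unfolding pos_cos_def by auto
qed

lemma pos_cos_add:
  assumes "pos_cos \<phi>" "pos_cos \<psi>"
  shows "pos_cos (\<lambda>\<xi>::'a::euclidean_space. \<phi> \<xi> + \<psi> \<xi>)"
proof -
  obtain B C where B: "\<And>\<xi>. \<bar>\<phi> \<xi>\<bar> \<le> B" and C: "\<And>\<xi>. \<bar>\<psi> \<xi>\<bar> \<le> C"
    and [measurable]: "\<phi> \<in> borel_measurable borel" "\<psi> \<in> borel_measurable borel"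
    using assms by (auto simp: pos_cos_def)
  have "\<bar>\<phi> \<xi> + \<psi> \<xi>\<bar> \<le> B + C" for \<xi> using B[of \<xi>] C[of \<xi>] by linarith
  moreover have "0 \<le> (\<integral>\<xi>. cos (x \<bullet> \<xi>) * (exp (- a * (norm \<xi>)\<^sup>2) * (\<phi> \<xi> + \<psi> \<xi>)) \<partial>lborel)" if "0 < a" for a x
    using pos_cosD[OF assms(1) that, of x] pos_cosD[OF assms(2) that, of x]
      integrable_cos_gaussian_bounded[OF _ B that, where x=x] integrable_cos_gaussian_bounded[OF _ C that, where x=x]
    by (simp add: distrib_left)
  ultimately show ?thesis unfolding pos_cos_def by auto
qed

lemma pos_cos_scale:
  assumes "pos_cos \<phi>" "0 \<le> (c::real)"
  shows "pos_cos (\<lambda>\<xi>::'a::euclidean_space. c * \<phi> \<xi>)"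
proof -
  obtain B where B: "\<And>\<xi>. \<bar>\<phi> \<xi>\<bar> \<le> B" and [measurable]: "\<phi> \<in> borel_measurable borel"
    using assms by (auto simp: pos_cos_def)
  have "\<bar>c * \<phi> \<xi>\<bar> \<le> c * B" for \<xi> using B[of \<xi>] assms by (simp add: abs_mult mult_left_mono)
  moreover have "0 \<le> (\<integral>\<xi>. cos (x \<bullet> \<xi>) * (exp (- a * (norm \<xi>)\<^sup>2) * (c * \<phi> \<xi>)) \<partial>lborel)" if "0 < a" for a x
    using pos_cosD[OF assms(1) that, of x] assms(2) by (simp add: mult.left_commute[of _ c])
  ultimately show ?thesis unfolding pos_cos_def by auto
qed

lemma pos_cos_gaussian_mult:
  assumes "pos_cos \<phi>" "0 \<le> s"
  shows "pos_cos (\<lambda>\<xi>::'a::euclidean_space. exp (- s * (norm \<xi>)\<^sup>2) * \<phi> \<xi>)"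
proof -
  obtain B where B: "\<And>\<xi>. \<bar>\<phi> \<xi>\<bar> \<le> B" and [measurable]: "\<phi> \<in> borel_measurable borel"
    using assms by (auto simp: pos_cos_def)
  have "\<bar>exp (- s * (norm \<xi>)\<^sup>2) * \<phi> \<xi>\<bar> \<le> 1 * B" for \<xi>
    unfolding abs_mult using B[of \<xi>] assms by (intro mult_mono) auto
  moreover have eq: "exp (- a * (norm \<xi>)\<^sup>2) * (exp (- s * (norm \<xi>)\<^sup>2) * \<phi> \<xi>) = exp (- (a + s) * (norm \<xi>)\<^sup>2) * \<phi> \<xi>" for a and \<xi> :: 'a
    by (simp add: algebra_simps exp_add exp_diff exp_minus inverse_eq_divide)
  moreover have "0 \<le> (\<integral>\<xi>. cos (x \<bullet> \<xi>) * (exp (- (a + s) * (norm \<xi>)\<^sup>2) * \<phi> \<xi>) \<partial>lborel)" if "0 < a" for a x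
    by (rule pos_cosD[OF assms(1)]) (use assms(2) that in simp)
  ultimately show ?thesis unfolding pos_cos_def eq by auto
qed

text \<open>Dominated convergence against the Gaussian factor. Convergence is asked for almost
  everywhere only, because the binomial series below is summed away from the frequency 0.\<close>

lemma pos_cos_limit:
  fixes \<phi> :: "'a::euclidean_space \<Rightarrow> real"
  assumes F: "\<And>n. pos_cos (F n)" and B: "\<And>n. AE \<xi> in lborel. \<bar>F n \<xi>\<bar> \<le> B"
    and lim: "AE \<xi> in lborel. (\<lambda>n. F n \<xi>) \<longlonglongrightarrow> \<phi> \<xi>"
    and [measurable]: "\<phi> \<in> borel_measurable borel" and bd: "\<And>\<xi>. \<bar>\<phi> \<xi>\<bar> \<le> C"
  shows "pos_cos \<phi>"
  unfolding pos_cos_def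
proof (intro conjI allI impI)
  fix a :: real and x :: 'a assume a: "0 < a"
  have [measurable]: "F n \<in> borel_measurable borel" for n using F by (auto simp: pos_cos_def)
  have "(\<lambda>n. \<integral>\<xi>. cos (x \<bullet> \<xi>) * (exp (- a * (norm \<xi>)\<^sup>2) * F n \<xi>) \<partial>lborel)
     \<longlonglongrightarrow> (\<integral>\<xi>. cos (x \<bullet> \<xi>) * (exp (- a * (norm \<xi>)\<^sup>2) * \<phi> \<xi>) \<partial>lborel)"
  proof (rule integral_dominated_convergence[where w="\<lambda>\<xi>. \<bar>B\<bar> * exp (- a * (norm \<xi>)\<^sup>2)"])
    show "integrable lborel (\<lambda>\<xi>::'a. \<bar>B\<bar> * exp (- a * (norm \<xi>)\<^sup>2))"
      using integrable_gaussian[OF a, where 'a='a] by simp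
    show "AE \<xi> in lborel. (\<lambda>n. cos (x \<bullet> \<xi>) * (exp (- a * (norm \<xi>)\<^sup>2) * F n \<xi>))
       \<longlonglongrightarrow> cos (x \<bullet> \<xi>) * (exp (- a * (norm \<xi>)\<^sup>2) * \<phi> \<xi>)"
      using lim by eventually_elim (intro tendsto_intros)
    show "AE \<xi> in lborel. norm (cos (x \<bullet> \<xi>) * (exp (- a * (norm \<xi>)\<^sup>2) * F n \<xi>)) \<le> \<bar>B\<bar> * exp (- a * (norm \<xi>)\<^sup>2)" for n
      using B[of n]
    proof eventually_elim
      case (elim \<xi>)
      have "\<bar>cos (x \<bullet> \<xi>)\<bar> * (exp (- a * (norm \<xi>)\<^sup>2) * \<bar>F n \<xi>\<bar>) \<le> 1 * (exp (- a * (norm \<xi>)\<^sup>2) * \<bar>B\<bar>)"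
        using elim by (intro mult_mono) auto
      thus ?case by (simp add: abs_mult mult.commute)
    qed
  qed measurable
  moreover have "0 \<le> (\<integral>\<xi>. cos (x \<bullet> \<xi>) * (exp (- a * (norm \<xi>)\<^sup>2) * F n \<xi>) \<partial>lborel)" for n
    by (rule pos_cosD[OF F a])
  ultimately show "0 \<le> (\<integral>\<xi>. cos (x \<bullet> \<xi>) * (exp (- a * (norm \<xi>)\<^sup>2) * \<phi> \<xi>) \<partial>lborel)"
    by (meson LIMSEQ_le_const)
qed (use bd in auto)

text \<open>In the power series of the outer exponential all coefficients are nonnegative and every
  power of the Gaussian is again a Gaussian.\<close>

lemma pos_cos_exp_gaussian_mult:
  fixes \<phi> :: "'a::euclidean_space \<Rightarrow> real"
  assumes \<phi>: "pos_cos \<phi>" and b: "0 \<le> b" and s: "0 \<le> s"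
  shows "pos_cos (\<lambda>\<xi>. exp (b * exp (- s * (norm \<xi>)\<^sup>2)) * \<phi> \<xi>)"
proof -
  obtain B where B: "\<And>\<xi>. \<bar>\<phi> \<xi>\<bar> \<le> B" and [measurable]: "\<phi> \<in> borel_measurable borel"
    using \<phi> by (auto simp: pos_cos_def)
  have B0: "0 \<le> B" using B[of 0] by (meson abs_ge_zero order_trans)
  define y where "y = (\<lambda>\<xi>::'a. exp (- s * (norm \<xi>)\<^sup>2))"
  have y: "0 \<le> y \<xi>" "y \<xi> \<le> 1" for \<xi> using s by (auto simp: y_def)
  have yb: "exp (b * y \<xi>) \<le> exp b" for \<xi> using y[of \<xi>] b by (simp add: mult_left_le)
  have pw: "pos_cos (\<lambda>\<xi>. y \<xi> ^ j * \<phi> \<xi>)" for j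
  proof (induction j)
    case (Suc j)
    then show ?case using pos_cos_gaussian_mult[OF Suc s] by (simp add: y_def mult.assoc)
  qed (use \<phi> in simp)
  have F: "pos_cos (\<lambda>\<xi>. (\<Sum>j<n. (b * y \<xi>) ^ j / fact j) * \<phi> \<xi>)" for n
  proof (induction n)
    case 0
    then show ?case using pos_cos_scale[OF \<phi>, of 0] by simp
  next
    case (Suc n)
    show ?case
      using pos_cos_add[OF Suc pos_cos_scale[OF pw, of "b ^ n / fact n" n]] b
      by (simp add: power_mult_distrib distrib_right mult.assoc)
  qed
  have exps: "(\<lambda>n. \<Sum>j<n. z ^ j / fact j) \<longlonglongrightarrow> exp z" for z :: real
    using exp_converges[of z] by (simp add: sums_def divide_inverse mult.commute)
  have le: "(\<Sum>j<n. (b * y \<xi>) ^ j / fact j) \<le> exp (b * y \<xi>)" for n \<xi>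
    using sum_le_suminf[OF summable_exp_generic[of "b * y \<xi>"], of "{..<n}"] y[of \<xi>] b
    by (simp add: exp_def divide_inverse mult.commute)
  have "pos_cos (\<lambda>\<xi>. exp (b * y \<xi>) * \<phi> \<xi>)"
  proof (rule pos_cos_limit[OF F, where B="exp b * B" and C="exp b * B"])
    show "AE \<xi> in lborel. \<bar>(\<Sum>j<n. (b * y \<xi>) ^ j / fact j) * \<phi> \<xi>\<bar> \<le> exp b * B" for n
      unfolding abs_mult using y b B0 
      by (intro AE_I2 mult_mono B) (auto simp: abs_of_nonneg sum_nonneg intro: order_trans[OF le yb])
    show "\<bar>exp (b * y \<xi>) * \<phi> \<xi>\<bar> \<le> exp b * B" for \<xi>
      unfolding abs_mult using yb B0 by (intro mult_mono B) auto
  qed (auto intro!: tendsto_mult exps simp: y_def)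
  thus ?thesis by (simp add: y_def)
qed

lemma pos_cos_exp_sum_gaussians:
  assumes "\<And>k. 0 \<le> b k" "\<And>k. 0 \<le> s k"
  shows "pos_cos (\<lambda>\<xi>::'a::euclidean_space. exp (\<Sum>k<N::nat. b k * exp (- s k * (norm \<xi>)\<^sup>2)))"
proof (induction N)
  case 0
  then show ?case using pos_cos_1 by simp
next
  case (Suc N)
  show ?case using pos_cos_exp_gaussian_mult[OF Suc assms, of N N] by (simp add: exp_add mult.commute)
qed

text \<open>Among the factors \<open>\<sigma> - real i\<close> only the one with
  \<open>i = 0\<close> is positive. Every later factor, combined with one sign, becomes
  \<open>real i - \<sigma>\<close> > 0, so the sign fixed at the start persists.\<close>

lemma neg_powr_binomial_coeff_nonneg:
  fixes \<sigma> :: real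
  assumes "0 < \<sigma>" "\<sigma> < 1"
  shows "0 \<le> - ((\<sigma> gchoose Suc k) * (- 1) ^ Suc k)"
proof -
  have "(\<Prod>i=0..<Suc k. \<sigma> - real i) * (- 1) ^ Suc k \<le> 0"
  proof (induction k)
    case (Suc k)
    have "(\<Prod>i=0..<Suc (Suc k). \<sigma> - real i) * (- 1) ^ Suc (Suc k)
        = ((\<Prod>i=0..<Suc k. \<sigma> - real i) * (- 1) ^ Suc k) * (real (Suc k) - \<sigma>)"
      by (simp add: algebra_simps)
    also have "\<dots> \<le> 0" using assms by (intro mult_nonpos_nonneg[OF Suc]) auto
    finally show ?case .
  qed (use assms in simp)
  moreover have "(\<sigma> gchoose Suc k) * (- 1) ^ Suc k
      = ((\<Prod>i=0..<Suc k. \<sigma> - real i) * (- 1) ^ Suc k) / fact (Suc k)"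
    by (simp only: gbinomial_prod_rev times_divide_eq_left)
  ultimately show ?thesis
    by (simp only: neg_0_le_iff_le divide_nonpos_pos fact_gt_zero)
qed

lemma pos_cos_exp_neg_powr_gaussian:
  fixes \<sigma> c s :: real
  assumes \<sigma>: "0 < \<sigma>" "\<sigma> < 1" and c: "0 \<le> c" and s: "0 < s"
  shows "pos_cos (\<lambda>\<xi>::'a::euclidean_space. exp (- c * (1 - exp (- s * (norm \<xi>)\<^sup>2)) powr \<sigma>))"
proof -
  define A where "A = (\<lambda>k. - ((\<sigma> gchoose Suc k) * (- 1) ^ Suc k))"
  have A: "0 \<le> A k" for k using neg_powr_binomial_coeff_nonneg[OF \<sigma>] by (simp add: A_def)
  have sums: "(\<lambda>k. A k * y ^ Suc k) sums (1 - (1 - y) powr \<sigma>)" if "0 \<le> y" "y < 1" for y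
  proof -
    have "(\<lambda>n. (\<sigma> gchoose n) * (- y) ^ n) sums (1 + - y) powr \<sigma>"
      using that by (intro gen_binomial_real) auto
    hence "(\<lambda>n. (\<sigma> gchoose n) * (- y) ^ n) sums (((1 - y) powr \<sigma> - 1) + (\<sigma> gchoose 0) * (- y) ^ 0)"
      by simp
    from sums_minus[OF iffD2[OF sums_Suc_iff this]]
    have "(\<lambda>n. - ((\<sigma> gchoose Suc n) * (- y) ^ Suc n)) sums - ((1 - y) powr \<sigma> - 1)" .
    moreover have "- ((\<sigma> gchoose Suc n) * (- y) ^ Suc n) = A n * y ^ Suc n" for n
      by (simp only: A_def power_minus[of y]) simp
    ultimately show ?thesis by (simp only: minus_diff_eq)
  qed
  \<comment> \<open>With y the Gaussian, -c (1 - y)^\<sigma> is -c plus a series in y with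
    coefficients \<open>c * A k\<close>. The constant -c survives as the positive factor
    \<open>exp (- c)\<close>. The series without c sums to at most 1, which bounds all partial
    exponentials by 1.\<close>
  define F where "F = (\<lambda>N (\<xi>::'a). exp (- c) * exp (\<Sum>k<N. (c * A k) * exp (- (s * real (Suc k)) * (norm \<xi>)\<^sup>2)))"
  have Feq: "F N \<xi> = exp (c * (- 1 + (\<Sum>k<N. A k * exp (- s * (norm \<xi>)\<^sup>2) ^ Suc k)))" for N \<xi>
    by (simp add: F_def exp_add[symmetric] exp_of_nat_mult[symmetric] sum_distrib_left algebra_simps 
      del: power_Suc of_nat_Suc)
  have ne: "AE \<xi>::'a in lborel. \<xi> \<noteq> 0" by (rule AE_lborel_singleton)
  have y1: "exp (- s * (norm \<xi>)\<^sup>2) < 1" if "\<xi> \<noteq> 0" for \<xi> :: 'a using that s by simp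
  show ?thesis
  proof (rule pos_cos_limit[of F 1 _ 1])
    show "pos_cos (F n)" for n unfolding F_def
      using c A s by (intro pos_cos_scale pos_cos_exp_sum_gaussians) auto
    show "AE \<xi> in lborel. \<bar>F n \<xi>\<bar> \<le> 1" for n
      using ne
    proof eventually_elim
      case (elim \<xi>)
      note S = sums[OF exp_ge_zero y1[OF elim]]
      have "(\<Sum>k<n. A k * exp (- s * (norm \<xi>)\<^sup>2) ^ Suc k) \<le> 1 - (1 - exp (- s * (norm \<xi>)\<^sup>2)) powr \<sigma>"
        unfolding sums_unique[OF S] using A by (intro sum_le_suminf[OF sums_summable[OF S]]) auto
      also have "\<dots> \<le> 1" by simp
      finally show ?case using c by (simp add: Feq mult_nonneg_nonpos)
    qed
    show "AE \<xi> in lborel. (\<lambda>n. F n \<xi>) \<longlonglongrightarrow> exp (- c * (1 - exp (- s * (norm \<xi>)\<^sup>2)) powr \<sigma>)"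
      using ne
    proof eventually_elim
      case (elim \<xi>)
      have "(\<lambda>n. F n \<xi>) \<longlonglongrightarrow> exp (c * (- 1 + (1 - (1 - exp (- s * (norm \<xi>)\<^sup>2)) powr \<sigma>)))"
        unfolding Feq using sums[OF exp_ge_zero y1[OF elim]] by (intro tendsto_intros) (simp add: sums_def)
      thus ?case by simp
    qed
  qed (use c in auto)
qed

lemma pos_cos_exp_neg_norm_powr:
  fixes \<sigma> t :: real
  assumes \<sigma>: "0 < \<sigma>" "\<sigma> < 1" and t: "0 \<le> t"
  shows "pos_cos (\<lambda>\<xi>::'a::euclidean_space. exp (- t * norm \<xi> powr (2 * \<sigma>)))"
\<comment> \<open>The constant c of the previous lemma is taken to be t n^\<sigma>, so that n moves
  inside the power: n^\<sigma> (1 - y)^\<sigma> = (n (1 - y))^\<sigma>, where n stands for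
  \<open>Suc n\<close>.\<close>
proof (rule pos_cos_limit[of "\<lambda>n (\<xi>::'a). exp (- (t * real (Suc n) powr \<sigma>) * (1 - exp (- (1 / real (Suc n)) * (norm \<xi>)\<^sup>2)) powr \<sigma>)" 1 _ 1])
  show "AE \<xi> in lborel. (\<lambda>n. exp (- (t * real (Suc n) powr \<sigma>) * (1 - exp (- (1 / real (Suc n)) * (norm (\<xi>::'a))\<^sup>2)) powr \<sigma>))
     \<longlonglongrightarrow> exp (- t * norm \<xi> powr (2 * \<sigma>))"
    using AE_lborel_singleton[of 0]
  proof eventually_elim
    case (elim \<xi>)
    define l where "l = (norm \<xi>)\<^sup>2"
    have l: "l > 0" using elim by (simp add: l_def)
    have "(\<lambda>n. real (Suc n) * (1 - exp (- l / real (Suc n)))) \<longlonglongrightarrow> l"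
      using l by real_asymp
    hence "(\<lambda>n. exp (- t * (real (Suc n) * (1 - exp (- l / real (Suc n)))) powr \<sigma>)) \<longlonglongrightarrow> exp (- t * l powr \<sigma>)"
      using l by (intro tendsto_intros) auto
    moreover have "l powr \<sigma> = norm \<xi> powr (2 * \<sigma>)"
      using elim powr_powr[of "norm \<xi>" 2 \<sigma>] by (simp add: l_def)
    moreover have "(real (Suc n) * (1 - exp (- l / real (Suc n)))) powr \<sigma>
       = real (Suc n) powr \<sigma> * (1 - exp (- l / real (Suc n))) powr \<sigma>" for n
      by (simp only: powr_mult)
    ultimately show ?case by (simp add: l_def mult.assoc)
  qed
  show "pos_cos (\<lambda>\<xi>::'a. exp (- (t * real (Suc n) powr \<sigma>) * (1 - exp (- (1 / real (Suc n)) * (norm \<xi>)\<^sup>2)) powr \<sigma>))" for n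
    using t by (intro pos_cos_exp_neg_powr_gaussian \<sigma>) auto
qed (use t in auto)

section \<open>The heat kernel\<close>

lemma integrable_mult_bounded:
  fixes f g :: "'b \<Rightarrow> real"
  assumes f: "integrable M f" and [measurable]: "g \<in> borel_measurable M" and "\<And>x. \<bar>g x\<bar> \<le> B"
  shows "integrable M (\<lambda>x. g x * f x)"
proof (rule Bochner_Integration.integrable_bound[OF integrable_mult_right[OF f, of B]])
  show "AE x in M. norm (g x * f x) \<le> norm (B * f x)"
  proof (rule AE_I2)
    fix x
    have "\<bar>g x\<bar> \<le> \<bar>B\<bar>" using assms(3)[of x] by linarith
    thus "norm (g x * f x) \<le> norm (B * f x)" by (simp add: abs_mult mult_right_mono)
  qed
qed (use f in measurable)

lemma integrable_lborel_pair_mult: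
  fixes f :: "'a::euclidean_space \<Rightarrow> real" and g :: "'b::euclidean_space \<Rightarrow> real"
  assumes f: "integrable lborel f" and g: "integrable lborel g"
  shows "integrable (lborel \<Otimes>\<^sub>M lborel) (\<lambda>(x, y). f x * g y)"
proof -
  have [measurable]: "f \<in> borel_measurable borel" "g \<in> borel_measurable borel"
    using f g by (auto simp: integrable_iff_bounded)
  show ?thesis
  proof (rule lborel_pair.Fubini_integrable)
    show "integrable lborel (\<lambda>x. \<integral>y. norm (case (x, y) of (x, y) \<Rightarrow> f x * g y) \<partial>lborel)"
      using integrable_mult_left[OF integrable_abs[OF f]] by (simp add: abs_mult)
    show "AE x in lborel. integrable lborel (\<lambda>y. case (x, y) of (x, y) \<Rightarrow> f x * g y)"
      using g by simp
  qed measurable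
qed

text \<open>The common shape of three interchanges below: an integrable tensor product times a
  bounded factor, which is a product of cosines, a single cosine or the integrand of Duhamel's
  formula.\<close>

lemma fubini_lborel_bounded:
  fixes f :: "'a::euclidean_space \<Rightarrow> real" and g :: "'b::euclidean_space \<Rightarrow> real"
  assumes f: "integrable lborel f" and g: "integrable lborel g"
    and h: "(\<lambda>(x, y). h x y) \<in> borel_measurable (lborel \<Otimes>\<^sub>M lborel)" "\<And>x y. \<bar>h x y\<bar> \<le> B"
  shows "(\<integral>x. (\<integral>y. h x y * (f x * g y) \<partial>lborel) \<partial>lborel) = (\<integral>y. (\<integral>x. h x y * (f x * g y) \<partial>lborel) \<partial>lborel)"
proof -
  have "integrable (lborel \<Otimes>\<^sub>M lborel) (\<lambda>z. (case z of (x, y) \<Rightarrow> h x y) * (case z of (x, y) \<Rightarrow> f x * g y))"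
    using h by (intro integrable_mult_bounded[OF integrable_lborel_pair_mult[OF f g], where B=B]) (auto split: prod.split)
  hence "integrable (lborel \<Otimes>\<^sub>M lborel) (\<lambda>(x, y). h x y * (f x * g y))"
    by (simp add: case_prod_beta')
  from lborel_pair.Fubini_integral[OF this] show ?thesis by simp
qed

text \<open>The linear defect, cruder than the quadratic one, makes the first moment of the symbol
  sufficient in \<open>ker_lower_bound\<close>.\<close>

lemma one_minus_abs_le_cos: "1 - \<bar>x\<bar> \<le> cos (x::real)"
proof -
  have "\<bar>sin (x / 2)\<bar> * \<bar>sin (x / 2)\<bar> \<le> \<bar>x / 2\<bar> * 1"
    by (intro mult_mono abs_sin_x_le_abs_x) auto
  moreover have "cos x = 1 - 2 * (sin (x / 2))\<^sup>2"
    using cos_double_sin[of "x / 2"] by simp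
  ultimately show ?thesis by (simp add: power2_eq_square)
qed

lemma powr_half_real: "0 < x \<Longrightarrow> x powr (real k / 2) = sqrt x ^ k"
  by (simp add: powr_half_sqrt[symmetric] powr_realpow[symmetric] powr_powr)

section \<open>Symbol and kernel with separate Laplacian and fractional times\<close>

locale mixed_diffusion =
  fixes \<sigma> :: real
  assumes sigma_pos: "0 < \<sigma>" and sigma_less_1: "\<sigma> < 1"
begin

text \<open>The time \<open>a\<close> belongs to the Laplacian and \<open>t\<close> to the
  fractional part. They are kept apart because scaling changes them differently;
  \<open>a = 0\<close> gives the fractional kernel, \<open>t = 0\<close> the Gaussian, and
  \<open>a = t\<close> the mixed kernel.\<close>

definition symb :: "real \<Rightarrow> real \<Rightarrow> 'a::euclidean_space \<Rightarrow> real" where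
  "symb a t \<xi> = exp (- a * (norm \<xi>)\<^sup>2 - t * norm \<xi> powr (2 * \<sigma>))"

definition ker :: "real \<Rightarrow> real \<Rightarrow> 'a::euclidean_space \<Rightarrow> real" where
  "ker a t x = (\<integral>\<xi>. cos (x \<bullet> \<xi>) * symb a t \<xi> \<partial>lborel) / (2 * pi) ^ DIM('a)"

lemma symb_pos [simp]: "0 < symb a t \<xi>" and symb_nonneg [simp]: "0 \<le> symb a t \<xi>"
  by (auto simp: symb_def)

lemma symb_minus [simp]: "symb a t (- \<xi>) = symb a t \<xi>"
  by (simp add: symb_def)

lemma symb_0 [simp]: "symb a t 0 = 1"
  using sigma_pos by (simp add: symb_def)

lemma symb_mult: "symb a t \<xi> * symb b s \<xi> = symb (a + b) (t + s) \<xi>"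
  by (simp add: symb_def exp_add[symmetric] algebra_simps)

lemma symb_antimono: "a \<le> b \<Longrightarrow> t \<le> s \<Longrightarrow> symb b s \<xi> \<le> symb a t \<xi>"
  unfolding symb_def exp_le_cancel_iff
  by (intro diff_mono) (auto intro: mult_right_mono)

lemma symb_le_1: "0 \<le> a \<Longrightarrow> 0 \<le> t \<Longrightarrow> symb a t \<xi> \<le> 1"
  using symb_antimono[of 0 a 0 t \<xi>] by (simp add: symb_def)

lemma measurable_symb [measurable]: "symb a t \<in> borel_measurable borel"
  unfolding symb_def by measurable

lemma measurable_symb' [measurable (raw)]:
  assumes [measurable]: "f \<in> borel_measurable M" "g \<in> borel_measurable M" "h \<in> borel_measurable M"
  shows "(\<lambda>x. symb (f x) (g x) (h x :: 'a::euclidean_space)) \<in> borel_measurable M"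
  unfolding symb_def by measurable

lemma integrable_norm_symb:
  assumes t: "0 < t" and a: "0 \<le> a"
  shows "integrable lborel (\<lambda>\<xi>::'a::euclidean_space. (1 + norm \<xi>) * symb a t \<xi>)"
proof -
  obtain C where C: "\<And>r. 0 \<le> r \<Longrightarrow> (1 + r) * exp (- t * r powr (2 * \<sigma>)) \<le> C * inverse ((1 + r\<^sup>2) ^ DIM('a))"
    using exp_neg_powr_decay[OF t, of "2 * \<sigma>" "DIM('a)"] sigma_pos by auto
  show ?thesis
  proof (rule Bochner_Integration.integrable_bound[OF integrable_mult_right[OF integrable_inverse_one_plus_norm_sq, of C]])
    show "AE \<xi> in lborel. norm ((1 + norm \<xi>) * symb a t \<xi>) \<le> norm (C * inverse ((1 + (norm (\<xi>::'a))\<^sup>2) ^ DIM('a)))"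
    proof (rule AE_I2)
      fix \<xi> :: 'a
      have "(1 + norm \<xi>) * symb a t \<xi> \<le> (1 + norm \<xi>) * symb 0 t \<xi>"
        using a by (intro mult_left_mono symb_antimono) auto
      also have "\<dots> \<le> C * inverse ((1 + (norm \<xi>)\<^sup>2) ^ DIM('a))"
        using C[of "norm \<xi>"] by (simp add: symb_def)
      also have "\<dots> \<le> \<bar>C\<bar> * inverse ((1 + (norm \<xi>)\<^sup>2) ^ DIM('a))"
        by (intro mult_right_mono) auto
      finally show "norm ((1 + norm \<xi>) * symb a t \<xi>) \<le> norm (C * inverse ((1 + (norm \<xi>)\<^sup>2) ^ DIM('a)))"
        by (simp add: abs_mult)
    qed
  qed measurable
qed

lemma integrable_symb:
  assumes "0 \<le> a" "0 \<le> t" "0 < a \<or> 0 < t"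
  shows "integrable lborel (symb a t :: 'a::euclidean_space \<Rightarrow> real)"
proof (cases "0 < t")
  case True
  show ?thesis
    by (rule Bochner_Integration.integrable_bound[OF integrable_norm_symb[OF True assms(1)]])
       (auto simp: abs_mult intro!: AE_I2)
next
  case False
  with assms have "0 < a" "t = 0" by auto
  thus ?thesis using integrable_gaussian[of a, where 'a='a] by (simp add: symb_def[abs_def])
qed

lemma integrable_cos_symb:
  assumes "0 \<le> a" "0 \<le> t" "0 < a \<or> 0 < t"
  shows "integrable lborel (\<lambda>\<xi>::'a::euclidean_space. cos (x \<bullet> \<xi>) * symb a t \<xi>)"
  by (rule integrable_mult_bounded[OF integrable_symb[OF assms], where B=1]) auto

text \<open>Joint in both times and the point, so that measurability in time of \<open>S\<close> and
  \<open>kdiff\<close> follows automatically.\<close>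

lemma measurable_ker' [measurable (raw)]:
  assumes [measurable]: "f \<in> borel_measurable M" "g \<in> borel_measurable M" "h \<in> borel_measurable M"
  shows "(\<lambda>x. ker (f x) (g x) (h x :: 'a::euclidean_space)) \<in> borel_measurable M"
  unfolding ker_def by measurable

lemma measurable_ker [measurable]: "ker a t \<in> borel_measurable borel"
  by measurable

lemma ker_minus [simp]: "ker a t (- x) = ker a t x"
  by (simp add: ker_def)

lemma ker_le_ker_0:
  assumes "0 \<le> a" "0 \<le> t" "0 < a \<or> 0 < t"
  shows "ker a t (x::'a::euclidean_space) \<le> ker a t (0::'a)"
  unfolding ker_def
proof (intro divide_right_mono integral_mono)
  show "integrable lborel (\<lambda>\<xi>::'a. cos (x \<bullet> \<xi>) * symb a t \<xi>)" "integrable lborel (\<lambda>\<xi>::'a. cos (0 \<bullet> \<xi>) * symb a t \<xi>)"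
    by (intro integrable_cos_symb assms)+
qed (auto simp: mult_left_le_one_le)

lemma ker_0_antimono:
  assumes "0 \<le> a" "0 \<le> t" "0 < a \<or> 0 < t" "a \<le> b" "t \<le> s"
  shows "ker b s (0::'a::euclidean_space) \<le> ker a t (0::'a)"
  unfolding ker_def using assms
  by (intro divide_right_mono integral_mono) (auto intro!: integrable_symb symb_antimono)

text \<open>The Gaussian factor in \<open>pos_cos\<close> is exactly the Laplacian part of the
  symbol, whence \<open>0 < a\<close>.\<close>

lemma ker_nonneg:
  assumes "0 < a" "0 \<le> t"
  shows "0 \<le> ker a t (x::'a::euclidean_space)"
proof -
  have "symb a t \<xi> = exp (- a * (norm \<xi>)\<^sup>2) * exp (- t * norm \<xi> powr (2 * \<sigma>))" for \<xi> :: 'a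
    by (simp add: symb_def exp_add[symmetric])
  thus ?thesis unfolding ker_def
    using pos_cosD[OF pos_cos_exp_neg_norm_powr[OF sigma_pos sigma_less_1 assms(2)] assms(1), of x]
    by simp
qed

lemma ker_gaussian:
  assumes "0 < a"
  shows "ker a 0 (x::'a::euclidean_space) = (4 * pi * a) powr (- (DIM('a) / 2)) * exp (- (norm x)\<^sup>2 / (4 * a))"
proof -
  have "(pi / a) powr (DIM('a) / 2) / (2 * pi) ^ DIM('a) = (sqrt (pi / a) / (2 * pi)) ^ DIM('a)"
    using assms by (simp add: powr_half_real power_divide)
  also have "sqrt (pi / a) / (2 * pi) = inverse (sqrt (4 * pi * a))"
    using assms real_sqrt_mult_self[of pi]
    by (simp add: real_sqrt_divide real_sqrt_mult field_simps)
  also have "\<dots> ^ DIM('a) = (4 * pi * a) powr (- (DIM('a) / 2))"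
    using assms by (simp add: powr_minus powr_half_real power_inverse)
  finally have "(pi / a) powr (DIM('a) / 2) / (2 * pi) ^ DIM('a) = (4 * pi * a) powr (- (DIM('a) / 2))" .
  thus ?thesis unfolding ker_def symb_def using integral_gaussian_cos[OF assms, of x]
    by (simp only: mult_zero_left diff_zero times_divide_eq_left[symmetric])
qed

text \<open>Substitution in the frequency. The times scale by different powers of \<open>r\<close>,
  so in general they cannot both be normalised; below, \<open>r\<close> is chosen to make the
  fractional time 1.\<close>

lemma ker_scale:
  assumes r: "0 < r"
  shows "ker a t (x::'a::euclidean_space) = r ^ DIM('a) * ker (a * r\<^sup>2) (t * r powr (2 * \<sigma>)) (r *\<^sub>R x)"
proof -
  have "(\<integral>\<xi>. cos (x \<bullet> \<xi>) * symb a t \<xi> \<partial>lborel)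
      = r ^ DIM('a) * (\<integral>\<xi>. cos (x \<bullet> (0 + r *\<^sub>R \<xi>)) * symb a t (0 + r *\<^sub>R \<xi>) \<partial>lborel)"
    using r by (subst integral_lborel_affine[of r _ 0]) auto
  also have "(\<lambda>\<xi>::'a. cos (x \<bullet> (0 + r *\<^sub>R \<xi>)) * symb a t (0 + r *\<^sub>R \<xi>))
      = (\<lambda>\<xi>. cos (r *\<^sub>R x \<bullet> \<xi>) * symb (a * r\<^sup>2) (t * r powr (2 * \<sigma>)) \<xi>)"
    using r by (auto simp: symb_def power_mult_distrib powr_mult mult_ac fun_eq_iff)
  finally show ?thesis by (simp add: ker_def)
qed

text \<open>
  Fourier inversion for \<open>ker\<close> is obtained by damping with \<open>exp (- |x|\<^sup>2 / n)\<close>; monotone convergence, which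
  needs \<open>ker_nonneg\<close>, then gives integrability of the kernel.
\<close>

lemma tendsto_symb_smoothing:
  assumes a: "0 < a" and t: "0 \<le> t"
  shows "(\<lambda>n. (pi * Suc n) powr (DIM('a) / 2) * (\<integral>\<xi>. symb a t \<xi> * exp (- (norm (\<xi> - \<eta>))\<^sup>2 * Suc n / 4) \<partial>lborel))
     \<longlonglongrightarrow> (2 * pi) ^ DIM('a) * symb a t (\<eta>::'a::euclidean_space)"
proof -
  \<comment> \<open>In the variable z with \<xi> = \<eta> + e z the concentrating Gaussian becomes
    the fixed one, and the limit falls on the continuous symbol.\<close>
  define e where "e n = 2 / sqrt (Suc n)" for n
  have e: "e n > 0" for n by (simp add: e_def)
  have e2: "(e n)\<^sup>2 = 4 / Suc n" for n by (simp add: e_def power_divide)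
  have "(\<integral>\<xi>. symb a t \<xi> * exp (- (norm (\<xi> - \<eta>))\<^sup>2 * Suc n / 4) \<partial>lborel)
      = e n ^ DIM('a) * (\<integral>z. symb a t (\<eta> + e n *\<^sub>R z) * exp (- 1 * (norm z)\<^sup>2) \<partial>lborel)" for n
    using e[of n] by (subst integral_lborel_affine[of "e n" _ \<eta>]) (auto simp: power_mult_distrib e2)
  moreover have "(pi * Suc n) powr (DIM('a) / 2) * e n ^ DIM('a) = (2 * sqrt pi) ^ DIM('a)" for n
  proof -
    have "(pi * Suc n) powr (DIM('a) / 2) * e n ^ DIM('a) = (sqrt (pi * Suc n) * e n) ^ DIM('a)"
      by (simp only: powr_half_real power_mult_distrib pi_gt_zero of_nat_0_less_iff zero_less_Suc zero_less_mult_iff simp_thms)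
    also have "sqrt (pi * Suc n) * e n = 2 * sqrt pi"
      by (simp add: e_def real_sqrt_mult del: of_nat_Suc)
    finally show ?thesis .
  qed
  ultimately have eq: "(pi * Suc n) powr (DIM('a) / 2) * (\<integral>\<xi>. symb a t \<xi> * exp (- (norm (\<xi> - \<eta>))\<^sup>2 * Suc n / 4) \<partial>lborel)
      = (2 * sqrt pi) ^ DIM('a) * (\<integral>z. symb a t (\<eta> + e n *\<^sub>R z) * exp (- 1 * (norm z)\<^sup>2) \<partial>lborel)" for n
    by (simp only: mult.assoc[symmetric])
  have "e \<longlonglongrightarrow> 0" unfolding e_def by real_asymp
  hence "(\<lambda>n. \<eta> + e n *\<^sub>R z) \<longlonglongrightarrow> \<eta> + 0 *\<^sub>R z" for z :: 'a by (intro tendsto_intros)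
  hence sl: "(\<lambda>n. symb a t (\<eta> + e n *\<^sub>R z)) \<longlonglongrightarrow> symb a t \<eta>" for z :: 'a
    unfolding symb_def using sigma_pos by (intro tendsto_intros) auto
  have "(\<lambda>n. \<integral>z. symb a t (\<eta> + e n *\<^sub>R z) * exp (- 1 * (norm z)\<^sup>2) \<partial>lborel)
     \<longlonglongrightarrow> (\<integral>z. symb a t \<eta> * exp (- 1 * (norm (z::'a))\<^sup>2) \<partial>lborel)"
  proof (rule integral_dominated_convergence[where w="\<lambda>z. exp (- 1 * (norm z)\<^sup>2)"])
    show "integrable lborel (\<lambda>z::'a. exp (- 1 * (norm z)\<^sup>2))"
      by (rule integrable_gaussian) simp
  qed (use sl in \<open>auto intro!: AE_I2 tendsto_mult_right simp: abs_mult symb_le_1 a t less_imp_le mult_left_le_one_le\<close>)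
  also have "(\<integral>z. symb a t \<eta> * exp (- 1 * (norm (z::'a))\<^sup>2) \<partial>lborel) = symb a t \<eta> * sqrt pi ^ DIM('a)"
    using integral_gaussian_cos[of 1 "0::'a"]
    by (simp add: powr_half_sqrt[symmetric] powr_realpow[symmetric] powr_powr)
  finally have "(\<lambda>n. (2 * sqrt pi) ^ DIM('a) * (\<integral>z. symb a t (\<eta> + e n *\<^sub>R z) * exp (- 1 * (norm (z::'a))\<^sup>2) \<partial>lborel))
     \<longlonglongrightarrow> (2 * sqrt pi) ^ DIM('a) * (symb a t \<eta> * sqrt pi ^ DIM('a))"
    by (intro tendsto_intros)
  moreover have "(2 * sqrt pi) ^ DIM('a) * (symb a t \<eta> * sqrt pi ^ DIM('a)) = (2 * pi) ^ DIM('a) * symb a t \<eta>"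
  proof -
    have "2 * pi = 2 * sqrt pi * sqrt pi" by simp
    hence "(2 * pi) ^ DIM('a) = (2 * sqrt pi * sqrt pi) ^ DIM('a)" by (simp only:)
    thus ?thesis by (simp only: power_mult_distrib mult_ac)
  qed
  ultimately show ?thesis unfolding eq by (simp only:)
qed

lemma tendsto_ker_gaussian_cos:
  assumes a: "0 < a" and t: "0 \<le> t"
  shows "(\<lambda>n. \<integral>x. ker a t x * cos (x \<bullet> \<eta>) * exp (- (1 / Suc n) * (norm x)\<^sup>2) \<partial>lborel) \<longlonglongrightarrow> symb a t (\<eta>::'a::euclidean_space)"
    (is "?L \<longlonglongrightarrow> _")
proof -
  define c where "c n = (pi * Suc n) powr (DIM('a) / 2)" for n
  let ?I = "\<lambda>n \<eta>. c n * (\<integral>\<xi>. symb a t \<xi> * exp (- (norm (\<xi> - \<eta>))\<^sup>2 * Suc n / 4) \<partial>lborel)"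
  have intI: "integrable lborel (\<lambda>\<xi>. symb a t \<xi> * exp (- (norm (\<xi> - \<eta>))\<^sup>2 * Suc n / 4))" for \<eta> :: 'a and n
    using integrable_mult_bounded[OF integrable_symb[of a t, where 'a='a], of "\<lambda>\<xi>. exp (- (norm (\<xi> - \<eta>))\<^sup>2 * Suc n / 4)" 1] a t
    by (simp add: mult.commute)
  have gi: "(\<integral>x. cos (x \<bullet> \<zeta>) * exp (- (1 / Suc n) * (norm x)\<^sup>2) \<partial>lborel) = c n * exp (- (norm \<zeta>)\<^sup>2 * Suc n / 4)" for n and \<zeta> :: 'a
    using integral_gaussian_cos[of "1 / Suc n" \<zeta>] by (simp add: c_def inner_commute del: of_nat_Suc)
  have gint: "integrable lborel (\<lambda>x. cos (x \<bullet> \<zeta>) * exp (- (1 / Suc n) * (norm x)\<^sup>2))" for n and \<zeta> :: 'a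
    by (rule integrable_mult_bounded[OF integrable_gaussian, where B=1]) auto
  \<comment> \<open>The product of cosines splits into cosines of the sum and the difference, so the
    x-integral gives Gaussians centred at \<eta> and at -\<eta>. Their limits agree because the
    symbol is even.\<close>
  have inner: "(\<integral>x. cos (x \<bullet> \<xi>) * cos (x \<bullet> \<eta>) * (exp (- (1 / Suc n) * (norm x)\<^sup>2) * symb a t \<xi>) \<partial>lborel)
     = (c n * (symb a t \<xi> * exp (- (norm (\<xi> - (- \<eta>)))\<^sup>2 * Suc n / 4)) + c n * (symb a t \<xi> * exp (- (norm (\<xi> - \<eta>))\<^sup>2 * Suc n / 4))) / 2"
    for n \<xi>
  proof -
    have "cos (x \<bullet> \<xi>) * cos (x \<bullet> \<eta>) * (exp (- (1 / Suc n) * (norm x)\<^sup>2) * symb a t \<xi>)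
      = (symb a t \<xi> / 2) * (cos (x \<bullet> (\<xi> - (- \<eta>))) * exp (- (1 / Suc n) * (norm x)\<^sup>2) 
         + cos (x \<bullet> (\<xi> - \<eta>)) * exp (- (1 / Suc n) * (norm x)\<^sup>2))" for x
      by (simp add: cos_add cos_diff inner_diff_right inner_add_right algebra_simps del: of_nat_Suc)
    thus ?thesis
      by (simp only: integral_mult_right_zero Bochner_Integration.integral_add[OF gint gint] gi)
         (simp add: algebra_simps del: of_nat_Suc)
  qed
  have "?L n = ((?I n (- \<eta>) + ?I n \<eta>) / 2) / (2 * pi) ^ DIM('a)" for n
  proof -
    have "ker a t x * cos (x \<bullet> \<eta>) * exp (- (1 / Suc n) * (norm x)\<^sup>2)
        = (\<integral>\<xi>. cos (x \<bullet> \<xi>) * cos (x \<bullet> \<eta>) * (exp (- (1 / Suc n) * (norm x)\<^sup>2) * symb a t \<xi>) \<partial>lborel) / (2 * pi) ^ DIM('a)" for x :: 'a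
    proof -
      have "(\<lambda>\<xi>. cos (x \<bullet> \<xi>) * cos (x \<bullet> \<eta>) * (exp (- (1 / Suc n) * (norm x)\<^sup>2) * symb a t \<xi>))
        = (\<lambda>\<xi>. (cos (x \<bullet> \<eta>) * exp (- (1 / Suc n) * (norm x)\<^sup>2)) * (cos (x \<bullet> \<xi>) * symb a t \<xi>))"
        by (simp add: fun_eq_iff)
      thus ?thesis unfolding ker_def by (simp only: integral_mult_right_zero) (simp del: of_nat_Suc)
    qed
    hence "?L n = (\<integral>x. (\<integral>\<xi>. cos (x \<bullet> \<xi>) * cos (x \<bullet> \<eta>) * (exp (- (1 / Suc n) * (norm x)\<^sup>2) * symb a t \<xi>) \<partial>lborel) \<partial>lborel) / (2 * pi) ^ DIM('a)"
      by (simp only: Bochner_Integration.integral_divide_zero)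
    also have "(\<integral>x. (\<integral>\<xi>. cos (x \<bullet> \<xi>) * cos (x \<bullet> \<eta>) * (exp (- (1 / Suc n) * (norm x)\<^sup>2) * symb a t \<xi>) \<partial>lborel) \<partial>lborel)
      = (\<integral>\<xi>. (\<integral>x. cos (x \<bullet> \<xi>) * cos (x \<bullet> \<eta>) * (exp (- (1 / Suc n) * (norm x)\<^sup>2) * symb a t \<xi>) \<partial>lborel) \<partial>lborel)"
    proof (rule fubini_lborel_bounded[where B=1])
      show "integrable lborel (\<lambda>x::'a. exp (- (1 / Suc n) * (norm x)\<^sup>2))" by (rule integrable_gaussian) simp
      show "integrable lborel (symb a t :: 'a \<Rightarrow> real)" using a t by (intro integrable_symb) auto
      show "\<bar>cos (x \<bullet> y) * cos (x \<bullet> \<eta>)\<bar> \<le> 1" for x y :: 'a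
        unfolding abs_mult by (intro mult_le_one) auto
    qed measurable
    also have "\<dots> = (?I n (- \<eta>) + ?I n \<eta>) / 2"
      unfolding inner using intI[of "- \<eta>" n] intI[of \<eta> n] by simp
    finally show ?thesis .
  qed
  moreover have "(\<lambda>n. ((?I n (- \<eta>) + ?I n \<eta>) / 2) / (2 * pi) ^ DIM('a))
     \<longlonglongrightarrow> (((2 * pi) ^ DIM('a) * symb a t (- \<eta>) + (2 * pi) ^ DIM('a) * symb a t \<eta>) / 2) / (2 * pi) ^ DIM('a)"
    unfolding c_def by (intro tendsto_intros tendsto_symb_smoothing a t) auto
  ultimately show ?thesis by simp
qed

lemma
  assumes a: "0 < a" and t: "0 \<le> t"
  shows integrable_ker: "integrable lborel (ker a t :: 'a::euclidean_space \<Rightarrow> real)"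
    and integral_ker: "(\<integral>x. ker a t (x::'a) \<partial>lborel) = 1"
    and integral_ker_cos: "(\<integral>x. ker a t x * cos (x \<bullet> \<eta>) \<partial>lborel) = symb a t (\<eta>::'a)"
proof -
  let ?e = "\<lambda>n (x::'a). exp (- (1 / Suc n) * (norm x)\<^sup>2)"
  have le: "(\<lambda>n. ?e n x) \<longlonglongrightarrow> 1" for x
  proof -
    have "(\<lambda>n. 1 / real (Suc n)) \<longlonglongrightarrow> 0" by real_asymp
    hence "(\<lambda>n. ?e n x) \<longlonglongrightarrow> exp (- 0 * (norm x)\<^sup>2)" by (intro tendsto_intros)
    thus ?thesis by simp
  qed
  have k: "has_bochner_integral lborel (ker a t :: 'a \<Rightarrow> real) (symb a t (0::'a))"
  proof (rule has_bochner_integral_monotone_convergence[where f="\<lambda>n x. ker a t x * ?e n x"])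
    show "integrable lborel (\<lambda>x. ker a t x * ?e n x)" for n
    proof -
      have "\<bar>ker a t x\<bar> \<le> ker a t (0::'a)" for x :: 'a
        using ker_nonneg[OF a t, of x] ker_le_ker_0[of a t x] a t by auto
      thus ?thesis by (intro integrable_mult_bounded[OF integrable_gaussian]) auto
    qed
    show "AE x in lborel. mono (\<lambda>n. ker a t x * ?e n x)"
      by (intro AE_I2 monoI mult_left_mono ker_nonneg a t) (auto intro!: divide_left_mono mult_right_mono)
    show "AE x in lborel. (\<lambda>n. ker a t x * ?e n x) \<longlonglongrightarrow> ker a t x"
      using tendsto_mult[OF tendsto_const le] by (intro AE_I2) fastforce
    show "(\<lambda>n. \<integral>x. ker a t x * ?e n x \<partial>lborel) \<longlonglongrightarrow> symb a t (0::'a)"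
      using tendsto_ker_gaussian_cos[OF a t, of 0] by simp
  qed measurable
  thus i: "integrable lborel (ker a t :: 'a \<Rightarrow> real)" and "(\<integral>x. ker a t (x::'a) \<partial>lborel) = 1"
    by (auto simp: has_bochner_integral_iff)
  \<comment> \<open>The kernel, now known to be integrable, is itself the majorant for a general
    frequency.\<close>
  have "(\<lambda>n. \<integral>x. ker a t x * cos (x \<bullet> \<eta>) * ?e n x \<partial>lborel) \<longlonglongrightarrow> (\<integral>x. ker a t x * cos (x \<bullet> \<eta>) \<partial>lborel)"
  proof (rule integral_dominated_convergence[OF _ _ i])
    show "AE x in lborel. (\<lambda>n. ker a t x * cos (x \<bullet> \<eta>) * ?e n x) \<longlonglongrightarrow> ker a t x * cos (x \<bullet> \<eta>)"
      using tendsto_mult[OF tendsto_const le] by (intro AE_I2) fastforce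
    show "AE x in lborel. norm (ker a t x * cos (x \<bullet> \<eta>) * ?e n x) \<le> ker a t x" for n
    proof (rule AE_I2)
      fix x :: 'a
      have "ker a t x * (\<bar>cos (x \<bullet> \<eta>)\<bar> * ?e n x) \<le> ker a t x * 1"
        by (intro mult_left_mono mult_le_one ker_nonneg a t) auto
      thus "norm (ker a t x * cos (x \<bullet> \<eta>) * ?e n x) \<le> ker a t x"
        using ker_nonneg[OF a t, of x] by (simp add: abs_mult)
    qed
  qed measurable
  from LIMSEQ_unique[OF this tendsto_ker_gaussian_cos[OF a t]]
  show "(\<integral>x. ker a t x * cos (x \<bullet> \<eta>) \<partial>lborel) = symb a t \<eta>" .
qed

lemma integral_ker_sin:
  "(\<integral>x. ker a t x * sin (x \<bullet> \<eta>) \<partial>lborel) = (0::real)" for \<eta> :: "'a::euclidean_space"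
proof -
  have "(\<integral>x. ker a t x * sin (x \<bullet> \<eta>) \<partial>lborel) = - (\<integral>x. ker a t x * sin (x \<bullet> \<eta>) \<partial>lborel)"
    by (subst integral_lborel_affine[of "-1" _ 0]) auto
  thus ?thesis by simp
qed

text \<open>The factors are treated differently: the first is expanded as a cosine integral, the
  second enters through its own transform \<open>integral_ker_cos\<close>. Hence only the second
  needs a Laplacian part, and the first may be the fractional kernel.\<close>

lemma ker_convolution:
  assumes at: "0 \<le> a" "0 \<le> t" "0 < a \<or> 0 < t" and b: "0 < b" and s: "0 \<le> s"
  shows "(\<integral>y. ker a t (x - y) * ker b s y \<partial>lborel) = ker (a + b) (t + s) (x::'a::euclidean_space)"
proof -
  have "ker a t (x - y) * ker b s y = (\<integral>\<xi>. cos ((x - y) \<bullet> \<xi>) * (ker b s y * symb a t \<xi>) \<partial>lborel) / (2 * pi) ^ DIM('a)" for y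
  proof -
    have "(\<lambda>\<xi>. cos ((x - y) \<bullet> \<xi>) * (ker b s y * symb a t \<xi>)) = (\<lambda>\<xi>. ker b s y * (cos ((x - y) \<bullet> \<xi>) * symb a t \<xi>))"
      by (simp add: fun_eq_iff)
    thus ?thesis by (simp only: integral_mult_right_zero) (simp add: ker_def[of a])
  qed
  hence "(\<integral>y. ker a t (x - y) * ker b s y \<partial>lborel)
     = (\<integral>y. (\<integral>\<xi>. cos ((x - y) \<bullet> \<xi>) * (ker b s y * symb a t \<xi>) \<partial>lborel) \<partial>lborel) / (2 * pi) ^ DIM('a)"
    by simp
  also have "(\<integral>y. (\<integral>\<xi>. cos ((x - y) \<bullet> \<xi>) * (ker b s y * symb a t \<xi>) \<partial>lborel) \<partial>lborel)
     = (\<integral>\<xi>. (\<integral>y. cos ((x - y) \<bullet> \<xi>) * (ker b s y * symb a t \<xi>) \<partial>lborel) \<partial>lborel)"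
    by (rule fubini_lborel_bounded[where B=1, OF integrable_ker[OF b s] integrable_symb[OF at]]) auto
  also have "(\<lambda>\<xi>. \<integral>y. cos ((x - y) \<bullet> \<xi>) * (ker b s y * symb a t \<xi>) \<partial>lborel)
     = (\<lambda>\<xi>. cos (x \<bullet> \<xi>) * symb (a + b) (t + s) \<xi>)"
  proof
    fix \<xi> :: 'a
    have 1: "integrable lborel (\<lambda>y. ker b s y * cos (y \<bullet> \<xi>))" "integrable lborel (\<lambda>y. ker b s y * sin (y \<bullet> \<xi>))"
      using integrable_mult_bounded[OF integrable_ker[OF b s], of "\<lambda>y. cos (y \<bullet> \<xi>)" 1]
        integrable_mult_bounded[OF integrable_ker[OF b s], of "\<lambda>y. sin (y \<bullet> \<xi>)" 1]
      by (simp_all add: mult.commute)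
    have "cos ((x - y) \<bullet> \<xi>) * (ker b s y * symb a t \<xi>) = symb a t \<xi> * (cos (x \<bullet> \<xi>) * (ker b s y * cos (y \<bullet> \<xi>))
       + sin (x \<bullet> \<xi>) * (ker b s y * sin (y \<bullet> \<xi>)))" for y
      by (simp add: inner_diff_left cos_diff algebra_simps)
    hence "(\<integral>y. cos ((x - y) \<bullet> \<xi>) * (ker b s y * symb a t \<xi>) \<partial>lborel)
      = (\<integral>y. symb a t \<xi> * (cos (x \<bullet> \<xi>) * (ker b s y * cos (y \<bullet> \<xi>))
       + sin (x \<bullet> \<xi>) * (ker b s y * sin (y \<bullet> \<xi>))) \<partial>lborel)"
      by (simp only:)
    also have "\<dots> = symb a t \<xi> * (cos (x \<bullet> \<xi>) * symb b s \<xi>)"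
      using 1 integral_ker_cos[OF b s, of \<xi>] integral_ker_sin[of b s \<xi>] by simp
    finally have "(\<integral>y. cos ((x - y) \<bullet> \<xi>) * (ker b s y * symb a t \<xi>) \<partial>lborel)
      = symb a t \<xi> * (cos (x \<bullet> \<xi>) * symb b s \<xi>)" .
    thus "(\<integral>y. cos ((x - y) \<bullet> \<xi>) * (ker b s y * symb a t \<xi>) \<partial>lborel) = cos (x \<bullet> \<xi>) * symb (a + b) (t + s) \<xi>"
      by (simp add: symb_mult[symmetric])
  qed
  finally show ?thesis by (simp add: ker_def)
qed

section \<open>Identification of the heat kernels of the problem with \<open>ker\<close>\<close>

lemma frac_heat_kernel_eq:
  assumes "0 < t"
  shows "frac_heat_kernel \<sigma> t (x::'a::euclidean_space) = ker 0 t x"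
proof -
  let ?f = "\<lambda>\<xi>. exp (\<i> * complex_of_real (x \<bullet> \<xi>)) * complex_of_real (exp (- t * norm \<xi> powr (2 * \<sigma>)))"
  have "integrable lborel ?f"
    by (rule Bochner_Integration.integrable_bound[OF integrable_symb[of 0 t, where 'a='a]])
       (use assms in \<open>auto simp: symb_def norm_mult\<close>)
  from integral_Re[OF this] have "Re (integral\<^sup>L lborel ?f) = (\<integral>\<xi>. Re (?f \<xi>) \<partial>lborel)" by simp
  moreover have "Re (?f \<xi>) = cos (x \<bullet> \<xi>) * symb 0 t \<xi>" for \<xi>
    by (simp add: Re_exp symb_def)
  ultimately show ?thesis unfolding frac_heat_kernel_def ker_def by simp
qed

lemma mixed_heat_kernel_eq:
  assumes "0 < t"
  shows "mixed_heat_kernel \<sigma> t (x::'a::euclidean_space) = ker t t x"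
proof -
  have "mixed_heat_kernel \<sigma> t x = (\<integral>\<xi>. ker t 0 (x - \<xi>) * ker 0 t \<xi> \<partial>lborel)"
    unfolding mixed_heat_kernel_def ker_gaussian[OF assms] frac_heat_kernel_eq[OF assms]
    by (simp add: mult.assoc)
  \<comment> \<open>Reflection moves the fractional kernel, for which no integrability is available,
    into the first slot of \<open>ker_convolution\<close>.\<close>
  also have "\<dots> = (\<integral>\<xi>. ker 0 t (x - \<xi>) * ker t 0 \<xi> \<partial>lborel)"
    by (subst integral_lborel_affine[of "-1" _ x]) (auto simp: mult.commute)
  also have "\<dots> = ker t t x" using ker_convolution[of 0 t t 0 x] assms by simp
  finally show ?thesis .
qed

section \<open>Continuity of the kernel in its times\<close>

lemma tendsto_symb_L1:
  assumes a: "0 < a" and an: "an \<longlonglongrightarrow> a" and tn: "tn \<longlonglongrightarrow> t" and t0: "\<And>n. 0 \<le> tn n"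
  shows "(\<lambda>n. \<integral>\<xi>. \<bar>symb (an n) (tn n) \<xi> - symb a t (\<xi>::'a::euclidean_space)\<bar> \<partial>lborel) \<longlonglongrightarrow> 0"
proof -
  have t: "0 \<le> t" using LIMSEQ_le_const[OF tn] t0 by auto
  \<comment> \<open>Dropping finitely many terms keeps the Laplacian times above a/2, so twice the
    Gaussian symbol at time a/2 dominates all differences.\<close>
  have "eventually (\<lambda>n. a / 2 < an n) sequentially"
    using order_tendstoD(1)[OF an, of "a / 2"] a by simp
  then obtain N where N: "\<And>n. n \<ge> N \<Longrightarrow> a / 2 < an n" by (auto simp: eventually_sequentially)
  have "(\<lambda>n. \<integral>\<xi>. \<bar>symb (an (n + N)) (tn (n + N)) \<xi> - symb a t (\<xi>::'a)\<bar> \<partial>lborel) \<longlonglongrightarrow> (\<integral>\<xi>. (0::real) \<partial>(lborel :: 'a measure))"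
  proof (rule integral_dominated_convergence[where w="\<lambda>\<xi>. 2 * symb (a / 2) 0 \<xi>"])
    show "integrable lborel (\<lambda>\<xi>::'a. 2 * symb (a / 2) 0 \<xi>)"
      using integrable_symb[of "a / 2" 0, where 'a='a] a by simp
    show "AE \<xi> in lborel. (\<lambda>n. \<bar>symb (an (n + N)) (tn (n + N)) \<xi> - symb a t (\<xi>::'a)\<bar>) \<longlonglongrightarrow> 0"
    proof (rule AE_I2)
      fix \<xi> :: 'a
      have "(\<lambda>n. symb (an (n + N)) (tn (n + N)) \<xi>) \<longlonglongrightarrow> symb a t \<xi>"
        unfolding symb_def by (intro tendsto_intros LIMSEQ_ignore_initial_segment an tn)
      thus "(\<lambda>n. \<bar>symb (an (n + N)) (tn (n + N)) \<xi> - symb a t \<xi>\<bar>) \<longlonglongrightarrow> 0"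
        by (simp add: tendsto_rabs_zero_iff LIM_zero)
    qed
    show "AE \<xi> in lborel. norm \<bar>symb (an (n + N)) (tn (n + N)) \<xi> - symb a t (\<xi>::'a)\<bar> \<le> 2 * symb (a / 2) 0 \<xi>" for n
    proof (rule AE_I2)
      fix \<xi> :: 'a
      have "symb (an (n + N)) (tn (n + N)) \<xi> \<le> symb (a / 2) 0 \<xi>" "symb a t \<xi> \<le> symb (a / 2) 0 \<xi>"
        using N[of "n + N"] t0[of "n + N"] t a by (intro symb_antimono; simp)+
      thus "norm \<bar>symb (an (n + N)) (tn (n + N)) \<xi> - symb a t \<xi>\<bar> \<le> 2 * symb (a / 2) 0 \<xi>"
        using symb_pos[of "an (n + N)" "tn (n + N)" \<xi>] symb_pos[of a t \<xi>] by (simp del: symb_pos)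
    qed
  qed measurable
  thus ?thesis by (simp add: LIMSEQ_offset)
qed

text \<open>The right side does not depend on \<open>x\<close>. Besides pointwise convergence this
  gives continuity in time of the free evolution in the supremum norm, used in
  \<open>u_continuous\<close>.\<close>

lemma ker_diff_le:
  assumes "0 \<le> a" "0 \<le> t" "0 < a \<or> 0 < t" "0 \<le> b" "0 \<le> s" "0 < b \<or> 0 < s"
  shows "\<bar>ker a t x - ker b s (x::'a::euclidean_space)\<bar> \<le> (\<integral>\<xi>. \<bar>symb a t \<xi> - symb b s (\<xi>::'a)\<bar> \<partial>lborel) / (2 * pi) ^ DIM('a)"
proof -
  note I = integrable_cos_symb[OF assms(1-3), of x] integrable_cos_symb[OF assms(4-6), of x]
  note J = integrable_symb[OF assms(1-3), where 'a='a] integrable_symb[OF assms(4-6), where 'a='a]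
  have "ker a t x - ker b s x = (\<integral>\<xi>. cos (x \<bullet> \<xi>) * (symb a t \<xi> - symb b s \<xi>) \<partial>lborel) / (2 * pi) ^ DIM('a)"
    using I by (simp add: ker_def right_diff_distrib diff_divide_distrib)
  also have "\<bar>\<dots>\<bar> = \<bar>\<integral>\<xi>. cos (x \<bullet> \<xi>) * (symb a t \<xi> - symb b s \<xi>) \<partial>lborel\<bar> / (2 * pi) ^ DIM('a)"
    by simp
  also have "\<bar>\<integral>\<xi>. cos (x \<bullet> \<xi>) * (symb a t \<xi> - symb b s \<xi>) \<partial>lborel\<bar> \<le> (\<integral>\<xi>. \<bar>symb a t \<xi> - symb b s (\<xi>::'a)\<bar> \<partial>lborel)"
  proof (rule order_trans[OF integral_abs_bound integral_mono])
    show "integrable lborel (\<lambda>\<xi>::'a. \<bar>cos (x \<bullet> \<xi>) * (symb a t \<xi> - symb b s \<xi>)\<bar>)"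
      using integrable_abs[OF Bochner_Integration.integrable_diff[OF I]] by (simp add: right_diff_distrib)
  qed (use J in \<open>auto simp: abs_mult mult_left_le_one_le\<close>)
  finally show ?thesis by (simp add: divide_right_mono)
qed

lemma tendsto_ker:
  assumes a: "0 < a" and an: "an \<longlonglongrightarrow> a" and tn: "tn \<longlonglongrightarrow> t" and t0: "\<And>n. 0 \<le> tn n" "\<And>n. 0 < an n"
  shows "(\<lambda>n. ker (an n) (tn n) x) \<longlonglongrightarrow> ker a t (x::'a::euclidean_space)"
proof -
  have t: "0 \<le> t" using LIMSEQ_le_const[OF tn] t0 by auto
  have "(\<lambda>n. ker (an n) (tn n) x - ker a t x) \<longlonglongrightarrow> 0"
  proof (rule Lim_null_comparison)
    show "\<forall>\<^sub>F n in sequentially. norm (ker (an n) (tn n) x - ker a t x)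
        \<le> (\<integral>\<xi>. \<bar>symb (an n) (tn n) \<xi> - symb a t (\<xi>::'a)\<bar> \<partial>lborel) / (2 * pi) ^ DIM('a)"
      unfolding real_norm_def using a t t0 by (intro always_eventually allI ker_diff_le) (auto simp: less_imp_le)
    show "(\<lambda>n. (\<integral>\<xi>. \<bar>symb (an n) (tn n) \<xi> - symb a t (\<xi>::'a)\<bar> \<partial>lborel) / (2 * pi) ^ DIM('a)) \<longlonglongrightarrow> 0"
      by (rule tendsto_divide_zero[OF tendsto_symb_L1[OF a an tn t0(1)]])
  qed
  thus ?thesis by (simp add: LIM_zero_iff)
qed

text \<open>Scheffe's lemma: the kernels are nonnegative with mass 1, so pointwise convergence
  already implies convergence in L1.\<close>

lemma tendsto_ker_L1:
  assumes a: "0 < a" and an: "an \<longlonglongrightarrow> a" and tn: "tn \<longlonglongrightarrow> t" and t0: "\<And>n. 0 \<le> tn n" "\<And>n. 0 < an n"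
  shows "(\<lambda>n. \<integral>x. \<bar>ker (an n) (tn n) x - ker a t (x::'a::euclidean_space)\<bar> \<partial>lborel) \<longlonglongrightarrow> 0"
proof -
  have t: "0 \<le> t" using LIMSEQ_le_const[OF tn] t0 by auto
  have nn: "(\<integral>\<^sup>+x. ennreal (norm (ker b s (x::'a))) \<partial>lborel) = 1" if "0 < b" "0 \<le> s" for b s
    using integrable_ker[OF that, where 'a='a] integral_ker[OF that, where 'a='a] ker_nonneg[OF that, where 'a='a]
    by (simp add: nn_integral_eq_integral)
  have "(\<lambda>n. \<integral>\<^sup>+x. norm (ker (an n) (tn n) x - ker a t (x::'a)) \<partial>lborel) \<longlonglongrightarrow> 0"
    by (rule Scheffe_lemma2)
       (use t0 a t in \<open>auto intro!: AE_I2 tendsto_ker integrable_ker an tn simp: nn[unfolded real_norm_def]\<close>)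
  moreover have "(\<integral>\<^sup>+x. norm (ker (an n) (tn n) x - ker a t (x::'a)) \<partial>lborel)
      = ennreal (\<integral>x. \<bar>ker (an n) (tn n) x - ker a t (x::'a)\<bar> \<partial>lborel)" for n
    using integrable_ker[OF t0(2,1), where 'a='a] integrable_ker[OF a t, where 'a='a]
    by (simp add: nn_integral_eq_integral)
  ultimately show ?thesis
    by (simp add: ennreal_0[symmetric] tendsto_ennreal_iff del: ennreal_0)
qed

section \<open>Decay and lower bound of the kernel at large times\<close>

lemma ker_upper_bound:
  assumes "0 < t" "0 \<le> a"
  shows "ker a t (x::'a::euclidean_space) \<le> ker 0 1 (0::'a) * t powr (- (DIM('a) / (2 * \<sigma>)))"
proof -
  \<comment> \<open>The solution of \<open>t * r powr (2 * \<sigma>) = 1\<close>; it is applied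
    after the Laplacian part has been dropped.\<close>
  define r where "r = t powr (- 1 / (2 * \<sigma>))"
  have r: "0 < r" using assms by (simp add: r_def)
  have "ker a t x \<le> ker a t (0::'a)" using assms by (intro ker_le_ker_0) auto
  also have "\<dots> \<le> ker 0 t (0::'a)" using assms by (intro ker_0_antimono) auto
  also have "\<dots> = r ^ DIM('a) * ker 0 (t * r powr (2 * \<sigma>)) (0::'a)"
    using ker_scale[OF r, of 0 t "0::'a"] by simp
  also have "t * r powr (2 * \<sigma>) = 1"
  proof -
    have "r powr (2 * \<sigma>) = t powr (- 1)" unfolding r_def powr_powr using sigma_pos by simp
    thus ?thesis using assms by (simp add: powr_minus)
  qed
  also have "r ^ DIM('a) = t powr (- (DIM('a) / (2 * \<sigma>)))"
    using assms sigma_pos by (simp add: r_def powr_realpow[symmetric] powr_powr)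
  finally show ?thesis by (simp add: mult.commute)
qed

lemma ker_lower_bound:
  "\<exists>A>0. \<exists>c>0. \<forall>t\<ge>1. \<forall>x::'a::euclidean_space. norm x \<le> A * t powr (1 / (2 * \<sigma>)) \<longrightarrow>
      c * t powr (- (DIM('a) / (2 * \<sigma>))) \<le> ker t t x"
proof -
  define m1 where "m1 = (\<integral>\<xi>. symb 1 1 (\<xi>::'a) \<partial>lborel)"
  define m2 where "m2 = (\<integral>\<xi>. norm \<xi> * symb 0 1 (\<xi>::'a) \<partial>lborel)"
  have I1: "integrable lborel (symb 1 1 :: 'a \<Rightarrow> real)" by (rule integrable_symb) auto
  have I2: "integrable lborel (\<lambda>\<xi>::'a. norm \<xi> * symb 0 1 \<xi>)"
    by (rule Bochner_Integration.integrable_bound[OF integrable_norm_symb[of 1 0]])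
       (auto simp: abs_mult intro!: AE_I2 mult_right_mono)
  have m1: "0 < m1"
  proof -
    have "m1 = 0 \<longleftrightarrow> (AE \<xi> in lborel. symb 1 1 (\<xi>::'a) = 0)"
      unfolding m1_def by (rule integral_nonneg_eq_0_iff_AE[OF I1]) auto
    moreover have "symb 1 1 \<xi> \<noteq> 0" for \<xi> :: 'a using symb_pos[of 1 1 \<xi>] by linarith
    ultimately have "m1 \<noteq> 0" by (simp add: eventually_False ae_filter_eq_bot_iff del: symb_pos)
    moreover have "0 \<le> m1" unfolding m1_def by (intro Bochner_Integration.integral_nonneg) auto
    ultimately show ?thesis by linarith
  qed
  have m2: "0 \<le> m2" unfolding m2_def by (intro Bochner_Integration.integral_nonneg) auto
  \<comment> \<open>After rescaling, \<open>symb 1 1\<close> bounds the symbol from below and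
    \<open>symb 0 1\<close> from above, uniformly in \<open>t\<close>. On the ball of radius
    \<open>A\<close> the cosine loses at most \<open>A * m2\<close>, and this is at most half of
    \<open>m1\<close>; the summand 1 guards against a zero denominator.\<close>
  define A where "A = m1 / (2 * (m2 + 1))"
  define c where "c = m1 / 2 / (2 * pi) ^ DIM('a)"
  have "c * t powr (- (DIM('a) / (2 * \<sigma>))) \<le> ker t t x" 
    if t: "t \<ge> 1" and x: "norm x \<le> A * t powr (1 / (2 * \<sigma>))" for t and x :: 'a
  proof -
    define r where "r = t powr (- 1 / (2 * \<sigma>))"
    have r: "0 < r" using t by (simp add: r_def)
    have r1: "t * r powr (2 * \<sigma>) = 1"
    proof -
      have "r powr (2 * \<sigma>) = t powr (- 1)" unfolding r_def powr_powr using sigma_pos by simp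
      thus ?thesis using t by (simp add: powr_minus)
    qed
    have r2: "r ^ DIM('a) = t powr (- (DIM('a) / (2 * \<sigma>)))"
      using t sigma_pos by (simp add: r_def powr_realpow[symmetric] powr_powr)
    \<comment> \<open>Here \<open>\<sigma> < 1\<close> and \<open>t \<ge> 1\<close> enter: the
      rescaled Laplacian time is t to the power 1 - 1/\<sigma>, whose exponent is negative.\<close>
    have r3: "t * r\<^sup>2 \<le> 1"
    proof -
      have "r\<^sup>2 = t powr (- 1 / \<sigma>)"
        using t powr_powr[of t "- 1 / (2 * \<sigma>)" 2] by (simp add: r_def)
      hence "t * r\<^sup>2 = t powr (1 - 1 / \<sigma>)"
        using t by (simp add: powr_diff powr_minus divide_inverse)
      also have "\<dots> \<le> t powr 0"
        using t sigma_pos sigma_less_1 by (intro powr_mono) auto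
      finally show ?thesis using t by simp
    qed
    have r4: "norm (r *\<^sub>R x) \<le> A"
    proof -
      have "norm (r *\<^sub>R x) \<le> r * (A * t powr (1 / (2 * \<sigma>)))" using x r by simp
      also have "\<dots> = A * (r * t powr (1 / (2 * \<sigma>)))" by simp
      also have "r * t powr (1 / (2 * \<sigma>)) = 1" using t by (simp add: r_def powr_minus field_simps)
      finally show ?thesis by simp
    qed
    have "m1 / 2 \<le> m1 - A * m2"
    proof -
      have "A * m2 \<le> A * (m2 + 1)" using m1 m2 by (simp add: A_def field_simps)
      also have "\<dots> = m1 / 2" using m2 by (simp add: A_def field_simps)
      finally show ?thesis by simp
    qed
    also have "\<dots> = (\<integral>\<xi>. symb 1 1 \<xi> - A * (norm \<xi> * symb 0 1 (\<xi>::'a)) \<partial>lborel)"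
      unfolding m1_def m2_def using I1 I2 by simp
    also have "\<dots> \<le> (\<integral>\<xi>. cos (r *\<^sub>R x \<bullet> \<xi>) * symb (t * r\<^sup>2) 1 \<xi> \<partial>lborel)"
    proof (rule integral_mono)
      show "integrable lborel (\<lambda>\<xi>. cos (r *\<^sub>R x \<bullet> \<xi>) * symb (t * r\<^sup>2) 1 \<xi>)"
        using t by (intro integrable_cos_symb) auto
      fix \<xi> :: 'a
      have "1 - \<bar>r *\<^sub>R x \<bullet> \<xi>\<bar> \<le> cos (r *\<^sub>R x \<bullet> \<xi>)"
        by (rule one_minus_abs_le_cos)
      moreover have "\<bar>r *\<^sub>R x \<bullet> \<xi>\<bar> \<le> A * norm \<xi>"
        using Cauchy_Schwarz_ineq2[of "r *\<^sub>R x" \<xi>] mult_right_mono[OF r4, of "norm \<xi>"] by (meson norm_ge_zero order_trans)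
      ultimately have "(1 - A * norm \<xi>) * symb (t * r\<^sup>2) 1 \<xi> \<le> cos (r *\<^sub>R x \<bullet> \<xi>) * symb (t * r\<^sup>2) 1 \<xi>"
        by (intro mult_right_mono) auto
      moreover have "symb 1 1 \<xi> \<le> symb (t * r\<^sup>2) 1 \<xi>" using r3 by (intro symb_antimono) auto
      moreover have "(A * norm \<xi>) * symb (t * r\<^sup>2) 1 \<xi> \<le> (A * norm \<xi>) * symb 0 1 \<xi>"
        using t m1 m2 by (intro mult_left_mono symb_antimono) (auto simp: A_def)
      ultimately show "symb 1 1 \<xi> - A * (norm \<xi> * symb 0 1 \<xi>) \<le> cos (r *\<^sub>R x \<bullet> \<xi>) * symb (t * r\<^sup>2) 1 \<xi>"
        by (simp add: algebra_simps)
    qed (use I1 I2 in simp)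
    finally have "c \<le> ker (t * r\<^sup>2) 1 (r *\<^sub>R x)"
      unfolding c_def ker_def by (rule divide_right_mono) simp
    hence "c * r ^ DIM('a) \<le> ker t t x"
      unfolding ker_scale[OF r, of t t x] r1 using r by (simp add: mult.commute)
    thus ?thesis by (simp add: r2)
  qed
  moreover have "A > 0" "c > 0" using m1 m2 by (auto simp: A_def c_def)
  ultimately show ?thesis by blast
qed

end

section \<open>The semigroup\<close>

lemma powr_above_tangent:
  fixes a b p :: real
  assumes "0 < a" "0 \<le> b" "1 \<le> p"
  shows "a powr p + p * a powr (p - 1) * (b - a) \<le> b powr p"
\<comment> \<open>Convexity is applied on the open half-line, so the endpoint 0 is checked by
  hand.\<close>
proof (cases "b = 0")
  case True
  have "a powr p = a powr (p - 1) * a" using assms by (simp add: powr_diff)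
  moreover have "a powr (p - 1) * a \<le> p * (a powr (p - 1) * a)"
    using mult_right_mono[of 1 p "a powr (p - 1) * a"] assms by simp
  ultimately show ?thesis using True assms by (simp add: algebra_simps)
next
  case False
  have "p * a powr (p - 1) * (b - a) \<le> b powr p - a powr p"
  proof (rule convex_on_imp_above_tangent)
    show "convex_on {0<..} (\<lambda>x. x powr p)" using assms by (rule_tac powr_convex)
    show "((\<lambda>x. x powr p) has_real_derivative p * a powr (p - 1)) (at a within {0<..})"
      using assms by (auto intro!: derivative_eq_intros)
    show "b \<in> {0<..}" using False assms by simp
  qed (use assms in \<open>auto simp: interior_open\<close>)
  thus ?thesis by simp
qed

text \<open>
  A mild solution is measurable in \<open>x\<close> for each time only; joint measurability, needed for Fubini, is
  recovered for the integrand of Duhamel's formula from its continuity in time.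
\<close>

lemma borel_measurable_caratheodory:
  fixes f :: "real \<Rightarrow> 'b \<Rightarrow> real"
  assumes cont: "\<And>y. y \<in> space M \<Longrightarrow> continuous_on {0..<t} (\<lambda>s. f s y)"
    and meas: "\<And>s. 0 \<le> s \<Longrightarrow> s < t \<Longrightarrow> f s \<in> borel_measurable M"
  shows "(\<lambda>(s, y). indicator {0..<t} s * f s y) \<in> borel_measurable ((lborel :: real measure) \<Otimes>\<^sub>M M)"
proof -
  \<comment> \<open>The time is rounded down to the grid of mesh 1/(n + 1), hence stays in [0, t).
    The inner indicator suppresses grid times outside this interval, where \<open>f\<close> is not
    known to be measurable.\<close>
  define F where "F = (\<lambda>n (s, y). indicator {0..<t} s * (indicator {0..<t} (real (nat \<lfloor>s * Suc n\<rfloor>) / Suc n) * f (real (nat \<lfloor>s * Suc n\<rfloor>) / Suc n) y))"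
  show ?thesis
  proof (rule borel_measurable_LIMSEQ_real[where u=F])
    fix z assume z: "z \<in> space ((lborel :: real measure) \<Otimes>\<^sub>M M)"
    obtain s y where zz: "z = (s, y)" by (cases z)
    show "(\<lambda>n. F n z) \<longlonglongrightarrow> (case z of (s, y) \<Rightarrow> indicator {0..<t} s * f s y)"
    proof (cases "0 \<le> s \<and> s < t")
      case True
      define q where "q n = real (nat \<lfloor>s * Suc n\<rfloor>) / Suc n" for n
      have q: "0 \<le> q n" "q n \<le> s" "s - 1 / Suc n \<le> q n" for n
      proof -
        have *: "real (nat \<lfloor>s * Suc n\<rfloor>) = of_int \<lfloor>s * Suc n\<rfloor>" using True by simp
        show "0 \<le> q n" by (simp add: q_def)
        have "of_int \<lfloor>s * Suc n\<rfloor> \<le> s * Suc n" "s * Suc n - 1 \<le> of_int \<lfloor>s * Suc n\<rfloor>" by linarith+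
        hence "of_int \<lfloor>s * Suc n\<rfloor> / Suc n \<le> s * Suc n / Suc n" "(s * Suc n - 1) / Suc n \<le> of_int \<lfloor>s * Suc n\<rfloor> / Suc n"
          by (intro divide_right_mono; simp)+
        thus "q n \<le> s" "s - 1 / Suc n \<le> q n" unfolding q_def *
          by (simp_all add: diff_divide_distrib del: of_nat_Suc)
      qed
      have "q \<longlonglongrightarrow> s"
      proof (rule tendsto_sandwich[of "\<lambda>n. s - 1 / Suc n" _ _ "\<lambda>_. s"])
        show "(\<lambda>n. s - 1 / real (Suc n)) \<longlonglongrightarrow> s" by real_asymp
      qed (use q in auto)
      moreover have "continuous_on {0..<t} (\<lambda>s. f s y)" using cont z zz by (auto simp: space_pair_measure)
      moreover have qt: "q n \<in> {0..<t}" for n using q(1,2)[of n] True by auto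
      ultimately have "(\<lambda>n. f (q n) y) \<longlonglongrightarrow> f s y"
        unfolding continuous_on_sequentially comp_def using True by auto
      with qt show ?thesis using True by (simp add: F_def zz q_def)
    qed (simp add: F_def zz)
  next
    fix n
    have 1: "(\<lambda>z. indicator {0..<t} (real k / Suc n) * f (real k / Suc n) (snd z)) \<in> borel_measurable ((lborel :: real measure) \<Otimes>\<^sub>M M)" for k
    proof (cases "real k / Suc n \<in> {0..<t}")
      case True
      then have [measurable]: "f (real k / Suc n) \<in> borel_measurable M" by (intro meas) auto
      show ?thesis by measurable
    qed (simp add: indicator_def)
    have 2: "(\<lambda>z. nat \<lfloor>fst z * real (Suc n)\<rfloor>) \<in> (lborel :: real measure) \<Otimes>\<^sub>M M \<rightarrow>\<^sub>M count_space UNIV"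
      by measurable
    have 3: "(\<lambda>z. indicator {0..<t} (fst z) :: real) \<in> borel_measurable ((lborel :: real measure) \<Otimes>\<^sub>M M)"
      by measurable
    show "F n \<in> borel_measurable ((lborel :: real measure) \<Otimes>\<^sub>M M)"
      using borel_measurable_times[OF 3 measurable_compose_countable[OF 1 2]]
      by (simp add: F_def case_prod_beta')
  qed
qed

lemma Linf_measurable: "f \<in> Linf \<Longrightarrow> f \<in> borel_measurable borel"
  by (simp add: Linf_def)

lemma AE_le_of_Linf_norm_le:
  assumes "Linf_norm f \<le> ereal b"
  shows "AE x in lborel. \<bar>f x\<bar> \<le> b"
  using esssup_AE[of "\<lambda>x. ereal \<bar>f x\<bar>" lborel] unfolding Linf_norm_def[symmetric]
  by eventually_elim (use assms in \<open>metis ereal_less_eq(3) order_trans\<close>)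

lemma Linf_norm_le:
  assumes "f \<in> borel_measurable borel" "AE x in lborel. \<bar>f x\<bar> \<le> b"
  shows "Linf_norm f \<le> ereal b"
  unfolding Linf_norm_def using assms by (intro esssup_I) auto

lemma Linf_norm_nonneg: "0 \<le> Linf_norm (f :: 'a::euclidean_space \<Rightarrow> real)"
proof (rule ccontr)
  assume *: "\<not> 0 \<le> Linf_norm f"
  have "AE x::'a in lborel. False"
    using esssup_AE[of "\<lambda>x. ereal \<bar>f x\<bar>" lborel] unfolding Linf_norm_def[symmetric]
  proof eventually_elim
    case (elim x)
    have "0 \<le> ereal \<bar>f x\<bar>" by simp
    with elim * show ?case using order_trans by blast
  qed
  thus False by (simp add: eventually_False ae_filter_eq_bot_iff)
qed

lemma Linf_AE_bound:
  assumes "f \<in> Linf"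
  shows "\<exists>M\<ge>0. AE x in lborel. \<bar>f x\<bar> \<le> M"
proof -
  obtain r where r: "Linf_norm f = ereal r"
    using assms Linf_norm_nonneg[of f] by (cases "Linf_norm f") (auto simp: Linf_def)
  thus ?thesis using AE_le_of_Linf_norm_le[of f r] Linf_norm_nonneg[of f] by auto
qed

section \<open>Contraction, semigroup law, Jensen's inequality and continuity for
  \<open>S\<close>\<close>

context mixed_diffusion
begin

definition S :: "real \<Rightarrow> ('a::euclidean_space \<Rightarrow> real) \<Rightarrow> 'a \<Rightarrow> real" where
  "S r \<phi> x = (\<integral>y. ker r r (x - y) * \<phi> y \<partial>lborel)"

lemma mixed_semigroup_eq: "0 < r \<Longrightarrow> mixed_semigroup \<sigma> r \<phi> x = S r \<phi> x"
  by (simp add: mixed_semigroup_def S_def mixed_heat_kernel_eq)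

lemma
  assumes "0 < a" "0 \<le> t"
  shows integrable_ker_translate: "integrable lborel (\<lambda>y. ker a t (x - y :: 'a::euclidean_space))"
    and integral_ker_translate: "(\<integral>y. ker a t (x - y :: 'a) \<partial>lborel) = 1"
proof -
  show "integrable lborel (\<lambda>y. ker a t (x - y :: 'a))"
    using integrable_lborel_affine[OF _ integrable_ker[OF assms], of "-1" x] by simp
  show "(\<integral>y. ker a t (x - y :: 'a) \<partial>lborel) = 1"
    using integral_lborel_affine[of "-1" "ker a t :: 'a \<Rightarrow> real" x] integral_ker[OF assms, where 'a='a]
    by simp
qed

lemma measurable_S [measurable (raw)]:
  assumes [measurable]: "\<phi> \<in> borel_measurable borel" "f \<in> borel_measurable M" "g \<in> borel_measurable M"
  shows "(\<lambda>z. S (f z) \<phi> (g z)) \<in> borel_measurable M"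
  unfolding S_def by measurable

lemma integrable_ker_mult_bounded:
  assumes r: "0 < r" and [measurable]: "\<phi> \<in> borel_measurable borel" and M: "AE y in lborel. \<bar>\<phi> y\<bar> \<le> M"
  shows "integrable lborel (\<lambda>y. ker r r (x - y :: 'a::euclidean_space) * \<phi> y)"
proof (rule Bochner_Integration.integrable_bound)
  show "integrable lborel (\<lambda>y. M * ker r r (x - y))"
    using integrable_ker_translate[of r r x] r by simp
  show "AE y in lborel. norm (ker r r (x - y) * \<phi> y) \<le> norm (M * ker r r (x - y))"
    using M
  proof eventually_elim
    case (elim y)
    have "0 \<le> ker r r (x - y)" using r by (intro ker_nonneg) auto
    hence "ker r r (x - y) * \<bar>\<phi> y\<bar> \<le> \<bar>M\<bar> * ker r r (x - y)"
      using elim by (subst mult.commute) (intro mult_right_mono, auto)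
    thus ?case using \<open>0 \<le> ker r r (x - y)\<close> by (simp add: abs_mult)
  qed
qed measurable

lemma integrable_ker_mult_integrable:
  assumes r: "0 < r" and \<phi>: "integrable lborel \<phi>"
  shows "integrable lborel (\<lambda>y. ker r r (x - y :: 'a::euclidean_space) * \<phi> y)"
proof (rule integrable_mult_bounded[OF \<phi>])
  show "\<bar>ker r r (x - y)\<bar> \<le> ker r r (0::'a)" for y
    using ker_le_ker_0[of r r "x - y"] ker_nonneg[of r r "x - y"] r by auto
qed measurable

lemma S_nonneg:
  assumes r: "0 < r" and "AE y in lborel. 0 \<le> \<phi> y"
  shows "0 \<le> S r \<phi> (x::'a::euclidean_space)"
  unfolding S_def using assms(2)
  by (intro integral_nonneg_AE) (auto elim!: eventually_mono intro!: mult_nonneg_nonneg ker_nonneg simp: r less_imp_le)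

lemma S_mono:
  assumes r: "0 < r" and "integrable lborel (\<lambda>y. ker r r (x - y) * \<phi> y)" "integrable lborel (\<lambda>y. ker r r (x - y) * \<psi> y)"
    and "AE y in lborel. \<phi> y \<le> \<psi> y"
  shows "S r \<phi> x \<le> S r \<psi> (x::'a::euclidean_space)"
  unfolding S_def using assms(4)
  by (intro integral_mono_AE assms(2,3)) (auto elim!: eventually_mono intro!: mult_left_mono ker_nonneg simp: r less_imp_le)

lemma S_abs_le:
  assumes r: "0 < r" and [measurable]: "\<phi> \<in> borel_measurable borel" and M: "AE y in lborel. \<bar>\<phi> y\<bar> \<le> M"
  shows "\<bar>S r \<phi> (x::'a::euclidean_space)\<bar> \<le> M"
proof -
  note I = integrable_ker_mult_bounded[OF assms, of x]
  have "\<bar>S r \<phi> x\<bar> \<le> (\<integral>y. \<bar>ker r r (x - y) * \<phi> y\<bar> \<partial>lborel)"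
    unfolding S_def by (rule integral_abs_bound)
  also have "\<dots> \<le> (\<integral>y. M * ker r r (x - y) \<partial>lborel)"
  proof (rule integral_mono_AE)
    show "AE y in lborel. \<bar>ker r r (x - y) * \<phi> y\<bar> \<le> M * ker r r (x - y)"
      using M
    proof eventually_elim
      case (elim y)
      have "0 \<le> ker r r (x - y)" using r by (intro ker_nonneg) auto
      with elim show ?case by (simp add: abs_mult mult.commute mult_right_mono)
    qed
  qed (use I integrable_ker_translate[of r r x] r in auto)
  also have "\<dots> = M" using integral_ker_translate[of r r x] r by simp
  finally show ?thesis .
qed

text \<open>Split into \<open>S r'\<close> applied to the difference of the functions, bounded by
  contraction, and the difference of the kernels applied to \<open>\<phi>\<close>, bounded by their
  L1 distance.\<close>

lemma S_diff_le:
  assumes r: "0 < r" and r': "0 < r'" and [measurable]: "\<phi> \<in> borel_measurable borel" "\<psi> \<in> borel_measurable borel"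
    and M: "AE y in lborel. \<bar>\<phi> y\<bar> \<le> M" and e: "AE y in lborel. \<bar>\<psi> y - \<phi> y\<bar> \<le> e"
  shows "\<bar>S r' \<psi> x - S r \<phi> (x::'a::euclidean_space)\<bar> \<le> e + M * (\<integral>y. \<bar>ker r' r' y - ker r r (y::'a)\<bar> \<partial>lborel)"
proof -
  have M': "AE y in lborel. \<bar>\<psi> y\<bar> \<le> M + e" using M e by eventually_elim linarith
  note I = integrable_ker_mult_bounded[OF r _ M, of x] integrable_ker_mult_bounded[OF r' _ M, of x]
    integrable_ker_mult_bounded[OF r' _ M', of x]
  have ki: "integrable lborel (\<lambda>y. \<bar>ker r' r' (x - y) - ker r r (x - y)\<bar>)"
    using integrable_ker_translate[of r r x] integrable_ker_translate[of r' r' x] r r' by auto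
  have "S r' \<psi> x - S r \<phi> x = S r' (\<lambda>y. \<psi> y - \<phi> y) x + (\<integral>y. (ker r' r' (x - y) - ker r r (x - y)) * \<phi> y \<partial>lborel)"
    unfolding S_def using I by (simp add: right_diff_distrib left_diff_distrib)
  moreover have "\<bar>S r' (\<lambda>y. \<psi> y - \<phi> y) x\<bar> \<le> e"
    using r' e by (intro S_abs_le) auto
  moreover have "\<bar>\<integral>y. (ker r' r' (x - y) - ker r r (x - y)) * \<phi> y \<partial>lborel\<bar>
      \<le> (\<integral>y. M * \<bar>ker r' r' (x - y) - ker r r (x - y)\<bar> \<partial>lborel)"
  proof (rule order_trans[OF integral_abs_bound integral_mono_AE])
    show "integrable lborel (\<lambda>y. \<bar>(ker r' r' (x - y) - ker r r (x - y)) * \<phi> y\<bar>)"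
      using integrable_abs[OF Bochner_Integration.integrable_diff[OF I(2) I(1)]] by (simp add: left_diff_distrib)
    show "AE y in lborel. \<bar>(ker r' r' (x - y) - ker r r (x - y)) * \<phi> y\<bar> \<le> M * \<bar>ker r' r' (x - y) - ker r r (x - y)\<bar>"
      using M by eventually_elim (simp add: abs_mult, subst mult.commute, rule mult_right_mono, auto)
  qed (use ki in simp)
  moreover have "(\<integral>y. \<bar>ker r' r' (x - y) - ker r r (x - y)\<bar> \<partial>lborel) = (\<integral>y. \<bar>ker r' r' y - ker r r (y::'a)\<bar> \<partial>lborel)"
    using integral_lborel_affine[of "-1" "\<lambda>y::'a. \<bar>ker r' r' y - ker r r y\<bar>" x] by simp
  ultimately show ?thesis by simp
qed

text \<open>Assuming integrability against the final kernel covers both applications in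
  \<open>J_eq\<close>: the integrable initial datum and the bounded source.\<close>

lemma S_semigroup:
  assumes r: "0 < r" and s: "0 < s" and [measurable]: "\<phi> \<in> borel_measurable borel"
    and I: "integrable lborel (\<lambda>z. ker (r + s) (r + s) (x - z) * \<phi> z)"
  shows "S r (S s \<phi>) x = S (r + s) \<phi> (x::'a::euclidean_space)"
proof -
  have conv: "(\<integral>y. ker r r (x - y) * ker s s (y - z) \<partial>lborel) = ker (r + s) (r + s) (x - z)" for z :: 'a
  proof -
    have "(\<integral>y. ker r r (x - y) * ker s s (y - z) \<partial>lborel) = (\<integral>y. ker r r ((x - z) - y) * ker s s y \<partial>lborel)"
      by (subst integral_lborel_affine[of 1 _ z]) (auto simp: algebra_simps)
    thus ?thesis using ker_convolution[of r r s s "x - z"] r s by simp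
  qed
  have nn: "0 \<le> ker r r (y::'a)" "0 \<le> ker s s (y::'a)" for y
    using r s by (auto intro!: ker_nonneg)
  have J: "integrable (lborel \<Otimes>\<^sub>M lborel) (\<lambda>(z, y). ker r r (x - y) * ker s s (y - z) * \<phi> z)"
  proof (rule lborel_pair.Fubini_integrable)
    have "(\<integral>y. norm (case (z, y) of (z, y) \<Rightarrow> ker r r (x - y) * ker s s (y - z) * \<phi> z) \<partial>lborel)
        = \<bar>ker (r + s) (r + s) (x - z) * \<phi> z\<bar>" for z
      using ker_nonneg[of "r + s" "r + s" "x - z"] r s nn by (simp add: abs_mult conv)
    thus "integrable lborel (\<lambda>z. \<integral>y. norm (case (z, y) of (z, y) \<Rightarrow> ker r r (x - y) * ker s s (y - z) * \<phi> z) \<partial>lborel)"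
      using integrable_abs[OF I] by simp
    have "integrable lborel (\<lambda>y. ker r r (x - y) * ker s s (y - z))" for z
      using nn s ker_le_ker_0[of s s]
      by (intro integrable_ker_mult_bounded[OF r, where M="ker s s (0::'a)"]) auto
    thus "AE z in lborel. integrable lborel (\<lambda>y. case (z, y) of (z, y) \<Rightarrow> ker r r (x - y) * ker s s (y - z) * \<phi> z)"
      by simp
  qed measurable
  have "S r (S s \<phi>) x = (\<integral>y. (\<integral>z. ker r r (x - y) * ker s s (y - z) * \<phi> z \<partial>lborel) \<partial>lborel)"
    unfolding S_def by (simp add: mult.assoc)
  also have "\<dots> = (\<integral>z. (\<integral>y. ker r r (x - y) * ker s s (y - z) * \<phi> z \<partial>lborel) \<partial>lborel)"
    using lborel_pair.Fubini_integral[OF J] by simp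
  also have "\<dots> = S (r + s) \<phi> x" by (simp add: conv S_def)
  finally show ?thesis .
qed

text \<open>The tangent line of the power at \<open>a = S r \<phi> x\<close> is integrated against
  the kernel; since the kernel has mass 1, the linear term cancels. For \<open>a = 0\<close> the
  left side vanishes.\<close>

lemma S_jensen:
  assumes r: "0 < r" and p: "1 \<le> p" and [measurable]: "\<phi> \<in> borel_measurable borel"
    and nn: "AE y in lborel. 0 \<le> \<phi> y" and M: "AE y in lborel. \<bar>\<phi> y\<bar> \<le> M"
  shows "S r \<phi> x powr p \<le> S r (\<lambda>y. \<phi> y powr p) (x::'a::euclidean_space)"
proof -
  define a where "a = S r \<phi> x"
  have a0: "0 \<le> a" unfolding a_def by (rule S_nonneg[OF r nn])
  have Mp: "AE y in lborel. \<bar>\<phi> y powr p\<bar> \<le> M powr p"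
    using nn M by eventually_elim (use p in \<open>auto intro!: powr_mono2\<close>)
  note I = integrable_ker_mult_bounded[OF r _ M, of x] integrable_ker_mult_bounded[OF r _ Mp, of x]
  note K = integrable_ker_translate[of r r x] integral_ker_translate[of r r x]
  show ?thesis
  proof (cases "a = 0")
    case False
    with a0 have a: "0 < a" by simp
    have "(\<integral>y. (a powr p - p * a powr (p - 1) * a) * ker r r (x - y) + p * a powr (p - 1) * (ker r r (x - y) * \<phi> y) \<partial>lborel)
        \<le> S r (\<lambda>y. \<phi> y powr p) x"
      unfolding S_def
    proof (rule integral_mono_AE)
      show "AE y in lborel. (a powr p - p * a powr (p - 1) * a) * ker r r (x - y) + p * a powr (p - 1) * (ker r r (x - y) * \<phi> y)
          \<le> ker r r (x - y) * \<phi> y powr p"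
        using nn
      proof eventually_elim
        case (elim y)
        have "ker r r (x - y) * (a powr p + p * a powr (p - 1) * (\<phi> y - a)) \<le> ker r r (x - y) * \<phi> y powr p"
          using powr_above_tangent[OF a elim p] r by (intro mult_left_mono ker_nonneg) auto
        thus ?case by (simp add: algebra_simps)
      qed
    qed (use I K r in auto)
    also have "(\<integral>y. (a powr p - p * a powr (p - 1) * a) * ker r r (x - y) + p * a powr (p - 1) * (ker r r (x - y) * \<phi> y) \<partial>lborel)
       = (a powr p - p * a powr (p - 1) * a) + p * a powr (p - 1) * a"
      using I K r by (simp add: a_def S_def)
    finally show ?thesis by (simp add: a_def)
  qed (use S_nonneg[OF r, of "\<lambda>y. \<phi> y powr p" x] in \<open>simp add: a_def\<close>)
qed

text \<open>The interval is open at \<open>T\<close>, where the kernel concentrates and continuity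
  in L1 is lost.\<close>

lemma continuous_on_S:
  fixes g :: "real \<Rightarrow> 'a::euclidean_space \<Rightarrow> real"
  assumes g [measurable]: "\<And>s. 0 \<le> s \<Longrightarrow> g s \<in> borel_measurable borel"
    and M: "\<And>s. 0 \<le> s \<Longrightarrow> s < T \<Longrightarrow> AE y in lborel. \<bar>g s y\<bar> \<le> M s"
    and cont: "\<And>s e. 0 \<le> s \<Longrightarrow> 0 < e \<Longrightarrow> \<exists>d>0. \<forall>s'\<ge>0. \<bar>s' - s\<bar> < d \<longrightarrow> (AE y in lborel. \<bar>g s' y - g s y\<bar> \<le> e)"
  shows "continuous_on {0..<T} (\<lambda>s. S (T - s) (g s) x)"
  unfolding continuous_on_sequentially comp_def
proof (intro allI ballI impI, elim conjE)
  fix sn s assume s: "s \<in> {0..<T}" and sn: "\<forall>n. sn n \<in> {0..<T}" and lim: "sn \<longlonglongrightarrow> s"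
  define D where "D n = (\<integral>y. \<bar>ker (T - sn n) (T - sn n) y - ker (T - s) (T - s) (y::'a)\<bar> \<partial>lborel)" for n
  have D: "D \<longlonglongrightarrow> 0"
    unfolding D_def using s sn by (intro tendsto_ker_L1 tendsto_intros lim) (auto simp: less_imp_le)
  have D0: "0 \<le> D n" for n unfolding D_def by (intro Bochner_Integration.integral_nonneg) auto
  show "(\<lambda>n. S (T - sn n) (g (sn n)) x) \<longlonglongrightarrow> S (T - s) (g s) x"
  proof (rule LIMSEQ_I)
    fix e :: real assume e: "0 < e"
    obtain d where d: "d > 0" "\<And>s'. s' \<ge> 0 \<Longrightarrow> \<bar>s' - s\<bar> < d \<Longrightarrow> AE y in lborel. \<bar>g s' y - g s y\<bar> \<le> e / 2"
      using cont[of s "e / 2"] s e by auto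
    obtain N1 where N1: "\<And>n. n \<ge> N1 \<Longrightarrow> \<bar>sn n - s\<bar> < d"
      using LIMSEQ_D[OF lim d(1)] by (auto simp: real_norm_def)
    have "(\<lambda>n. M s * D n) \<longlonglongrightarrow> M s * 0" by (intro tendsto_intros D)
    then obtain N2 where N2: "\<And>n. n \<ge> N2 \<Longrightarrow> \<bar>M s * D n\<bar> < e / 2"
      using LIMSEQ_D[of _ "M s * 0" "e / 2"] e by (auto simp: real_norm_def)
    show "\<exists>no. \<forall>n\<ge>no. norm (S (T - sn n) (g (sn n)) x - S (T - s) (g s) x) < e"
    proof (intro exI[of _ "max N1 N2"] allI impI)
      fix n assume n: "max N1 N2 \<le> n"
      have "\<bar>S (T - sn n) (g (sn n)) x - S (T - s) (g s) x\<bar> \<le> e / 2 + M s * D n"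
        unfolding D_def using s sn n N1[of n] M[of s] by (intro S_diff_le d(2) g) auto
      thus "norm (S (T - sn n) (g (sn n)) x - S (T - s) (g s) x) < e"
        using N2[of n] n by simp
    qed
  qed
qed

end

section \<open>Nonexistence\<close>

text \<open>The essential-supremum conditions of a global solution are restated in almost-everywhere
  form, which suits integration; \<open>global_mild_of_mild_solution\<close> supplies them.\<close>

locale global_mild = mixed_diffusion +
  fixes p :: real and u0 :: "'a::euclidean_space \<Rightarrow> real" and u :: "real \<Rightarrow> 'a \<Rightarrow> real"
  assumes p: "1 < p"
    and u0: "integrable lborel u0" and u0_pos: "\<And>x. 0 < u0 x"
    and u_meas: "\<And>s. 0 \<le> s \<Longrightarrow> u s \<in> borel_measurable borel"
    and u_nonneg: "\<And>s. 0 \<le> s \<Longrightarrow> AE y in lborel. 0 \<le> u s y"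
    and u_bdd: "\<And>T. 0 \<le> T \<Longrightarrow> \<exists>M\<ge>0. \<forall>s. 0 \<le> s \<and> s \<le> T \<longrightarrow> (AE y in lborel. \<bar>u s y\<bar> \<le> M)"
    and u_cont: "\<And>s e. 0 \<le> s \<Longrightarrow> 0 < e \<Longrightarrow>
      \<exists>d>0. \<forall>s'\<ge>0. \<bar>s' - s\<bar> < d \<longrightarrow> (AE y in lborel. \<bar>u s' y - u s y\<bar> \<le> e)"
    and u_eq: "\<And>t. 0 < t \<Longrightarrow> AE x in lborel. u t x = mixed_semigroup \<sigma> t u0 x
      + (LINT s:{0..t}|lborel. mixed_semigroup \<sigma> (t - s) (\<lambda>y. u s y powr p) x)"
begin

definition g :: "real \<Rightarrow> 'a \<Rightarrow> real" where "g s y = u s y powr p"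
text \<open>What the source at time \<open>s\<close> contributes at the origin at the horizon
  \<open>T\<close>. By \<open>J_eq\<close> this is the derivative of \<open>J T\<close>.\<close>

definition F :: "real \<Rightarrow> real \<Rightarrow> real" where "F T s = S (T - s) (g s) 0"
definition J :: "real \<Rightarrow> real \<Rightarrow> real" where "J T t = S (T - t) (u t) 0"

lemma g_meas: "0 \<le> s \<Longrightarrow> g s \<in> borel_measurable borel"
  using u_meas[of s] unfolding g_def by measurable

lemma g_nonneg: "0 \<le> g s y"
  by (simp add: g_def)

lemma g_bdd: 
  assumes "0 \<le> T"
  shows "\<exists>M\<ge>0. \<forall>s. 0 \<le> s \<and> s \<le> T \<longrightarrow> (AE y in lborel. \<bar>g s y\<bar> \<le> M)"
proof -
  obtain M where M: "M \<ge> 0" "\<And>s. 0 \<le> s \<Longrightarrow> s \<le> T \<Longrightarrow> AE y in lborel. \<bar>u s y\<bar> \<le> M"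
    using u_bdd[OF assms] by auto
  have "AE y in lborel. \<bar>g s y\<bar> \<le> M powr p" if "0 \<le> s" "s \<le> T" for s
    using M(2)[OF that] u_nonneg[OF that(1)] by eventually_elim (use p in \<open>auto simp: g_def intro!: powr_mono2\<close>)
  thus ?thesis by (intro exI[of _ "M powr p"]) auto
qed

lemma g_cont:
  assumes s: "0 \<le> s" and e: "0 < e"
  shows "\<exists>d>0. \<forall>s'\<ge>0. \<bar>s' - s\<bar> < d \<longrightarrow> (AE y in lborel. \<bar>g s' y - g s y\<bar> \<le> e)"
proof -
  obtain M where M: "M \<ge> 0" "AE y in lborel. \<bar>u s y\<bar> \<le> M" using u_bdd[OF s] s by auto
  have "uniformly_continuous_on {0..M + 1} (\<lambda>x. x powr p)"
    using p by (intro compact_uniformly_continuous continuous_on_powr') (auto intro!: continuous_intros)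
  then obtain c where c: "c > 0" "\<And>a b. a \<in> {0..M+1} \<Longrightarrow> b \<in> {0..M+1} \<Longrightarrow> \<bar>b - a\<bar> < c \<Longrightarrow> \<bar>b powr p - a powr p\<bar> < e"
    using e unfolding uniformly_continuous_on_def dist_real_def by metis
  \<comment> \<open>The bound 1 keeps nearby values of \<open>u\<close> in
    \<open>{0..M + 1}\<close>, where the power is uniformly continuous; c/2 makes the inequality
    strict.\<close>
  obtain d where d: "d > 0" "\<And>s'. s' \<ge> 0 \<Longrightarrow> \<bar>s' - s\<bar> < d \<Longrightarrow> AE y in lborel. \<bar>u s' y - u s y\<bar> \<le> min 1 (c / 2)"
    using u_cont[OF s, of "min 1 (c / 2)"] c by auto
  have "AE y in lborel. \<bar>g s' y - g s y\<bar> \<le> e" if s': "s' \<ge> 0" "\<bar>s' - s\<bar> < d" for s'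
    using d(2)[OF s'] M(2) u_nonneg[OF s] u_nonneg[OF s'(1)]
  proof eventually_elim
    case (elim y)
    have "\<bar>u s' y powr p - u s y powr p\<bar> < e"
      using elim c(1) by (intro c(2)) auto
    thus ?case by (simp add: g_def)
  qed
  with d(1) show ?thesis by blast
qed

section \<open>Duhamel's formula and its value at the origin\<close>

lemma continuous_on_S_g: "continuous_on {0..<T} (\<lambda>s. S (T - s) (g s) x)"
proof (cases "0 \<le> T")
  case True
  then obtain M where M: "M \<ge> 0" "\<And>s. 0 \<le> s \<Longrightarrow> s \<le> T \<Longrightarrow> AE y in lborel. \<bar>g s y\<bar> \<le> M"
    using g_bdd by metis
  show ?thesis
    by (rule continuous_on_S[where M="\<lambda>_. M"]) (use g_meas M(2) g_cont in auto)
qed simp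

lemma duhamel_integral:
  assumes "0 < t"
  shows "(LINT s:{0..t}|lborel. mixed_semigroup \<sigma> (t - s) (\<lambda>y. u s y powr p) x)
    = (\<integral>s. indicator {0..<t} s * S (t - s) (g s) x \<partial>lborel)"
  unfolding set_lebesgue_integral_def
proof (rule integral_cong_AE)
  have 1: "(\<lambda>s. indicator {0..<t} s * S (t - s) (g s) x) \<in> borel_measurable borel"
    using borel_measurable_continuous_on_indicator[OF _ continuous_on_S_g[of t x]] by simp
  show "(\<lambda>s. indicator {0..<t} s * S (t - s) (g s) x) \<in> borel_measurable lborel" using 1 by simp
  \<comment> \<open>At \<open>s = t\<close> the semigroup is the identity, so the two integrands may
    differ there; changing one point does not affect measurability in \<open>s\<close>.\<close>
  have "(\<lambda>s. indicator {0..t} s *\<^sub>R mixed_semigroup \<sigma> (t - s) (\<lambda>y. u s y powr p) x)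
     = (\<lambda>s. if s = t then g t x else indicator {0..<t} s * S (t - s) (g s) x)"
    using assms by (auto simp: fun_eq_iff indicator_def mixed_semigroup_eq g_def[abs_def] mixed_semigroup_def[of \<sigma> 0])
  thus "(\<lambda>s. indicator {0..t} s *\<^sub>R mixed_semigroup \<sigma> (t - s) (\<lambda>y. u s y powr p) x) \<in> borel_measurable lborel"
    using 1 by simp
  show "AE s in lborel. indicator {0..t} s *\<^sub>R mixed_semigroup \<sigma> (t - s) (\<lambda>y. u s y powr p) x
      = indicator {0..<t} s * S (t - s) (g s) x"
    using AE_lborel_singleton[of t]
    by eventually_elim (auto simp: indicator_def mixed_semigroup_eq g_def[abs_def])
qed

lemma u_duhamel:
  assumes "0 < t"
  shows "AE x in lborel. u t x = S t u0 x + (\<integral>s. indicator {0..<t} s * S (t - s) (g s) x \<partial>lborel)"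
  using u_eq[OF assms] by (simp only: duhamel_integral[OF assms] mixed_semigroup_eq[OF assms])

lemma u_ge:
  assumes "0 < t"
  shows "AE x in lborel. S t u0 x \<le> u t x"
  using u_duhamel[OF assms]
proof eventually_elim
  case (elim x)
  have "0 \<le> (\<integral>s. indicator {0..<t} s * S (t - s) (g s) x \<partial>lborel)"
    by (intro Bochner_Integration.integral_nonneg)
       (auto simp: indicator_def intro!: S_nonneg AE_I2 g_nonneg)
  with elim show ?case by simp
qed

lemma F_continuous: "continuous_on {0..<T} (F T)"
  unfolding F_def by (rule continuous_on_S_g)

lemma F_nonneg: "s < T \<Longrightarrow> 0 \<le> F T s"
  unfolding F_def by (intro S_nonneg) (auto simp: g_nonneg)

text \<open>Apply \<open>S (T - t)\<close> to Duhamel's formula at time \<open>t\<close> and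
  evaluate at 0. Fubini moves it inside the time integral, and the semigroup law merges it with
  \<open>S (t - s)\<close> into \<open>S (T - s)\<close>. The result is a gauge integral, ready for
  the fundamental theorem of calculus.\<close>

lemma J_eq:
  assumes t: "0 < t" "t < T"
  shows "J T t = S T u0 0 + integral {0..t} (F T)"
proof -
  have [measurable]: "u t \<in> borel_measurable borel" "u0 \<in> borel_measurable borel"
    using u_meas t u0 by (auto simp: integrable_iff_bounded)
  obtain M where M: "M \<ge> 0" "\<And>s. 0 \<le> s \<Longrightarrow> s \<le> t \<Longrightarrow> AE y in lborel. \<bar>g s y\<bar> \<le> M"
    using g_bdd[of t] t by auto
  define h where "h s y = indicator {0..<t} s * S (t - s) (g s) y" for s y
  have hb: "\<bar>h s y\<bar> \<le> M" for s y
    using S_abs_le[of "t - s" "g s" M y] g_meas M by (auto simp: h_def indicator_def)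
  have hm: "(\<lambda>(s, y). h s y) \<in> borel_measurable (lborel \<Otimes>\<^sub>M lborel)"
    unfolding h_def
  proof (rule borel_measurable_caratheodory)
    show "continuous_on {0..<t} (\<lambda>s. S (t - s) (g s) y)" for y by (rule continuous_on_S_g)
    show "(\<lambda>y. S (t - s) (g s) y) \<in> borel_measurable lborel" if "0 \<le> s" for s
      using g_meas[OF that] by measurable
  qed
  define D where "D y = (\<integral>s. h s y \<partial>lborel)" for y
  have Dm [measurable]: "D \<in> borel_measurable borel"
    unfolding D_def using hm by measurable
  have Db: "\<bar>D y\<bar> \<le> M * t" for y
  proof -
    have "\<bar>D y\<bar> \<le> (\<integral>s. \<bar>h s y\<bar> \<partial>lborel)" unfolding D_def by (rule integral_abs_bound)
    also have "\<dots> \<le> (\<integral>s. M * indicator {0..t} s \<partial>lborel)"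
    proof (rule integral_mono)
      show i: "integrable lborel (\<lambda>s. M * indicator {0..t} s :: real)"
        by (intro integrable_mult_right integrable_real_indicator) (auto simp: emeasure_lborel_Icc_eq)
      have m: "(\<lambda>s. h s y) \<in> borel_measurable lborel" using hm by measurable
      show le: "\<bar>h s y\<bar> \<le> M * indicator {0..t} s" for s using hb[of s y] by (auto simp: h_def indicator_def)
      show "integrable lborel (\<lambda>s. \<bar>h s y\<bar>)"
        by (rule Bochner_Integration.integrable_bound[OF i]) (use m le M(1) in \<open>auto intro!: AE_I2 simp: abs_mult\<close>)
    qed
    also have "\<dots> = M * t" using t by simp
    finally show ?thesis .
  qed
  \<comment> \<open>The locale provides integrability of \<open>u0\<close>, so the bound for
    \<open>S t u0\<close> is the supremum of the kernel times the L1 norm.\<close>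
  have I1: "integrable lborel (\<lambda>y. ker (T - t) (T - t) (0 - y) * S t u0 y)"
  proof (rule integrable_ker_mult_bounded[where M="ker t t (0::'a) * (\<integral>z. \<bar>u0 z\<bar> \<partial>lborel)"])
    have "\<bar>S t u0 y\<bar> \<le> ker t t (0::'a) * (\<integral>z. \<bar>u0 z\<bar> \<partial>lborel)" for y
    proof -
      have k: "\<bar>ker t t (y - z)\<bar> \<le> ker t t (0::'a)" for z
        using ker_le_ker_0[of t t "y - z"] ker_nonneg[of t t "y - z"] t by auto
      have "\<bar>S t u0 y\<bar> \<le> (\<integral>z. \<bar>ker t t (y - z) * u0 z\<bar> \<partial>lborel)"
        unfolding S_def by (rule integral_abs_bound)
      also have "\<dots> \<le> (\<integral>z. ker t t (0::'a) * \<bar>u0 z\<bar> \<partial>lborel)"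
        using integrable_abs[OF integrable_ker_mult_integrable[OF t(1) u0, of y]] u0 k
        by (intro integral_mono) (auto simp: abs_mult mult_right_mono)
      finally show ?thesis by simp
    qed
    thus "AE y in lborel. \<bar>S t u0 y\<bar> \<le> ker t t (0::'a) * (\<integral>z. \<bar>u0 z\<bar> \<partial>lborel)" by simp
  qed (use t in auto)
  have I2: "integrable lborel (\<lambda>y. ker (T - t) (T - t) (0 - y) * D y)"
    using t Db by (intro integrable_ker_mult_bounded[where M="M * t"]) auto
  have "J T t = (\<integral>y. ker (T - t) (T - t) (0 - y) * S t u0 y + ker (T - t) (T - t) (0 - y) * D y \<partial>lborel)"
    unfolding J_def S_def[of "T - t"]
  proof (rule integral_cong_AE)
    show "AE y in lborel. ker (T - t) (T - t) (0 - y) * u t y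
        = ker (T - t) (T - t) (0 - y) * S t u0 y + ker (T - t) (T - t) (0 - y) * D y"
      using u_duhamel[OF t(1)] by eventually_elim (simp add: D_def h_def algebra_simps)
  qed measurable
  also have "\<dots> = S (T - t) (S t u0) 0 + (\<integral>y. ker (T - t) (T - t) (0 - y) * D y \<partial>lborel)"
    using I1 I2 by (simp add: S_def[of "T - t"])
  also have "S (T - t) (S t u0) 0 = S T u0 0"
    using S_semigroup[of "T - t" t u0 0] integrable_ker_mult_integrable[of T u0 0] u0 t by simp
  also have "(\<integral>y. ker (T - t) (T - t) (0 - y) * D y \<partial>lborel)
     = (\<integral>y. (\<integral>s. h s y * (indicator {0..t} s * ker (T - t) (T - t) (0 - y)) \<partial>lborel) \<partial>lborel)"
  proof (rule Bochner_Integration.integral_cong[OF refl])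
    fix y
    \<comment> \<open>\<open>h\<close> vanishes outside \<open>{0..<t}\<close>, so this indicator
      changes nothing; it supplies the integrable function of \<open>s\<close> that
      \<open>fubini_lborel_bounded\<close> asks for.\<close>
    have "h s y * (indicator {0..t} s * ker (T - t) (T - t) (0 - y)) = ker (T - t) (T - t) (0 - y) * h s y" for s
      by (auto simp: h_def indicator_def)
    thus "ker (T - t) (T - t) (0 - y) * D y = (\<integral>s. h s y * (indicator {0..t} s * ker (T - t) (T - t) (0 - y)) \<partial>lborel)"
      by (simp only: D_def integral_mult_right_zero)
  qed
  also have "\<dots> = (\<integral>s. (\<integral>y. h s y * (indicator {0..t} s * ker (T - t) (T - t) (0 - y)) \<partial>lborel) \<partial>lborel)"
    using integrable_ker_translate[of "T - t" "T - t" "0::'a"] t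
    by (intro fubini_lborel_bounded[OF _ _ hm hb, symmetric]) auto
  also have "\<dots> = (\<integral>s. indicator {0..<t} s * F T s \<partial>lborel)"
  proof (rule Bochner_Integration.integral_cong[OF refl])
    fix s :: real
    show "(\<integral>y. h s y * (indicator {0..t} s * ker (T - t) (T - t) (0 - y)) \<partial>lborel) = indicator {0..<t} s * F T s"
    proof (cases "0 \<le> s \<and> s < t")
      case True
      have "(\<integral>y. h s y * (indicator {0..t} s * ker (T - t) (T - t) (0 - y)) \<partial>lborel) = S (T - t) (S (t - s) (g s)) 0"
        using True by (simp add: h_def S_def[of "T - t"] mult.commute)
      also have "\<dots> = S (T - s) (g s) 0"
        using S_semigroup[of "T - t" "t - s" "g s" 0] g_meas[of s] True t
          integrable_ker_mult_bounded[of "T - s" "g s" M 0] M(2)[of s] by simp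
      finally show ?thesis using True by (simp add: F_def)
    qed (auto simp: h_def indicator_def)
  qed
  also have "\<dots> = (LINT s:{0..t}|lborel. F T s)"
    unfolding set_lebesgue_integral_def
  proof (rule integral_cong_AE)
    have c: "continuous_on {0..t} (F T)" "continuous_on {0..<t} (F T)"
      using t by (auto intro: continuous_on_subset[OF F_continuous[of T]])
    show "(\<lambda>s. indicator {0..<t} s * F T s) \<in> borel_measurable lborel"
      "(\<lambda>s. indicator {0..t} s *\<^sub>R F T s) \<in> borel_measurable lborel"
      using borel_measurable_continuous_on_indicator[OF _ c(2)] borel_measurable_continuous_on_indicator[OF _ c(1)]
      by simp_all
    show "AE s in lborel. indicator {0..<t} s * F T s = indicator {0..t} s *\<^sub>R F T s"
      using AE_lborel_singleton[of t] by eventually_elim (auto simp: indicator_def)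
  qed
  also have "\<dots> = integral {0..t} (F T)"
    using t by (intro set_borel_integral_eq_integral borel_integrable_atLeastAtMost'
        continuous_on_subset[OF F_continuous[of T]]) auto
  finally show ?thesis .
qed

lemma F_ge_J_powr:
  assumes "0 \<le> s" "s < T"
  shows "J T s powr p \<le> F T s"
proof -
  obtain M where M: "AE y in lborel. \<bar>u s y\<bar> \<le> M" using u_bdd[OF assms(1)] assms by auto
  show ?thesis unfolding J_def F_def g_def[abs_def]
    using assms p by (intro S_jensen[OF _ _ u_meas u_nonneg M]) auto
qed

text \<open>Since J' = F \<ge> J^p, the function J^(1 - p) + (p - 1) s is nonincreasing. Comparing
  its values at \<open>t\<close> and \<open>\<tau>\<close> and discarding the nonnegative power at
  \<open>\<tau>\<close> gives the bound.\<close>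

lemma J_blowup_bound:
  assumes pos: "0 < S T u0 0" and t: "0 < t" "t < \<tau>" "\<tau> < T"
  shows "(p - 1) * (\<tau> - t) \<le> J T t powr (1 - p)"
proof -
  \<comment> \<open>The right end lies strictly between \<open>\<tau>\<close> and \<open>T\<close>:
    \<open>F T\<close> is continuous up to it, and every time in \<open>{t..\<tau>}\<close> is
    interior.\<close>
  have Fc: "continuous_on {0..(\<tau> + T) / 2} (F T)"
    using t by (intro continuous_on_subset[OF F_continuous[of T]]) auto
  have Jpos: "0 < J T s" if "0 < s" "s < T" for s
  proof -
    have "0 \<le> integral {0..s} (F T)" using that 
      by (intro Henstock_Kurzweil_Integration.integral_nonneg integrable_continuous_real
          continuous_on_subset[OF F_continuous[of T]] F_nonneg) auto
    thus ?thesis using J_eq[OF that] pos by simp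
  qed
  define H where "H s = (S T u0 0 + integral {0..s} (F T)) powr (1 - p) + (p - 1) * s" for s
  have "H \<tau> \<le> H t"
  proof (rule DERIV_nonpos_imp_nonincreasing[of t \<tau> H])
    fix s assume s: "t \<le> s" "s \<le> \<tau>"
    have J: "S T u0 0 + integral {0..s} (F T) = J T s" using J_eq[of s T] s t by simp
    have Js: "0 < J T s" using Jpos s t by simp
    have "((\<lambda>s. integral {0..s} (F T)) has_real_derivative F T s) (at s within {0..(\<tau> + T) / 2})"
      using s t by (intro integral_has_real_derivative Fc) auto
    hence d: "((\<lambda>s. integral {0..s} (F T)) has_real_derivative F T s) (at s)"
      using s t by (subst (asm) at_within_interior) auto
    have "(H has_real_derivative ((1 - p) * J T s powr (1 - p - 1) * F T s + (p - 1))) (at s)"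
      unfolding H_def using Js J by (auto intro!: derivative_eq_intros d)
    moreover have "(1 - p) * J T s powr (1 - p - 1) * F T s + (p - 1) \<le> 0"
    proof -
      have "1 = J T s powr (- p) * J T s powr p" using Js by (simp add: powr_minus)
      also have "\<dots> \<le> J T s powr (- p) * F T s" using F_ge_J_powr[of s T] s t by (intro mult_left_mono) auto
      finally have "(p - 1) * 1 \<le> (p - 1) * (J T s powr (- p) * F T s)" using p by (intro mult_left_mono) auto
      thus ?thesis by (simp add: algebra_simps)
    qed
    ultimately show "\<exists>y. DERIV H s :> y \<and> y \<le> 0" by blast
  qed (use t in simp)
  moreover have "0 \<le> (S T u0 0 + integral {0..\<tau>} (F T)) powr (1 - p)" by simp
  moreover have Jt: "J T t = S T u0 0 + integral {0..t} (F T)" using J_eq[of t T] t by simp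
  moreover have "(p - 1) * (\<tau> - t) = (p - 1) * \<tau> - (p - 1) * t" by (rule right_diff_distrib)
  ultimately show ?thesis unfolding H_def Jt by linarith
qed

text \<open>The ball of radius A/2 carries positive mass of \<open>u0\<close>. For
  \<open>t \<ge> 1\<close>, a point \<open>x\<close> as in the second bound and any \<open>y\<close>
  in that ball are at distance at most \<open>A * t powr (1 / (2 * \<sigma>))\<close>, so the kernel
  bound applies to \<open>x - y\<close>. It is repeated in the statement so that both bounds share
  the same \<open>A\<close>. The constant delivered as \<open>m\<close> is \<open>c\<close> times
  the mass.\<close>

lemma S_u0_lower:
  "\<exists>A>0. \<exists>c>0. \<exists>m>0. (\<forall>t\<ge>1. \<forall>x::'a. norm x \<le> A * t powr (1 / (2 * \<sigma>)) \<longrightarrow>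
        c * t powr (- (DIM('a) / (2 * \<sigma>))) \<le> ker t t x)
     \<and> (\<forall>t\<ge>1. \<forall>x. norm x \<le> A / 2 * t powr (1 / (2 * \<sigma>)) \<longrightarrow>
        m * t powr (- (DIM('a) / (2 * \<sigma>))) \<le> S t u0 x)"
proof -
  obtain A c where A: "A > 0" and c: "c > 0"
    and low: "\<And>t x. 1 \<le> t \<Longrightarrow> norm (x::'a) \<le> A * t powr (1 / (2 * \<sigma>)) \<Longrightarrow>
        c * t powr (- (DIM('a) / (2 * \<sigma>))) \<le> ker t t x"
    using ker_lower_bound[where 'a='a] by blast
  define B where "B = cball (0::'a) (A / 2)"
  define m where "m = (\<integral>y. indicator B y * u0 y \<partial>lborel)"
  have [measurable]: "u0 \<in> borel_measurable borel" "B \<in> sets borel"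
    using u0 by (auto simp: B_def integrable_iff_bounded)
  have Bi: "integrable lborel (\<lambda>y. indicator B y * u0 y)"
    by (rule integrable_mult_bounded[OF u0, where B=1]) (auto simp: indicator_def)
  have m: "0 < m"
  proof -
    have "m \<noteq> 0"
    proof
      assume "m = 0"
      hence "AE y in lborel. indicator B y * u0 y = 0"
        unfolding m_def using u0_pos by (subst (asm) integral_nonneg_eq_0_iff_AE[OF Bi]) (auto simp: less_imp_le)
      hence "AE y in lborel. y \<notin> B"
        by eventually_elim (use u0_pos in \<open>auto simp: indicator_def split: if_splits\<close>, metis less_irrefl)
      hence "emeasure lborel B = 0" by (subst (asm) AE_iff_measurable[of B]) auto
      moreover have "emeasure lborel (ball (0::'a) (A / 2)) \<le> emeasure lborel B"
        unfolding B_def by (intro emeasure_mono) auto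
      ultimately show False using A unit_ball_vol_pos[of "DIM('a)"] by (simp add: emeasure_ball)
    qed
    moreover have "0 \<le> m" unfolding m_def using u0_pos
      by (intro Bochner_Integration.integral_nonneg) (auto simp: less_imp_le)
    ultimately show ?thesis by simp
  qed
  have "c * m * t powr (- (DIM('a) / (2 * \<sigma>))) \<le> S t u0 x"
    if t: "1 \<le> t" and x: "norm x \<le> A / 2 * t powr (1 / (2 * \<sigma>))" for t x
  proof -
    have t1: "1 \<le> t powr (1 / (2 * \<sigma>))" using t sigma_pos by (intro ge_one_powr_ge_zero) auto
    have "c * m * t powr (- (DIM('a) / (2 * \<sigma>))) = (\<integral>y. c * t powr (- (DIM('a) / (2 * \<sigma>))) * (indicator B y * u0 y) \<partial>lborel)"
      by (simp add: m_def)
    also have "\<dots> \<le> S t u0 x"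
      unfolding S_def
    proof (rule integral_mono)
      show "integrable lborel (\<lambda>y. ker t t (x - y) * u0 y)" using t by (intro integrable_ker_mult_integrable u0) auto
      fix y
      show "c * t powr (- (DIM('a) / (2 * \<sigma>))) * (indicator B y * u0 y) \<le> ker t t (x - y) * u0 y"
      proof (cases "y \<in> B")
        case True
        have "norm (x - y) \<le> norm x + norm y" by (rule norm_triangle_ineq4)
        also have "\<dots> \<le> A / 2 * t powr (1 / (2 * \<sigma>)) + A / 2 * t powr (1 / (2 * \<sigma>))"
        proof -
          have "norm y \<le> A / 2" using True by (simp add: B_def)
          moreover have "A / 2 * 1 \<le> A / 2 * t powr (1 / (2 * \<sigma>))" using t1 A by (intro mult_left_mono) auto
          ultimately show ?thesis using x by linarith
        qed
        also have "\<dots> = A * t powr (1 / (2 * \<sigma>))" by simp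
        finally show ?thesis using True low[OF t, of "x - y"] u0_pos[of y] by (simp add: mult_right_mono)
      next
        case False
        thus ?thesis using u0_pos[of y] ker_nonneg[of t t "x - y"] t by simp
      qed
    qed (use Bi in simp)
    finally show ?thesis .
  qed
  thus ?thesis using A c m low by (intro exI[of _ A] conjI exI[of _ c] exI[of _ "c * m"]) auto
qed

text \<open>For \<open>1 \<le> s \<le> t\<close> integrate over the ball of radius
  \<open>A / 2 * s powr (1 / (2 * \<sigma>))\<close>. There the kernel at time
  \<open>2 * t - s\<close> is at least \<open>c * (2 * t) powr (- q)\<close>, the source is at least
  \<open>(m * s powr (- q)) powr p\<close>, and the volume is of order \<open>s powr q\<close>. The
  powers of \<open>s\<close> combine to \<open>- q * (p - 1)\<close>, which is at least -1.\<close>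

lemma F_lower:
  assumes pF: "p \<le> 1 + 2 * \<sigma> / DIM('a)"
  shows "\<exists>C>0. \<forall>t\<ge>1. 0 < S t u0 0 \<and> (\<forall>s. 1 \<le> s \<and> s \<le> t \<longrightarrow> C * t powr (- (DIM('a) / (2 * \<sigma>))) / s \<le> F (2 * t) s)"
proof -
  define q where "q = DIM('a) / (2 * \<sigma>)"
  have q: "q > 0" using sigma_pos by (simp add: q_def)
  have pq: "q * (p - 1) \<le> 1" using pF sigma_pos by (simp add: q_def field_simps)
  obtain A c m where A: "A > 0" and c: "c > 0" and m: "m > 0"
    and low: "\<And>t x. 1 \<le> t \<Longrightarrow> norm (x::'a) \<le> A * t powr (1 / (2 * \<sigma>)) \<Longrightarrow> c * t powr (- q) \<le> ker t t x"
    and low0: "\<And>t x. 1 \<le> t \<Longrightarrow> norm x \<le> A / 2 * t powr (1 / (2 * \<sigma>)) \<Longrightarrow> m * t powr (- q) \<le> S t u0 x"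
    using S_u0_lower unfolding q_def by blast
  define V where "V = unit_ball_vol (DIM('a)) * (A / 2) ^ DIM('a)"
  have V: "V > 0" using A by (simp add: V_def)
  define C where "C = c * 2 powr (- q) * m powr p * V"
  have C: "C > 0" using c m V by (simp add: C_def)
  have "C * t powr (- q) / s \<le> F (2 * t) s" if s: "1 \<le> s" "s \<le> t" for s t
  proof -
    define R where "R = A / 2 * s powr (1 / (2 * \<sigma>))"
    have R: "R > 0" using A s by (simp add: R_def)
    define a where "a = c * (2 * t) powr (- q)"
    define b where "b = (m * s powr (- q)) powr p"
    have a: "a > 0" using c s by (simp add: a_def)
    have vol: "measure lborel (cball (0::'a) R) = V * s powr q"
    proof -
      have "measure lborel (cball (0::'a) R) = unit_ball_vol (DIM('a)) * R ^ DIM('a)"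
        using R by (simp add: content_cball)
      also have "R ^ DIM('a) = (A / 2) ^ DIM('a) * s powr q"
        unfolding R_def power_mult_distrib using s by (simp add: powr_realpow[symmetric] powr_powr q_def)
      finally show ?thesis by (simp add: V_def)
    qed
    have "C * t powr (- q) / s \<le> C * t powr (- q) * s powr (- (q * (p - 1)))"
    proof -
      have "1 / s = s powr (- 1)" using s by (simp add: powr_minus divide_inverse)
      also have "\<dots> \<le> s powr (- (q * (p - 1)))" using s pq by (intro powr_mono) auto
      finally have "C * t powr (- q) * (1 / s) \<le> C * t powr (- q) * s powr (- (q * (p - 1)))"
        using C by (intro mult_left_mono) auto
      thus ?thesis by simp
    qed
    also have "\<dots> = a * b * (V * s powr q)"
    proof -
      have "(2 * t) powr (- q) = 2 powr (- q) * t powr (- q)" using s by (simp add: powr_mult)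
      moreover have "(m * s powr (- q)) powr p = m powr p * s powr (- (q * p))" using m s by (simp add: powr_mult powr_powr)
      moreover have "s powr (- (q * (p - 1))) = s powr (- (q * p)) * s powr q"
        using s by (simp add: powr_add[symmetric] algebra_simps)
      ultimately show ?thesis by (simp add: C_def a_def b_def)
    qed
    also have "\<dots> = (\<integral>y. a * b * indicator (cball (0::'a) R) y \<partial>lborel)"
      by (simp add: vol emeasure_lborel_cball_finite)
    also have "\<dots> \<le> F (2 * t) s"
      unfolding F_def S_def
    proof (rule integral_mono_AE)
      obtain M where M: "AE y in lborel. \<bar>g s y\<bar> \<le> M" using g_bdd[of s] s
        by (meson order_refl order_trans zero_le_one)
      show "integrable lborel (\<lambda>y. ker (2 * t - s) (2 * t - s) (0 - y) * g s y)"
        using s g_meas by (intro integrable_ker_mult_bounded[OF _ _ M]) auto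
      show "integrable lborel (\<lambda>y::'a. a * b * indicator (cball 0 R) y)"
        using emeasure_lborel_cball_finite[of "0::'a" R] by simp
      have "0 < s" using s by simp
      show "AE y in lborel. a * b * indicator (cball 0 R) y \<le> ker (2 * t - s) (2 * t - s) (0 - y) * g s y"
        using u_ge[OF \<open>0 < s\<close>]
      proof eventually_elim
        case (elim y)
        show ?case
        proof (cases "y \<in> cball 0 R")
          case True
          have "a \<le> c * (2 * t - s) powr (- q)"
            unfolding a_def using c s q by (intro mult_left_mono powr_mono2') auto
          also have "\<dots> \<le> ker (2 * t - s) (2 * t - s) (0 - y)"
          proof (rule low)
            have "norm (0 - y) \<le> A / 2 * s powr (1 / (2 * \<sigma>))" using True by (simp add: R_def)
            also have "\<dots> \<le> A * (2 * t - s) powr (1 / (2 * \<sigma>))"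
              using A s sigma_pos by (intro mult_mono powr_mono2) auto
            finally show "norm (0 - y) \<le> A * (2 * t - s) powr (1 / (2 * \<sigma>))" .
          qed (use s in simp)
          finally have 1: "a \<le> ker (2 * t - s) (2 * t - s) (0 - y)" .
          have "m * s powr (- q) \<le> u s y"
            using low0[of s y] s True elim by (simp add: R_def)
          hence "b \<le> g s y" unfolding b_def g_def using m p by (intro powr_mono2) auto
          with 1 a have "a * b \<le> ker (2 * t - s) (2 * t - s) (0 - y) * g s y"
            by (intro mult_mono) (auto simp: b_def)
          thus ?thesis using True by simp
        next
          case False
          thus ?thesis using ker_nonneg[of "2 * t - s" "2 * t - s" "0 - y"] s g_nonneg[of s y] by simp
        qed
      qed
    qed
    finally show ?thesis .
  qed
  moreover have "0 < S t u0 0" if "t \<ge> 1" for t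
  proof -
    have "0 < m * t powr (- q)" using m that by simp
    also have "\<dots> \<le> S t u0 0" using that A by (intro low0) auto
    finally show ?thesis .
  qed
  ultimately show ?thesis using C unfolding q_def by blast
qed

theorem supercritical: "1 + 2 * \<sigma> / DIM('a) < p"
proof (rule ccontr)
  assume "\<not> 1 + 2 * \<sigma> / DIM('a) < p"
  hence pF: "p \<le> 1 + 2 * \<sigma> / DIM('a)" by simp
  define q where "q = DIM('a) / (2 * \<sigma>)"
  have pq: "q * (p - 1) \<le> 1" using pF sigma_pos by (simp add: q_def field_simps)
  obtain C where C: "C > 0" and pos: "\<And>t. t \<ge> 1 \<Longrightarrow> 0 < S t u0 0"
    and low: "\<And>t s. 1 \<le> s \<Longrightarrow> s \<le> t \<Longrightarrow> C * t powr (- q) / s \<le> F (2 * t) s"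
    using F_lower[OF pF] unfolding q_def by (metis order_trans)
  \<comment> \<open>\<open>X\<close> stands for \<open>ln t\<close>, chosen so that \<open>(C X)\<close> to the power \<open>1 - p\<close> is half of \<open>(p - 1) / 2\<close>.\<close>
  define X where "X = ((p - 1) / 4) powr (1 / (1 - p)) / C"
  have X: "X > 0" using C p by (simp add: X_def)
  define t where "t = exp X"
  have t: "t > 1" "ln t = X" using X by (auto simp: t_def)
  have Jlow: "C * t powr (- q) * X \<le> J (2 * t) t"
  proof -
    have c1: "continuous_on {1..t} (F (2 * t))" "continuous_on {0..t} (F (2 * t))"
      using t by (auto intro: continuous_on_subset[OF F_continuous[of "2 * t"]])
    have hi: "((\<lambda>s. C * t powr (- q) * (1 / s)) has_integral (C * t powr (- q) * (ln t - ln 1))) {1..t}"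
      using t by (intro has_integral_mult_right fundamental_theorem_of_calculus)
        (auto simp: has_real_derivative_iff_has_vector_derivative[symmetric] intro!: derivative_eq_intros)
    have "C * t powr (- q) * X = integral {1..t} (\<lambda>s. C * t powr (- q) * (1 / s))"
      using integral_unique[OF hi] t by simp
    also have "\<dots> \<le> integral {1..t} (F (2 * t))"
      using low by (intro integral_le[OF has_integral_integrable[OF hi] integrable_continuous_real[OF c1(1)]]) simp
    also have "\<dots> \<le> integral {0..t} (F (2 * t))"
      using t c1 by (intro integral_subset_le integrable_continuous_real ballI F_nonneg) auto
    also have "\<dots> \<le> J (2 * t) t" using J_eq[of t "2 * t"] pos[of "2 * t"] t by simp
    finally show ?thesis .
  qed
  \<comment> \<open>\<open>\<tau>\<close> is taken as 3t/2, midway between \<open>t\<close> and the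
    horizon \<open>2 * t\<close>. The lower bound of order t/2 then meets an upper bound of order
    t/4 with the same factor.\<close>
  have "(p - 1) * (3 / 2 * t - t) \<le> J (2 * t) t powr (1 - p)"
    using pos[of "2 * t"] t by (intro J_blowup_bound) auto
  also have "\<dots> \<le> (C * t powr (- q) * X) powr (1 - p)"
    using Jlow p C X t by (intro powr_mono2') auto
  also have "\<dots> = (C * X) powr (1 - p) * t powr (q * (p - 1))"
    using C X t by (simp add: powr_mult powr_powr algebra_simps)
  also have "(C * X) powr (1 - p) = (p - 1) / 4"
    using C p by (simp add: X_def powr_powr)
  also have "(p - 1) / 4 * t powr (q * (p - 1)) \<le> (p - 1) / 4 * t powr 1"
    using p t pq by (intro mult_left_mono powr_mono) auto
  finally have "(p - 1) * t * (1 / 2) \<le> (p - 1) * t * (1 / 4)" using t by (simp add: algebra_simps)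
  moreover have "(p - 1) * t > 0" using p t by simp
  ultimately show False by linarith
qed

end

section \<open>From global mild solutions to the locale \<open>global_mild\<close>\<close>

lemma mild_solution_infinity_iff:
  "mild_solution \<sigma> p u0 \<infinity> u \<longleftrightarrow>
     (\<forall>t\<ge>0. u t \<in> Linf \<and> (AE x in lborel. 0 \<le> u t x)) \<and>
     (\<forall>t\<ge>0. ((\<lambda>s. Linf_norm (\<lambda>x. u s x - u t x)) \<longlongrightarrow> 0) (at t within {0..})) \<and>
     (\<forall>t\<ge>0. AE x in lborel. u t x = mixed_semigroup \<sigma> t u0 x
            + (LINT s:{0..t}|lborel. mixed_semigroup \<sigma> (t - s) (\<lambda>y. u s y powr p) x))"
proof -
  have "{t. 0 \<le> t \<and> ereal t < \<infinity>} = {0..}" by auto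
  thus ?thesis unfolding mild_solution_def by (simp add: Let_def Ball_def)
qed

lemma mild_solution_continuousD:
  fixes u :: "real \<Rightarrow> 'a::euclidean_space \<Rightarrow> real"
  assumes "mild_solution \<sigma> p u0 \<infinity> u" and s: "0 \<le> s" and e: "0 < e"
  shows "\<exists>d>0. \<forall>s'\<ge>0. \<bar>s' - s\<bar> < d \<longrightarrow> (AE y in lborel. \<bar>u s' y - u s y\<bar> \<le> e)"
proof -
  have "((\<lambda>s'. Linf_norm (\<lambda>x. u s' x - u s x)) \<longlongrightarrow> 0) (at s within {0..})"
    using assms by (simp add: mild_solution_infinity_iff)
  hence "eventually (\<lambda>s'. Linf_norm (\<lambda>x. u s' x - u s x) < ereal e) (at s within {0..})"
    by (rule order_tendstoD) (use e in simp)
  then obtain d where d: "d > 0" "\<And>s'. s' \<ge> 0 \<Longrightarrow> s' \<noteq> s \<Longrightarrow> \<bar>s' - s\<bar> < d \<Longrightarrow> Linf_norm (\<lambda>x. u s' x - u s x) < ereal e"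
    unfolding eventually_at dist_real_def by auto
  have "AE y in lborel. \<bar>u s' y - u s y\<bar> \<le> e" if "s' \<ge> 0" "\<bar>s' - s\<bar> < d" for s'
  proof (cases "s' = s")
    case False
    show ?thesis by (rule AE_le_of_Linf_norm_le) (use d(2)[OF that(1) False that(2)] in simp)
  qed (use e in simp)
  with d(1) show ?thesis by blast
qed

text \<open>Continuity bounds \<open>u\<close> near each time, and \<open>Bolzano\<close>, the
  bisection form of compactness, joins the local bounds.\<close>

lemma mild_solution_locally_bounded:
  fixes u :: "real \<Rightarrow> 'a::euclidean_space \<Rightarrow> real"
  assumes u: "mild_solution \<sigma> p u0 \<infinity> u" and T: "0 \<le> T"
  shows "\<exists>M\<ge>0. \<forall>s. 0 \<le> s \<and> s \<le> T \<longrightarrow> (AE y in lborel. \<bar>u s y\<bar> \<le> M)"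
proof -
  \<comment> \<open>The condition \<open>s \<ge> 0\<close> is built in because small intervals
    around a time near 0 may reach negative times.\<close>
  define P where "P a b \<longleftrightarrow> (\<exists>M\<ge>0. \<forall>s\<ge>0. a \<le> s \<and> s \<le> b \<longrightarrow> (AE y in lborel. \<bar>u s y\<bar> \<le> M))" for a b
  have "P 0 T"
  proof (rule Bolzano[OF T])
    fix a b c :: real assume "P a b" "P b c"
    then obtain M N where M: "M \<ge> 0" "\<And>s. s \<ge> 0 \<Longrightarrow> a \<le> s \<Longrightarrow> s \<le> b \<Longrightarrow> AE y in lborel. \<bar>u s y\<bar> \<le> M"
      and N: "N \<ge> 0" "\<And>s. s \<ge> 0 \<Longrightarrow> b \<le> s \<Longrightarrow> s \<le> c \<Longrightarrow> AE y in lborel. \<bar>u s y\<bar> \<le> N"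
      unfolding P_def by auto
    have "AE y in lborel. \<bar>u s y\<bar> \<le> max M N" if "s \<ge> 0" "a \<le> s" "s \<le> c" for s
    proof (cases "s \<le> b")
      case True
      show ?thesis using M(2)[OF that(1,2) True] by eventually_elim simp
    next
      case False
      show ?thesis using N(2)[OF that(1) _ that(3)] False by (auto elim!: eventually_mono)
    qed
    thus "P a c" unfolding P_def using M(1) by (intro exI[of _ "max M N"]) auto
  next
    fix x :: real assume x: "0 \<le> x" "x \<le> T"
    have "u x \<in> Linf" using u x by (simp add: mild_solution_infinity_iff)
    then obtain M where M: "M \<ge> 0" "AE y in lborel. \<bar>u x y\<bar> \<le> M" using Linf_AE_bound by blast
    obtain d where d: "d > 0" "\<And>s. s \<ge> 0 \<Longrightarrow> \<bar>s - x\<bar> < d \<Longrightarrow> AE y in lborel. \<bar>u s y - u x y\<bar> \<le> 1"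
      using mild_solution_continuousD[OF u x(1), of 1] by auto
    have "P a b" if "a \<le> x" "x \<le> b" "b - a < d" for a b
    proof -
      have "AE y in lborel. \<bar>u s y\<bar> \<le> M + 1" if s: "s \<ge> 0" "a \<le> s" "s \<le> b" for s
      proof -
        have "\<bar>s - x\<bar> < d" using s \<open>a \<le> x\<close> \<open>x \<le> b\<close> \<open>b - a < d\<close> by linarith
        from d(2)[OF s(1) this] M(2) show ?thesis by eventually_elim linarith
      qed
      thus ?thesis unfolding P_def using M(1) by (intro exI[of _ "M + 1"]) auto
    qed
    with d(1) show "\<exists>d>0. \<forall>a b. a \<le> x \<and> x \<le> b \<and> b - a < d \<longrightarrow> P a b" by blast
  qed
  thus ?thesis unfolding P_def by auto
qed

lemma global_mild_of_mild_solution: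
  fixes u :: "real \<Rightarrow> 'a::euclidean_space \<Rightarrow> real"
  assumes "0 < \<sigma>" "\<sigma> < 1" "1 < p" "integrable lborel u0" "\<And>x. 0 < u0 x" "mild_solution \<sigma> p u0 \<infinity> u"
  shows "global_mild \<sigma> p u0 u"
proof
  fix s e :: real assume "0 \<le> s" "0 < e"
  with assms show "\<exists>d>0. \<forall>s'\<ge>0. \<bar>s' - s\<bar> < d \<longrightarrow> (AE y in lborel. \<bar>u s' y - u s y\<bar> \<le> e)"
    by (intro mild_solution_continuousD)
next
  fix T :: real assume "0 \<le> T"
  with assms show "\<exists>M\<ge>0. \<forall>s. 0 \<le> s \<and> s \<le> T \<longrightarrow> (AE y in lborel. \<bar>u s y\<bar> \<le> M)"
    by (intro mild_solution_locally_bounded)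
qed (use assms in \<open>auto simp: mild_solution_infinity_iff Linf_measurable\<close>)

section \<open>Existence\<close>

lemma integrable_indicator_subset_Icc:
  fixes A :: "real set"
  assumes "A \<in> sets borel" "A \<subseteq> {a..b}"
  shows "integrable lborel (indicator A :: real \<Rightarrow> real)"
proof (rule integrable_real_indicator)
  have "emeasure lborel A \<le> emeasure lborel {a..b}" using assms by (intro emeasure_mono) auto
  also have "\<dots> < \<infinity>" by (simp add: emeasure_lborel_Icc_eq)
  finally show "emeasure lborel A < \<infinity>" .
qed (use assms in simp)

text \<open>\<open>small\<close> is what makes the Duhamel term of any
  \<open>w \<le> 2 * \<epsilon> * V\<close> at most \<open>\<epsilon> * V\<close>, see
  \<open>Q_bounds\<close>. It can be met because the left side is of order \<epsilon>^p with
  \<open>p > 1\<close>.\<close>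

locale small_gaussian = mixed_diffusion +
  fixes p \<epsilon> :: real and u0 :: "'a::euclidean_space \<Rightarrow> real"
  assumes p: "1 < p" and eps: "0 < \<epsilon>" and u0_eq: "u0 = (\<lambda>x. \<epsilon> * ker 1 0 x)"
    and decay_integrable: "integrable lborel (\<lambda>s. indicator {0..} s * ker (1 + s) s (0::'a) powr (p - 1))"
    and small: "(2 * \<epsilon>) powr p * (\<integral>s. indicator {0..} s * ker (1 + s) s (0::'a) powr (p - 1) \<partial>lborel) \<le> \<epsilon>"
begin

text \<open>\<open>\<epsilon> V t\<close> is the free evolution of \<open>u\<^sub>0\<close>: \<open>ker 1 0\<close> is a Gaussian, whose Fourier transform is \<open>exp (- |\<xi>|\<^sup>2)\<close>.\<close>

definition V :: "real \<Rightarrow> 'a \<Rightarrow> real" where "V t x = ker (1 + t) t x"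

definition M :: real where "M = (2 * \<epsilon> * V 0 0) powr p"

definition Q :: "(real \<Rightarrow> 'a \<Rightarrow> real) \<Rightarrow> real \<Rightarrow> 'a \<Rightarrow> real" where
  "Q w t x = (\<integral>r. indicator {0..<t} r * S (t - r) (\<lambda>y. w r y powr p) x \<partial>lborel)"

text \<open>The order interval between 0 and the supersolution. Joint measurability is part of it so
  that one more Duhamel integral can be taken at each iteration.\<close>

definition adm :: "(real \<Rightarrow> 'a \<Rightarrow> real) \<Rightarrow> bool" where
  "adm w \<longleftrightarrow> (\<lambda>(s, y). w s y) \<in> borel_measurable (borel \<Otimes>\<^sub>M borel) \<and> 
     (\<forall>s\<ge>0. \<forall>y. 0 \<le> w s y \<and> w s y \<le> 2 * \<epsilon> * V s y)"

section \<open>Admissible functions and the Duhamel operator\<close>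

lemma V_nonneg: "0 \<le> t \<Longrightarrow> 0 \<le> V t x"
  unfolding V_def by (rule ker_nonneg) auto

lemma V_le: "0 \<le> t \<Longrightarrow> V t x \<le> V t 0"
  unfolding V_def by (rule ker_le_ker_0) auto

lemma V_le_V00: "0 \<le> t \<Longrightarrow> V t x \<le> V 0 0"
  using V_le[of t x] ker_0_antimono[of 1 0 "1 + t" t, where 'a='a] by (simp add: V_def)

lemma V_meas [measurable]: "V t \<in> borel_measurable borel"
  unfolding V_def by measurable

lemma S_V: "0 < r \<Longrightarrow> 0 \<le> s \<Longrightarrow> S r (V s) x = V (r + s) x"
  unfolding S_def V_def using ker_convolution[of r r "1 + s" s x] by (simp add: add.left_commute)

lemma M_nonneg: "0 \<le> M"
  by (simp add: M_def)

lemma adm_meas: "adm w \<Longrightarrow> w s \<in> borel_measurable borel"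
  unfolding adm_def using measurable_Pair2[of "\<lambda>(s, y). w s y" borel borel borel s] by simp

lemma adm_nonneg: "adm w \<Longrightarrow> 0 \<le> s \<Longrightarrow> 0 \<le> w s y"
  by (simp add: adm_def)

lemma adm_powr_le_M:
  assumes "adm w" "0 \<le> s"
  shows "w s y powr p \<le> M"
proof -
  have "w s y \<le> 2 * \<epsilon> * V s y" using assms by (simp add: adm_def)
  also have "\<dots> \<le> 2 * \<epsilon> * V 0 0" using eps assms(2) by (intro mult_left_mono V_le_V00) auto
  finally show ?thesis unfolding M_def using adm_nonneg[OF assms] p by (intro powr_mono2) auto
qed

text \<open>Of the p factors, p - 1 are replaced by the supremum of \<open>V s\<close>, while one is
  kept as a function: the semigroup carries \<open>V s\<close> to \<open>V t\<close>, so the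
  supersolution reproduces itself.\<close>

lemma adm_powr_le_V:
  assumes "adm w" "0 \<le> s"
  shows "w s y powr p \<le> (2 * \<epsilon>) powr p * V s 0 powr (p - 1) * V s y"
proof -
  have "w s y powr p \<le> (2 * \<epsilon> * V s y) powr p"
    using assms p by (intro powr_mono2) (auto simp: adm_def)
  also have "\<dots> = (2 * \<epsilon>) powr p * (V s y powr (p - 1) * V s y)"
    using V_nonneg[OF assms(2), of y] eps p
    by (cases "V s y = 0") (auto simp: powr_mult powr_diff)
  also have "\<dots> \<le> (2 * \<epsilon>) powr p * (V s 0 powr (p - 1) * V s y)"
    using V_nonneg[OF assms(2)] V_le[OF assms(2)] p
    by (intro mult_left_mono mult_right_mono powr_mono2) auto
  finally show ?thesis by (simp add: mult.assoc)
qed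

lemma adm_S_meas:
  assumes "adm w"
  shows "(\<lambda>(t, x, r). S (t - r) (\<lambda>y. w r y powr p) x) \<in> borel_measurable (borel \<Otimes>\<^sub>M borel \<Otimes>\<^sub>M borel)"
proof -
  have [measurable]: "case_prod w \<in> borel_measurable (borel \<Otimes>\<^sub>M borel)" using assms by (simp add: adm_def)
  show ?thesis unfolding S_def by measurable
qed

text \<open>The bound by \<open>M\<close> gives integrability over bounded times; the last bound
  carries the decay in \<open>r\<close> that \<open>small\<close> measures.\<close>

lemma adm_S_bounds:
  assumes w: "adm w" and r: "0 \<le> r" "r < t"
  shows "0 \<le> S (t - r) (\<lambda>y. w r y powr p) x"
    and "S (t - r) (\<lambda>y. w r y powr p) x \<le> M"
    and "S (t - r) (\<lambda>y. w r y powr p) x \<le> (2 * \<epsilon>) powr p * V r 0 powr (p - 1) * V t x"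
proof -
  have [measurable]: "w r \<in> borel_measurable borel" by (rule adm_meas[OF w])
  have b: "AE y in lborel. \<bar>w r y powr p\<bar> \<le> M" using adm_powr_le_M[OF w r(1)] by simp
  show "0 \<le> S (t - r) (\<lambda>y. w r y powr p) x" using r by (intro S_nonneg) auto
  show "S (t - r) (\<lambda>y. w r y powr p) x \<le> M"
    using S_abs_le[OF _ _ b, of "t - r" x] r by simp
  have Vb: "AE y in lborel. \<bar>V r y\<bar> \<le> V r 0" using V_nonneg[OF r(1)] V_le[OF r(1)] by simp
  have "S (t - r) (\<lambda>y. w r y powr p) x \<le> S (t - r) (\<lambda>y. ((2 * \<epsilon>) powr p * V r 0 powr (p - 1)) * V r y) x"
  proof (rule S_mono)
    show "integrable lborel (\<lambda>y. ker (t - r) (t - r) (x - y) * w r y powr p)"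
      using r by (intro integrable_ker_mult_bounded[OF _ _ b]) auto
    show "integrable lborel (\<lambda>y. ker (t - r) (t - r) (x - y) * (((2 * \<epsilon>) powr p * V r 0 powr (p - 1)) * V r y))"
      using integrable_mult_right[OF integrable_ker_mult_bounded[OF _ _ Vb, of "t - r" x], of "(2 * \<epsilon>) powr p * V r 0 powr (p - 1)"] r
      by (simp add: mult_ac)
  qed (use r adm_powr_le_V[OF w r(1)] in \<open>auto simp: mult.assoc\<close>)
  also have "\<dots> = ((2 * \<epsilon>) powr p * V r 0 powr (p - 1)) * S (t - r) (V r) x"
    unfolding S_def by (simp only: mult.left_commute[of _ "(2 * \<epsilon>) powr p * V r 0 powr (p - 1)"] integral_mult_right_zero)
  also have "S (t - r) (V r) x = V t x" using S_V[of "t - r" r x] r by simp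
  finally show "S (t - r) (\<lambda>y. w r y powr p) x \<le> (2 * \<epsilon>) powr p * V r 0 powr (p - 1) * V t x" .
qed

lemma adm_Q_integrable:
  assumes w: "adm w"
  shows "integrable lborel (\<lambda>r. indicator {0..<t} r * S (t - r) (\<lambda>y. w r y powr p) x)"
proof (rule Bochner_Integration.integrable_bound)
  show "integrable lborel (\<lambda>r. M * indicator {0..<t} r)"
    by (intro integrable_mult_right integrable_indicator_subset_Icc[where a=0 and b=t]) auto
  have "(\<lambda>r. case (t, x, r) of (t, x, r) \<Rightarrow> S (t - r) (\<lambda>y. w r y powr p) x) \<in> borel_measurable borel"
    by (rule measurable_compose[OF _ adm_S_meas[OF w]]) measurable
  thus "(\<lambda>r. indicator {0..<t} r * S (t - r) (\<lambda>y. w r y powr p) x) \<in> borel_measurable lborel"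
    by simp
  show "AE r in lborel. norm (indicator {0..<t} r * S (t - r) (\<lambda>y. w r y powr p) x) \<le> norm (M * indicator {0..<t} r)"
    using adm_S_bounds[OF w] M_nonneg by (auto simp: indicator_def)
qed

lemma Q_bounds:
  assumes w: "adm w" and t: "0 \<le> t"
  shows "0 \<le> Q w t x" "Q w t x \<le> \<epsilon> * V t x"
proof -
  show "0 \<le> Q w t x" unfolding Q_def
    by (intro Bochner_Integration.integral_nonneg) (auto simp: indicator_def adm_S_bounds[OF w])
  define c where "c = (2 * \<epsilon>) powr p * V t x"
  have c: "0 \<le> c" using V_nonneg[OF t] by (simp add: c_def)
  have "Q w t x \<le> (\<integral>r. c * (indicator {0..} r * ker (1 + r) r (0::'a) powr (p - 1)) \<partial>lborel)"
    unfolding Q_def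
  proof (rule integral_mono[OF adm_Q_integrable[OF w] integrable_mult_right[OF decay_integrable]])
    fix r :: real
    show "indicator {0..<t} r * S (t - r) (\<lambda>y. w r y powr p) x \<le> c * (indicator {0..} r * ker (1 + r) r (0::'a) powr (p - 1))"
    proof (cases "0 \<le> r \<and> r < t")
      case True
      thus ?thesis using adm_S_bounds(3)[OF w, of r t x] by (simp add: c_def V_def[of r] mult_ac)
    next
      case False
      hence "indicator {0..<t} r = (0::real)" by (auto simp: indicator_def)
      thus ?thesis using c by simp
    qed
  qed
  also have "\<dots> = ((2 * \<epsilon>) powr p * (\<integral>s. indicator {0..} s * ker (1 + s) s (0::'a) powr (p - 1) \<partial>lborel)) * V t x"
    by (simp only: integral_mult_right_zero c_def) (simp add: mult_ac)
  also have "\<dots> \<le> \<epsilon> * V t x" using small V_nonneg[OF t] by (intro mult_right_mono)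
  finally show "Q w t x \<le> \<epsilon> * V t x" .
qed

lemma Q_mono:
  assumes w: "adm w" and w': "adm w'" and le: "\<And>s y. 0 \<le> s \<Longrightarrow> w s y \<le> w' s y"
  shows "Q w t x \<le> Q w' t x"
  unfolding Q_def
proof (rule integral_mono[OF adm_Q_integrable[OF w] adm_Q_integrable[OF w']])
  fix r
  show "indicator {0..<t} r * S (t - r) (\<lambda>y. w r y powr p) x \<le> indicator {0..<t} r * S (t - r) (\<lambda>y. w' r y powr p) x"
  proof (cases "0 \<le> r \<and> r < t")
    case True
    have [measurable]: "w r \<in> borel_measurable borel" "w' r \<in> borel_measurable borel"
      using adm_meas[OF w] adm_meas[OF w'] by auto
    have "S (t - r) (\<lambda>y. w r y powr p) x \<le> S (t - r) (\<lambda>y. w' r y powr p) x"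
      using True adm_powr_le_M[OF w] adm_powr_le_M[OF w'] adm_nonneg[OF w] le p
      by (intro S_mono integrable_ker_mult_bounded[where M=M] AE_I2 powr_mono2) auto
    thus ?thesis using True by simp
  qed (auto simp: indicator_def)
qed

section \<open>Monotone iteration\<close>

primrec U :: "nat \<Rightarrow> real \<Rightarrow> 'a \<Rightarrow> real" where
  "U 0 = (\<lambda>t x. 0)"
| "U (Suc n) = (\<lambda>t x. \<epsilon> * V t x + Q (U n) t x)"

definition u :: "real \<Rightarrow> 'a \<Rightarrow> real" where "u t x = lim (\<lambda>n. U n t x)"

lemma adm_U: "adm (U n)"
proof (induction n)
  case 0
  then show ?case using eps V_nonneg by (simp add: adm_def)
next
  case (Suc n)
  have "(\<lambda>z. Q (U n) (fst z) (snd z)) \<in> borel_measurable (borel \<Otimes>\<^sub>M borel)"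
  proof -
    have "(\<lambda>q. case ((\<lambda>(z, r). (fst z, snd z, r)) q) of (t, x, r) \<Rightarrow> S (t - r) (\<lambda>y. U n r y powr p) x)
        \<in> borel_measurable ((borel \<Otimes>\<^sub>M borel) \<Otimes>\<^sub>M lborel)"
      by (rule measurable_compose[OF _ adm_S_meas[OF Suc]]) measurable
    hence [measurable]: "(\<lambda>q. S (fst (fst q) - snd q) (\<lambda>y. U n (snd q) y powr p) (snd (fst q))) \<in> borel_measurable ((borel \<Otimes>\<^sub>M borel) \<Otimes>\<^sub>M lborel)"
      by (simp add: case_prod_beta')
    have "(\<lambda>q. indicator {0..<fst (fst q)} (snd q) * S (fst (fst q) - snd q) (\<lambda>y. U n (snd q) y powr p) (snd (fst q)))
        \<in> borel_measurable ((borel \<Otimes>\<^sub>M borel) \<Otimes>\<^sub>M lborel)"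
    proof -
      have "(\<lambda>q::(real \<times> 'a) \<times> real. indicator {0..<fst (fst q)} (snd q) :: real) \<in> borel_measurable ((borel \<Otimes>\<^sub>M borel) \<Otimes>\<^sub>M lborel)"
        unfolding indicator_def atLeastLessThan_iff by measurable
      thus ?thesis by measurable
    qed
    thus ?thesis unfolding Q_def
      by (intro sigma_finite_measure.borel_measurable_lebesgue_integral sigma_finite_lborel) (simp add: case_prod_beta')
  qed
  hence "(\<lambda>(s, y). U (Suc n) s y) \<in> borel_measurable (borel \<Otimes>\<^sub>M borel)"
    by (simp add: V_def case_prod_beta')
  moreover have "0 \<le> U (Suc n) s y \<and> U (Suc n) s y \<le> 2 * \<epsilon> * V s y" if "0 \<le> s" for s y
    using Q_bounds[OF Suc that, of y] V_nonneg[OF that, of y] eps by (simp add: add_nonneg_nonneg)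
  ultimately show ?case by (simp only: adm_def simp_thms) simp
qed

text \<open>The iteration starts from 0, so its first step goes up, and \<open>Q_mono\<close>
  propagates this.\<close>

lemma U_mono: "0 \<le> s \<Longrightarrow> U n s y \<le> U (Suc n) s y"
proof (induction n arbitrary: s y)
  case 0
  then show ?case using adm_nonneg[OF adm_U, of s "Suc 0" y] by simp
next
  case (Suc n)
  show ?case using Q_mono[OF adm_U adm_U, of n "Suc n" s y] Suc.IH by simp
qed

lemma U_lim:
  assumes "0 \<le> s"
  shows "(\<lambda>n. U n s y) \<longlonglongrightarrow> u s y"
proof -
  have "convergent (\<lambda>n. U n s y)"
  proof (rule Bseq_monoseq_convergent)
    show "monoseq (\<lambda>n. U n s y)" using U_mono[OF assms] by (auto simp: monoseq_Suc)
    show "Bseq (\<lambda>n. U n s y)"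
      using adm_U by (intro BseqI'[of _ "2 * \<epsilon> * V s y"]) (auto simp: adm_def assms)
  qed
  thus ?thesis unfolding u_def by (simp add: convergent_LIMSEQ_iff)
qed

lemma adm_u: "adm u"
  unfolding adm_def
proof (intro conjI allI impI)
  have "(\<lambda>z. U n (fst z) (snd z)) \<in> borel_measurable (borel \<Otimes>\<^sub>M borel)" for n
    using adm_U[of n] by (simp add: adm_def case_prod_beta')
  thus "(\<lambda>(s, y). u s y) \<in> borel_measurable (borel \<Otimes>\<^sub>M borel)"
    unfolding u_def case_prod_beta' by measurable
  fix s :: real and y assume s: "0 \<le> s"
  show "0 \<le> u s y" using adm_nonneg[OF adm_U s] by (intro LIMSEQ_le_const[OF U_lim[OF s]]) auto
  show "u s y \<le> 2 * \<epsilon> * V s y" using adm_U s by (intro LIMSEQ_le_const2[OF U_lim[OF s]]) (auto simp: adm_def)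
qed

lemma S_U_lim:
  assumes r: "0 \<le> r" "r < t"
  shows "(\<lambda>n. S (t - r) (\<lambda>y. U n r y powr p) x) \<longlonglongrightarrow> S (t - r) (\<lambda>y. u r y powr p) x"
  unfolding S_def
proof (rule integral_dominated_convergence[where w="\<lambda>y. M * ker (t - r) (t - r) (x - y)"])
  have [measurable]: "U n r \<in> borel_measurable borel" "u r \<in> borel_measurable borel" for n
    using adm_meas[OF adm_U] adm_meas[OF adm_u] by auto
  show "(\<lambda>y. ker (t - r) (t - r) (x - y) * U n r y powr p) \<in> borel_measurable lborel" 
    "(\<lambda>y. ker (t - r) (t - r) (x - y) * u r y powr p) \<in> borel_measurable lborel" for n by measurable
  show "integrable lborel (\<lambda>y. M * ker (t - r) (t - r) (x - y))"
    using integrable_ker_translate[of "t - r" "t - r" x] r by simp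
  show "AE y in lborel. (\<lambda>n. ker (t - r) (t - r) (x - y) * U n r y powr p) \<longlonglongrightarrow> ker (t - r) (t - r) (x - y) * u r y powr p"
    using adm_nonneg[OF adm_U r(1)] p
    by (intro AE_I2 tendsto_mult tendsto_const tendsto_powr' U_lim r) auto
  show "AE y in lborel. norm (ker (t - r) (t - r) (x - y) * U n r y powr p) \<le> M * ker (t - r) (t - r) (x - y)" for n
  proof (rule AE_I2)
    fix y
    have "0 \<le> ker (t - r) (t - r) (x - y)" using r by (intro ker_nonneg) auto
    thus "norm (ker (t - r) (t - r) (x - y) * U n r y powr p) \<le> M * ker (t - r) (t - r) (x - y)"
      using adm_powr_le_M[OF adm_U r(1), of n y] by (simp add: abs_mult mult.commute mult_right_mono)
  qed
qed

lemma Q_U_lim: "(\<lambda>n. Q (U n) t x) \<longlonglongrightarrow> Q u t x"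
  unfolding Q_def
proof (rule integral_dominated_convergence[where w="\<lambda>r. M * indicator {0..<t} r"])
  show "integrable lborel (\<lambda>r. M * indicator {0..<t} r)"
    by (intro integrable_mult_right integrable_indicator_subset_Icc[where a=0 and b=t]) auto
  show "(\<lambda>r. indicator {0..<t} r * S (t - r) (\<lambda>y. u r y powr p) x) \<in> borel_measurable lborel"
    using adm_Q_integrable[OF adm_u] by blast
  show "(\<lambda>r. indicator {0..<t} r * S (t - r) (\<lambda>y. U n r y powr p) x) \<in> borel_measurable lborel" for n
    using adm_Q_integrable[OF adm_U] by blast
  show "AE r in lborel. (\<lambda>n. indicator {0..<t} r * S (t - r) (\<lambda>y. U n r y powr p) x)
      \<longlonglongrightarrow> indicator {0..<t} r * S (t - r) (\<lambda>y. u r y powr p) x"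
    using S_U_lim by (auto simp: indicator_def)
  show "AE r in lborel. norm (indicator {0..<t} r * S (t - r) (\<lambda>y. U n r y powr p) x) \<le> M * indicator {0..<t} r" for n
    using adm_S_bounds[OF adm_U] by (auto simp: indicator_def)
qed

lemma u_eq:
  assumes "0 \<le> t"
  shows "u t x = \<epsilon> * V t x + Q u t x"
proof (rule LIMSEQ_unique)
  show "(\<lambda>n. U (Suc n) t x) \<longlonglongrightarrow> u t x" using U_lim[OF assms] by (rule LIMSEQ_Suc)
  show "(\<lambda>n. U (Suc n) t x) \<longlonglongrightarrow> \<epsilon> * V t x + Q u t x"
    unfolding U.simps by (intro tendsto_intros Q_U_lim)
qed

section \<open>Continuity in time and Duhamel's formula for the limit\<close>

definition kdiff :: "real \<Rightarrow> real \<Rightarrow> real" where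
  "kdiff h r = (\<integral>y. \<bar>ker (r + h) (r + h) y - ker r r (y::'a)\<bar> \<partial>lborel)"

lemma kdiff_meas [measurable]: "kdiff h \<in> borel_measurable borel"
  unfolding kdiff_def by measurable

lemma kdiff_bounds:
  assumes "0 < r" "0 \<le> h"
  shows "0 \<le> kdiff h r" "kdiff h r \<le> 2"
proof -
  show "0 \<le> kdiff h r" unfolding kdiff_def by (intro Bochner_Integration.integral_nonneg) auto
  have "kdiff h r \<le> (\<integral>y. ker (r + h) (r + h) y + ker r r (y::'a) \<partial>lborel)"
    unfolding kdiff_def
  proof (rule integral_mono)
    fix y :: 'a
    have "0 \<le> ker (r + h) (r + h) y" "0 \<le> ker r r y" using assms by (auto intro!: ker_nonneg)
    thus "\<bar>ker (r + h) (r + h) y - ker r r y\<bar> \<le> ker (r + h) (r + h) y + ker r r y" by linarith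
  qed (use assms integrable_ker[where 'a='a] in auto)
  also have "\<dots> = 2" using assms integrable_ker[where 'a='a] integral_ker[where 'a='a] by simp
  finally show "kdiff h r \<le> 2" .
qed

text \<open>For each fixed \<open>r > 0\<close> this is \<open>tendsto_ker_L1\<close>. As
  \<open>r\<close> approaches 0 the kernels concentrate and uniformity is lost, so dominated
  convergence in \<open>r\<close> with the bound 2 is used.\<close>

lemma tendsto_integral_kdiff:
  assumes h: "h \<longlonglongrightarrow> 0" "\<And>n. 0 \<le> h n"
  shows "(\<lambda>n. \<integral>r. indicator {0<..T} r * kdiff (h n) r \<partial>lborel) \<longlonglongrightarrow> 0"
proof -
  have "(\<lambda>n. \<integral>r. indicator {0<..T} r * kdiff (h n) r \<partial>lborel) \<longlonglongrightarrow> (\<integral>r. (0::real) \<partial>(lborel :: real measure))"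
  proof (rule integral_dominated_convergence[where w="\<lambda>r. 2 * indicator {0<..T} r"])
    show "integrable lborel (\<lambda>r. 2 * indicator {0<..T} r :: real)"
      by (intro integrable_mult_right integrable_indicator_subset_Icc[where a=0 and b=T]) auto
    show "AE r in lborel. (\<lambda>n. indicator {0<..T} r * kdiff (h n) r) \<longlonglongrightarrow> 0"
    proof (rule AE_I2)
      fix r :: real
      show "(\<lambda>n. indicator {0<..T} r * kdiff (h n) r) \<longlonglongrightarrow> 0"
      proof (cases "0 < r")
        case True
        have "(\<lambda>n. r + h n) \<longlonglongrightarrow> r + 0" by (intro tendsto_intros h)
        hence "(\<lambda>n. kdiff (h n) r) \<longlonglongrightarrow> 0"
          unfolding kdiff_def using True h(2)
          by (intro tendsto_ker_L1) (auto intro: add_pos_nonneg add_nonneg_nonneg simp: less_imp_le)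
        thus ?thesis by (rule tendsto_mult_right_zero)
      qed (simp add: indicator_def)
    qed
    show "AE r in lborel. norm (indicator {0<..T} r * kdiff (h n) r) \<le> 2 * indicator {0<..T} r" for n
      using kdiff_bounds[OF _ h(2)] by (auto simp: indicator_def abs_of_nonneg)
  qed measurable
  thus ?thesis by simp
qed

text \<open>Source times in \<open>{s..<t}\<close> occur in only one integral and cost at most
  \<open>M\<close> each. For earlier times the kernels at \<open>t - r\<close> and
  \<open>s - r\<close> are compared, and r -> s - r turns the cost into an integral of
  \<open>kdiff (t - s)\<close>. The bound is uniform in \<open>x\<close>, and \<open>T\<close> frees
  the domain of integration from the varying \<open>s\<close>.\<close>

lemma Q_diff_le:
  assumes s: "0 \<le> s" and st: "s \<le> t" and T: "s \<le> T"
  shows "\<bar>Q u t x - Q u s x\<bar> \<le> M * (t - s) + M * (\<integral>r. indicator {0<..T} r * kdiff (t - s) r \<partial>lborel)"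
proof -
  let ?S = "\<lambda>t r. S (t - r) (\<lambda>y. u r y powr p) x"
  have ik: "integrable lborel (\<lambda>r. indicator {0<..T} r * kdiff (t - s) r)"
  proof (rule Bochner_Integration.integrable_bound)
    show "integrable lborel (\<lambda>r. 2 * indicator {0<..T} r :: real)"
      by (intro integrable_mult_right integrable_indicator_subset_Icc[where a=0 and b=T]) auto
    show "AE r in lborel. norm (indicator {0<..T} r * kdiff (t - s) r) \<le> norm (2 * indicator {0<..T} r :: real)"
      using kdiff_bounds[of _ "t - s"] st by (auto simp: indicator_def abs_of_nonneg)
  qed measurable
  have ik': "integrable lborel (\<lambda>r. indicator {0<..T} (s - r) * kdiff (t - s) (s - r))"
    using integrable_lborel_affine[OF _ ik, of "-1" s] by simp
  have eqk: "(\<integral>r. indicator {0<..T} (s - r) * kdiff (t - s) (s - r) \<partial>lborel) = (\<integral>r. indicator {0<..T} r * kdiff (t - s) r \<partial>lborel)"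
    using integral_lborel_affine[of "-1" "\<lambda>r. indicator {0<..T} r * kdiff (t - s) r" s] by simp
  have ii: "integrable lborel (\<lambda>r. M * indicator {s..<t} r)"
    by (intro integrable_mult_right integrable_indicator_subset_Icc[where a=s and b=t]) auto
  have "\<bar>Q u t x - Q u s x\<bar> = \<bar>\<integral>r. indicator {0..<t} r * ?S t r - indicator {0..<s} r * ?S s r \<partial>lborel\<bar>"
    unfolding Q_def using adm_Q_integrable[OF adm_u] by simp
  also have "\<dots> \<le> (\<integral>r. \<bar>indicator {0..<t} r * ?S t r - indicator {0..<s} r * ?S s r\<bar> \<partial>lborel)"
    by (rule integral_abs_bound)
  also have "\<dots> \<le> (\<integral>r. M * indicator {s..<t} r + M * (indicator {0<..T} (s - r) * kdiff (t - s) (s - r)) \<partial>lborel)"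
  proof (rule integral_mono)
    show "integrable lborel (\<lambda>r. \<bar>indicator {0..<t} r * ?S t r - indicator {0..<s} r * ?S s r\<bar>)"
      using adm_Q_integrable[OF adm_u] by simp
    show "integrable lborel (\<lambda>r. M * indicator {s..<t} r + M * (indicator {0<..T} (s - r) * kdiff (t - s) (s - r)))"
      using ii ik' by simp
    fix r :: real
    consider "r < 0 \<or> t \<le> r" | "0 \<le> r" "r < s" | "s \<le> r" "r < t" by linarith
    thus "\<bar>indicator {0..<t} r * ?S t r - indicator {0..<s} r * ?S s r\<bar>
       \<le> M * indicator {s..<t} r + M * (indicator {0<..T} (s - r) * kdiff (t - s) (s - r))"
    proof cases
      case 1
      hence z: "indicator {0..<t} r = (0::real)" "indicator {0..<s} r = (0::real)" using st by (auto simp: indicator_def)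
      have "0 \<le> indicator {0<..T} (s - r) * kdiff (t - s) (s - r)"
        using kdiff_bounds(1)[of "s - r" "t - s"] st by (auto simp: indicator_def)
      thus ?thesis using M_nonneg z by simp
    next
      case 2
      have ur: "u r \<in> borel_measurable borel" by (rule adm_meas[OF adm_u])
      have b: "AE y in lborel. \<bar>u r y powr p\<bar> \<le> M" using adm_powr_le_M[OF adm_u 2(1)] by simp
      have "\<bar>?S t r - ?S s r\<bar> \<le> 0 + M * (\<integral>y. \<bar>ker (t - r) (t - r) y - ker (s - r) (s - r) (y::'a)\<bar> \<partial>lborel)"
        using 2 st b ur by (intro S_diff_le) auto
      also have "(\<integral>y. \<bar>ker (t - r) (t - r) y - ker (s - r) (s - r) (y::'a)\<bar> \<partial>lborel) = kdiff (t - s) (s - r)"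
        by (simp add: kdiff_def)
      finally show ?thesis using 2 st T M_nonneg by (simp add: indicator_def)
    next
      case 3
      have "0 \<le> r" using 3 s by simp
      thus ?thesis using adm_S_bounds[OF adm_u _ 3(2), of x] 3 s by (simp add: indicator_def)
    qed
  qed
  also have "\<dots> = M * (t - s) + M * (\<integral>r. indicator {0<..T} r * kdiff (t - s) r \<partial>lborel)"
    using ii ik' eqk st by simp
  finally show ?thesis .
qed

lemma u_meas: "u t \<in> borel_measurable borel"
  by (rule adm_meas[OF adm_u])

lemma u_in_Linf:
  assumes "0 \<le> t"
  shows "u t \<in> Linf"
proof -
  have "\<bar>u t x\<bar> \<le> 2 * \<epsilon> * V 0 0" for x
  proof -
    have "u t x \<le> 2 * \<epsilon> * V t x" "0 \<le> u t x" using adm_u assms by (auto simp: adm_def)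
    moreover have "2 * \<epsilon> * V t x \<le> 2 * \<epsilon> * V 0 0" using eps assms by (intro mult_left_mono V_le_V00) auto
    ultimately show ?thesis by simp
  qed
  hence "Linf_norm (u t) \<le> ereal (2 * \<epsilon> * V 0 0)" by (intro Linf_norm_le u_meas) auto
  thus ?thesis unfolding Linf_def using u_meas by (auto intro: le_less_trans)
qed

lemma u_continuous:
  assumes t: "0 \<le> t"
  shows "((\<lambda>s. Linf_norm (\<lambda>x. u s x - u t x)) \<longlongrightarrow> 0) (at t within {0..})"
  unfolding tendsto_at_iff_sequentially comp_def
proof (intro allI impI)
  fix X assume X: "\<forall>i. X i \<in> {0..} - {t}" and lim: "X \<longlonglongrightarrow> t"
  have X0: "0 \<le> X n" for n using X by auto
  define E where "E n = (\<integral>\<xi>. \<bar>symb (1 + X n) (X n) \<xi> - symb (1 + t) t (\<xi>::'a)\<bar> \<partial>lborel) / (2 * pi) ^ DIM('a)" for n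
  define W where "W n = (\<integral>r. indicator {0<..t} r * kdiff \<bar>X n - t\<bar> r \<partial>lborel)" for n
  define b where "b n = \<epsilon> * E n + (M * \<bar>X n - t\<bar> + M * W n)" for n
  have h: "(\<lambda>n. \<bar>X n - t\<bar>) \<longlonglongrightarrow> 0" using lim by (simp add: LIM_zero tendsto_rabs_zero_iff)
  have "E \<longlonglongrightarrow> 0"
    unfolding E_def using t X0 by (intro tendsto_divide_zero tendsto_symb_L1 tendsto_intros lim) auto
  moreover have "W \<longlonglongrightarrow> 0" unfolding W_def by (intro tendsto_integral_kdiff h) auto
  ultimately have "b \<longlonglongrightarrow> \<epsilon> * 0 + (M * 0 + M * 0)"
    unfolding b_def by (intro tendsto_intros h)
  hence b: "(\<lambda>n. ereal (b n)) \<longlonglongrightarrow> 0" by (simp add: zero_ereal_def)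
  have "\<bar>u (X n) x - u t x\<bar> \<le> b n" for n x
  proof -
    have "\<bar>V (X n) x - V t x\<bar> \<le> E n"
      unfolding V_def E_def using X0[of n] t by (intro ker_diff_le) auto
    hence "\<epsilon> * \<bar>V (X n) x - V t x\<bar> \<le> \<epsilon> * E n" using eps by (intro mult_left_mono) auto
    hence "\<bar>\<epsilon> * V (X n) x - \<epsilon> * V t x\<bar> \<le> \<epsilon> * E n"
      using eps by (simp add: right_diff_distrib[symmetric] abs_mult)
    \<comment> \<open>In either order the smaller of the two times is at most \<open>t\<close>, so
      \<open>W n\<close>, with horizon \<open>t\<close>, serves both cases.\<close>
    moreover have "\<bar>Q u (X n) x - Q u t x\<bar> \<le> M * \<bar>X n - t\<bar> + M * W n"
    proof (cases "X n \<le> t")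
      case True
      thus ?thesis using Q_diff_le[OF X0 True True, of x] by (simp add: W_def abs_minus_commute)
    next
      case False
      thus ?thesis using Q_diff_le[OF t, of "X n" t x] by (simp add: W_def)
    qed
    ultimately show ?thesis unfolding b_def u_eq[OF X0] u_eq[OF t] by linarith
  qed
  hence le: "Linf_norm (\<lambda>x. u (X n) x - u t x) \<le> ereal (b n)" for n
    using u_meas by (intro Linf_norm_le) auto
  show "(\<lambda>n. Linf_norm (\<lambda>x. u (X n) x - u t x)) \<longlonglongrightarrow> 0"
    by (rule tendsto_sandwich[OF _ _ tendsto_const b]) (auto simp: le Linf_norm_nonneg)
qed

lemma u_duhamel:
  assumes t: "0 \<le> t"
  shows "u t x = mixed_semigroup \<sigma> t u0 x + (LINT s:{0..t}|lborel. mixed_semigroup \<sigma> (t - s) (\<lambda>y. u s y powr p) x)"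
proof -
  have "mixed_semigroup \<sigma> t u0 x = \<epsilon> * V t x"
  proof (cases "t = 0")
    case False
    have "mixed_semigroup \<sigma> t u0 x = S t u0 x" using False t by (simp add: mixed_semigroup_eq)
    also have "\<dots> = \<epsilon> * S t (V 0) x"
      unfolding S_def u0_eq V_def
      by (simp only: mult.left_commute[of _ \<epsilon>] integral_mult_right_zero add_0_right)
    also have "\<dots> = \<epsilon> * V t x" using S_V[of t 0 x] False t by simp
    finally show ?thesis .
  qed (simp add: mixed_semigroup_def u0_eq V_def)
  moreover have "(LINT s:{0..t}|lborel. mixed_semigroup \<sigma> (t - s) (\<lambda>y. u s y powr p) x) = Q u t x"
    unfolding Q_def set_lebesgue_integral_def
  proof (rule integral_cong_AE)
    have 1: "(\<lambda>s. indicator {0..<t} s * S (t - s) (\<lambda>y. u s y powr p) x) \<in> borel_measurable lborel"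
      using adm_Q_integrable[OF adm_u] by blast
    show "(\<lambda>s. indicator {0..<t} s * S (t - s) (\<lambda>y. u s y powr p) x) \<in> borel_measurable lborel" by fact
    have "(\<lambda>s. indicator {0..t} s *\<^sub>R mixed_semigroup \<sigma> (t - s) (\<lambda>y. u s y powr p) x)
      = (\<lambda>s. if s = t then u t x powr p else indicator {0..<t} s * S (t - s) (\<lambda>y. u s y powr p) x)"
      using t by (auto simp: fun_eq_iff indicator_def mixed_semigroup_eq mixed_semigroup_def[of \<sigma> 0])
    thus "(\<lambda>s. indicator {0..t} s *\<^sub>R mixed_semigroup \<sigma> (t - s) (\<lambda>y. u s y powr p) x) \<in> borel_measurable lborel"
      using 1 by simp
    show "AE s in lborel. indicator {0..t} s *\<^sub>R mixed_semigroup \<sigma> (t - s) (\<lambda>y. u s y powr p) x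
       = indicator {0..<t} s * S (t - s) (\<lambda>y. u s y powr p) x"
      using AE_lborel_singleton[of t] by eventually_elim (auto simp: indicator_def mixed_semigroup_eq)
  qed
  ultimately show ?thesis using u_eq[OF t] by simp
qed

theorem has_global_solution: "has_global_solution \<sigma> p u0"
  unfolding has_global_solution_def mild_solution_infinity_iff
  using u_in_Linf u_continuous u_duhamel adm_nonneg[OF adm_u] by (intro exI[of _ u]) auto

lemma u0_admissible: "u0 \<in> C0" "integrable lborel u0" "0 < u0 x"
proof -
  have eq: "u0 = (\<lambda>x. \<epsilon> * ((4 * pi * 1) powr (- (DIM('a) / 2)) * exp (- (norm x)\<^sup>2 / (4 * 1))))"
    unfolding u0_eq by (subst ker_gaussian) auto
  show "0 < u0 x" using eps by (simp add: eq)
  show "integrable lborel u0" unfolding u0_eq using integrable_ker[of 1 0, where 'a='a] by simp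
  have "((\<lambda>r::real. exp (- r\<^sup>2 / (4 * 1))) \<longlongrightarrow> 0) at_top" by real_asymp
  from filterlim_compose[OF this filterlim_norm_at_top]
  have "((\<lambda>x::'a. exp (- (norm x)\<^sup>2 / (4 * 1))) \<longlongrightarrow> 0) at_infinity" .
  hence "(u0 \<longlongrightarrow> \<epsilon> * ((4 * pi * 1) powr (- (DIM('a) / 2)) * 0)) at_infinity"
    unfolding eq by (intro tendsto_intros)
  moreover have "continuous_on UNIV u0" unfolding eq by (intro continuous_intros) auto
  ultimately show "u0 \<in> C0" by (simp add: C0_def)
qed

end

section \<open>Choice of the small datum\<close>

lemma (in mixed_diffusion) integrable_ker_decay:
  assumes p: "1 + 2 * \<sigma> / DIM('a) < p"
  shows "integrable lborel (\<lambda>s. indicator {0..} s * ker (1 + s) s (0::'a::euclidean_space) powr (p - 1))"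
proof -
  define q where "q = DIM('a) / (2 * \<sigma>)"
  have pq: "q * (p - 1) > 1" using p sigma_pos by (simp add: q_def field_simps)
  have p1: "p > 1" using p sigma_pos by (smt (verit) divide_nonneg_nonneg of_nat_0_le_iff)
  define C where "C = ker 0 1 (0::'a) powr (p - 1)"
  define D where "D = ker 1 0 (0::'a) powr (p - 1)"
  have int2: "integrable lborel (\<lambda>s. indicator {1..} s * s powr (- q * (p - 1)))"
  proof (rule integrableI_nonneg)
    have "((\<lambda>x. x powr (- q * (p - 1))) has_integral - (1 powr (- q * (p - 1) + 1)) / (- q * (p - 1) + 1)) {1..}"
      using pq by (intro has_integral_powr_to_inf) auto
    hence "((\<lambda>x. if x \<in> {1..} then x powr (- q * (p - 1)) else 0) has_integral - (1 powr (- q * (p - 1) + 1)) / (- q * (p - 1) + 1)) UNIV"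
      by (subst has_integral_restrict_UNIV)
    moreover have "(\<lambda>x. if x \<in> {1..} then x powr (- q * (p - 1)) else 0) = (\<lambda>s. indicator {1..} s * s powr (- q * (p - 1)))"
      by (auto simp: indicator_def)
    ultimately show "(\<integral>\<^sup>+s. ennreal (indicator {1..} s * s powr (- q * (p - 1))) \<partial>lborel) < \<infinity>"
      using nn_integral_has_integral_lborel[of "\<lambda>s. indicator {1..} s * s powr (- q * (p - 1))"] by simp
  qed auto
  show ?thesis
  proof (rule Bochner_Integration.integrable_bound)
    show "integrable lborel (\<lambda>s. D * indicator {0..1} s + C * (indicator {1..} s * s powr (- q * (p - 1))))"
      by (intro Bochner_Integration.integrable_add integrable_mult_right int2 integrable_real_indicator)
        (auto simp: emeasure_lborel_Icc_eq)
    show "AE s in lborel. norm (indicator {0..} s * ker (1 + s) s (0::'a) powr (p - 1))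
       \<le> norm (D * indicator {0..1} s + C * (indicator {1..} s * s powr (- q * (p - 1))))"
    proof (rule AE_I2)
      fix s :: real
      \<comment> \<open>The Gaussian datum shifts the Laplacian time to \<open>1 + s\<close>, so the
        kernel is bounded near \<open>s = 0\<close>; beyond 1 the fractional decay is integrable
        because \<open>q * (p - 1) > 1\<close>.\<close>
      consider "s < 0" | "0 \<le> s" "s \<le> 1" | "1 < s" by linarith
      thus "norm (indicator {0..} s * ker (1 + s) s (0::'a) powr (p - 1))
       \<le> norm (D * indicator {0..1} s + C * (indicator {1..} s * s powr (- q * (p - 1))))"
      proof cases
        case 2
        have "ker (1 + s) s (0::'a) powr (p - 1) \<le> D"
          unfolding D_def using 2 p1 by (intro powr_mono2 ker_0_antimono ker_nonneg) auto
        moreover have "0 \<le> C * (indicator {1..} s * s powr (- q * (p - 1)))" by (simp add: C_def)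
        ultimately show ?thesis using 2 by simp
      next
        case 3
        have "ker (1 + s) s (0::'a) powr (p - 1) \<le> (ker 0 1 (0::'a) * s powr (- q)) powr (p - 1)"
          using ker_upper_bound[of s "1 + s" "0::'a"] 3 p1 unfolding q_def
          by (intro powr_mono2 ker_nonneg) auto
        also have "\<dots> = C * s powr (- q * (p - 1))"
        proof -
          have "0 \<le> ker 0 1 (0::'a)" unfolding ker_def
            by (intro divide_nonneg_pos Bochner_Integration.integral_nonneg) auto
          thus ?thesis by (simp add: C_def powr_mult powr_powr)
        qed
        finally show ?thesis using 3 by simp
      qed simp
    qed
  qed measurable
qed

lemma (in mixed_diffusion) small_gaussian_exists:
  assumes p: "1 + 2 * \<sigma> / DIM('a) < p"
  shows "\<exists>\<epsilon>. small_gaussian \<sigma> p \<epsilon> (\<lambda>x::'a::euclidean_space. \<epsilon> * ker 1 0 x)"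
proof -
  define B where "B = (\<integral>s. indicator {0..} s * ker (1 + s) s (0::'a) powr (p - 1) \<partial>lborel)"
  have B: "0 \<le> B" unfolding B_def by (intro Bochner_Integration.integral_nonneg) auto
  have p1: "p > 1" using p sigma_pos by (smt (verit) divide_nonneg_nonneg of_nat_0_le_iff)
  \<comment> \<open>Chosen with \<open>2 powr p * e powr (p - 1) * (B + 1) = 1\<close>, so that the
    left side of \<open>small\<close> is \<open>e * (B / (B + 1))\<close>. Using
    \<open>B + 1\<close> avoids dividing by a possibly zero \<open>B\<close>.\<close>
  define e where "e = (1 / (2 powr p * (B + 1))) powr (1 / (p - 1))"
  have e: "0 < e" using B by (simp add: e_def)
  have "e powr (p - 1) = 1 / (2 powr p * (B + 1))" using B p1 by (simp add: e_def powr_powr)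
  moreover have "e powr p = e powr (p - 1) * e" using e by (simp add: powr_diff)
  ultimately have "(2 * e) powr p * B = e * (B / (B + 1))" using B e
    by (simp add: powr_mult divide_simps, simp add: mult_ac)
  also have "\<dots> \<le> e * 1" using B e by (intro mult_left_mono) auto
  finally have "small_gaussian \<sigma> p e (\<lambda>x::'a. e * ker 1 0 x)"
    by unfold_locales (use p1 e integrable_ker_decay[OF p] in \<open>auto simp: B_def\<close>)
  thus ?thesis by blast
qed

theorem corollary1p4:
  fixes \<sigma> p :: real
  assumes "0 < \<sigma>" and "\<sigma> < 1" and "1 < p"
  shows "(\<forall>u0 :: 'a::euclidean_space \<Rightarrow> real.
            u0 \<in> C0 \<and> integrable lborel u0 \<and> (\<forall>x. 0 < u0 x) \<longrightarrow> \<not> has_global_solution \<sigma> p u0)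
         \<longleftrightarrow> 1 < p \<and> p \<le> 1 + 2 * \<sigma> / real DIM('a)"
proof -
  interpret mixed_diffusion \<sigma> by standard (use assms in auto)
  show ?thesis
  proof (intro iffI allI impI notI conjI)
    assume no: "\<forall>u0 :: 'a \<Rightarrow> real. u0 \<in> C0 \<and> integrable lborel u0 \<and> (\<forall>x. 0 < u0 x) \<longrightarrow> \<not> has_global_solution \<sigma> p u0"
    show "p \<le> 1 + 2 * \<sigma> / real DIM('a)"
    proof (rule ccontr)
      assume "\<not> p \<le> 1 + 2 * \<sigma> / real DIM('a)"
      then obtain e where "small_gaussian \<sigma> p e (\<lambda>x::'a. e * ker 1 0 x)"
        using small_gaussian_exists[of p, where 'a='a] by auto
      then interpret small_gaussian \<sigma> p e "\<lambda>x::'a. e * ker 1 0 x" .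
      show False using no u0_admissible has_global_solution by blast
    qed
  next
    fix u0 :: "'a \<Rightarrow> real"
    assume pF: "1 < p \<and> p \<le> 1 + 2 * \<sigma> / real DIM('a)"
      and u0: "u0 \<in> C0 \<and> integrable lborel u0 \<and> (\<forall>x. 0 < u0 x)" and "has_global_solution \<sigma> p u0"
    then obtain u where "mild_solution \<sigma> p u0 \<infinity> u" by (auto simp: has_global_solution_def)
    then interpret global_mild \<sigma> p u0 u
      using assms u0 by (intro global_mild_of_mild_solution) auto
    show False using supercritical pF by simp
  qed (use assms in simp)
qed

end
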